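(* Let $A,\theta,\eta$ satisfy (H1)--(H3) and let $f_1,f_2$ each satisfy (H4), where (H1)--(H4) are listed in the context. Let $v_1$ and $v_2$ be two entropy weak solutions (in the sense defined in the context) of $\eta(x,v)_t+\operatorname{div}A(v)=f$ with right-hand sides $f_1$ and $f_2$ respectively. Then: 1. For all nonnegative $\psi\in\mathcal D(\mathbb{R}_+\times\mathbb{R}^N)$ $$\begin{aligned}&\int_{\mathbb{R}_+\times\mathbb{R}^N}|\eta(x,v_1)-\eta(x,v_2)|\,\psi_t\,dx\,dt+\int_{\mathbb{R}_+\times\mathbb{R}^N}\operatorname{sgn}(v_1-v_2)(A(v_1)-A(v_2))\cdot\nabla\psi\,dx\,dt\\&+\int_{\mathbb{R}_+\times\mathbb{R}^N}\operatorname{sgn}(v_1-v_2)(f_1(t,x,v_1)-f_2(t,x,v_2))\psi\,dx\,dt\ \ge\ -\int_{\{(t,x):v_1=v_2\}}|f_1(t,x,v_1)-f_2(t,x,v_2)|\psi\,dx\,dt.\end{aligned}$$ 2. For all nonnegative $\psi\in\mathcal D(\mathbb{R}_+\times\mathbb{R}^N)$ $$\begin{aligned}&\int_{\mathbb{R}_+\times\mathbb{R}^N}(\eta(x,v_1)-\eta(x,v_2))^+\psi_t\,dx\,dt+\int_{\mathbb{R}_+\times\mathbb{R}^N}\chi_{\{v_1>v_2\}}(A(v_1)-A(v_2))\cdot\nabla\psi\,dx\,dt\\&+\int_{\mathbb{R}_+\times\mathbb{R}^N}\chi_{\{v_1>v_2\}}(f_1(t,x,v_1)-f_2(t,x,v_2))\psi\,dx\,dt\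 \ge\ -\int_{\{(t,x):v_1=v_2\}}(f_1(t,x,v_1)-f_2(t,x,v_2))^+\psi\,dx\,dt.\end{aligned}$$
   Context: Notation: $N\ge1$, $\mathbb{R}_+=(0,\infty)$; $\mathcal D(\Omega)$ is the set of smooth functions with compact support in $\Omega$; $r^+=\max(r,0)$; $\operatorname{sgn}0=0$; $\chi$ denotes indicator functions; $L^1_{loc}(\mathbb{R}_+\times\mathbb{R}^N)$ means integrable on $(0,T)\times K$ for all $T>0$ and compact $K\subset\mathbb{R}^N$; $\operatorname{div},\nabla$ are with respect to $x$. Assumptions: (H1) $A:\mathbb{R}\to\mathbb{R}^N$ is continuous and $\theta:\mathbb{R}^N\times\mathbb{R}\to2^{\mathbb{R}}\setminus\{\emptyset\}$ is a multi-valued mapping such that for almost every $x\in\mathbb{R}^N$, $\theta(x,\cdot)$ is a maximal monotone operator with $0\in\theta(x,0)$. The inverse of $\theta$ with respect to $u$, denoted $\eta$ (so $u=\eta(x,s)$ iff $s\in\theta(x,u)$), is single-valued and continuous in its second argument. Moreover $\theta^*(\cdot,l)\in L^1_{loc}(\mathbb{R}^N)$ for each $l\in\mathbb{R}$, where $\theta^*(x,l)$ is the element of $\theta(x,l)$ of least absolute value. (H2) There exist continuous $h_1,h_2:\mathbb{R}\to\mathbb{R}$ with $\lim_{|u|\to\infty}h_1(u)=\infty$ such that $h_1(u)\le|\overline\theta|\le h_2(u)$ for all $\overline\theta\in\theta(x,u)$, almost every $x$ and all $u\in\mathbb{R}$. (H3) There exist $1\le p\le\frac{N}{N-1}$ (any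 finite $p\ge1$ if $N=1$) and constants $R_\infty,C_\infty>0$ such that $|A(s)|^p\le C_\infty|\eta(x,s)|$ for all $|x|>R_\infty$ and all $s\in\mathbb{R}$. (H4) (for a source $f:\mathbb{R}_+\times\mathbb{R}^N\times\mathbb{R}\to\mathbb{R}$) $f(\cdot,\cdot,r)\in L^1_{loc}(\mathbb{R}_+\times\mathbb{R}^N)$ for all $r\in\mathbb{R}$; $f(t,x,\cdot)$ is continuous and $f(t,x,0)=0$ for a.a. $(t,x)$; and $(f(t,x,r)-f(t,x,s))(r-s)\le0$ for all $r,s\in\mathbb{R}$ and a.a. $(t,x)$. Definition (entropy weak solution with right-hand side $f$, in terms of the variable $v$). A function $v\in L^\infty(\mathbb{R}_+\times\mathbb{R}^N)$ with $\eta(x,v)\in L^\infty(\mathbb{R}_+\times\mathbb{R}^N)\cap L^\infty(\mathbb{R}_+;L^1(\mathbb{R}^N))$ is an entropy weak solution with right-hand side $f$ and initial datum $u_0\in L^1_{loc}(\mathbb{R}^N)$ if for all nonnegative $\psi\in\mathcal D(\mathbb{R}\times\mathbb{R}^N)$ and all $k\in\mathbb{R}$: $$\int_{\mathbb{R}_+\times\mathbb{R}^N}\Big\{(\eta(x,v)-\eta(x,k))^+\psi_t+\chi_{\{v>k\}}(A(v)-A(k))\cdot\nabla\psi+\chi_{\{v>k\}}f(t,x,v)\psi\Big\}dx\,dt\ge-\int_{\mathbb{R}^N}(u_0-\eta(x,k))^+\psi(0,x)\,dx,$$ $$\int_{\mathbb{R}_+\times\mathbb{R}^N}\Big\{(\eta(x,k)-\eta(x,v))^+\psi_t+\chi_{\{k>v\}}(A(k)-A(v))\cdot\nabla\psi-\chi_{\{k>v\}}f(t,x,v)\psi\Big\}dx\,dt\ge-\int_{\mathbb{R}^N}(\eta(x,k)-u_0)^+\psi(0,x)\,dx.$$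 The solutions $v_1$ and $v_2$ may have different initial data. *)

theory Defs
  imports "HOL-Analysis.Analysis"
begin

text \<open>
  Space is \<^typ>\<open>real ^ 'n\<close>, so $N$ is \<open>CARD('n)\<close>, and time-space points are pairs
  \<open>(t, x)\<close> of type \<open>real \<times> real ^ 'n\<close>. Measurability and integrals refer to the (complete)
  Lebesgue measure, so modifying data on null sets is harmless.
\<close>

abbreviation time_space :: "(real \<times> (real ^ 'n)) set"
  where "time_space \<equiv> {0<..} \<times> UNIV"

section \<open>Test functions\<close>

text \<open>Iterated partial derivatives; each of them is required to be totally differentiable.\<close>

primrec C_k :: "nat \<Rightarrow> ('a::euclidean_space \<Rightarrow> real) \<Rightarrow> bool"
  where
    "C_k 0 f \<longleftrightarrow> continuous_on UNIV f"
  | "C_k (Suc k) f \<longleftrightarrow> (\<forall>z. f differentiable (at z)) \<and>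
       (\<forall>b\<in>Basis. C_k k (\<lambda>z. frechet_derivative f (at z) b))"

definition smooth :: "('a::euclidean_space \<Rightarrow> real) \<Rightarrow> bool"
  where "smooth f \<longleftrightarrow> (\<forall>k. C_k k f)"

text \<open>Elements of $\mathcal D(\Omega)$ are represented by their extension by zero to the whole space.\<close>

definition test_functions :: "'a::euclidean_space set \<Rightarrow> ('a \<Rightarrow> real) set"
  where "test_functions \<Omega> = {\<psi>. smooth \<psi> \<and> compact (closure {z. \<psi> z \<noteq> 0}) \<and>
     closure {z. \<psi> z \<noteq> 0} \<subseteq> \<Omega>}"

definition d_t :: "(real \<times> (real ^ 'n) \<Rightarrow> real) \<Rightarrow> real \<times> (real ^ 'n) \<Rightarrow> real"
  where "d_t \<psi> z = frechet_derivative \<psi> (at z) (1, 0)"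

definition grad_x :: "(real \<times> (real ^ 'n) \<Rightarrow> real) \<Rightarrow> real \<times> (real ^ 'n) \<Rightarrow> real ^ 'n"
  where "grad_x \<psi> z = (\<chi> i. frechet_derivative \<psi> (at z) (0, axis i 1))"

section \<open>Function spaces\<close>

definition L1_loc_space :: "(real ^ 'n \<Rightarrow> real) \<Rightarrow> bool"
  where "L1_loc_space g \<longleftrightarrow> (\<forall>K. compact K \<longrightarrow> g absolutely_integrable_on K)"

text \<open>Integrability up to the initial time \<open>t = 0\<close>.\<close>

definition L1_loc_time_space :: "(real \<times> (real ^ 'n) \<Rightarrow> real) \<Rightarrow> bool"
  where "L1_loc_time_space g \<longleftrightarrow>
    (\<forall>T K. 0 < T \<and> compact K \<longrightarrow> g absolutely_integrable_on ({0<..<T} \<times> K))"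

definition L_inf :: "(real \<times> (real ^ 'n) \<Rightarrow> real) \<Rightarrow> bool"
  where "L_inf g \<longleftrightarrow> g \<in> borel_measurable (lebesgue_on time_space) \<and>
    (\<exists>C. AE z in lebesgue. z \<in> time_space \<longrightarrow> \<bar>g z\<bar> \<le> C)"

text \<open>
  $L^\infty(\mathbb{R}_+; L^1(\mathbb{R}^N))$; strong measurability of \<open>t \<mapsto> g (t, \<cdot>)\<close> is expressed by
  joint measurability of \<open>g\<close>.
\<close>

definition L_inf_L1 :: "(real \<times> (real ^ 'n) \<Rightarrow> real) \<Rightarrow> bool"
  where "L_inf_L1 g \<longleftrightarrow> g \<in> borel_measurable (lebesgue_on time_space) \<and>
    (\<exists>C. AE t in lebesgue. 0 < t \<longrightarrow>
       integrable lebesgue (\<lambda>x. g (t, x)) \<and> (LINT x|lebesgue. \<bar>g (t, x)\<bar>) \<le> C)"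

section \<open>Assumptions on the data\<close>

definition monotone_operator :: "(real \<Rightarrow> real set) \<Rightarrow> bool"
  where "monotone_operator T \<longleftrightarrow> (\<forall>u v. \<forall>r\<in>T u. \<forall>s\<in>T v. 0 \<le> (r - s) * (u - v))"

definition maximal_monotone :: "(real \<Rightarrow> real set) \<Rightarrow> bool"
  where "maximal_monotone T \<longleftrightarrow> monotone_operator T \<and>
    (\<forall>S. monotone_operator S \<and> (\<forall>u. T u \<subseteq> S u) \<longrightarrow> S = T)"

text \<open>Well defined on nonempty closed intervals, such as the values of a maximal monotone operator.\<close>

definition least_abs :: "real set \<Rightarrow> real"
  where "least_abs S = (THE s. s \<in> S \<and> (\<forall>r\<in>S. \<bar>s\<bar> \<le> \<bar>r\<bar>))"

text \<open>
  The equivalence \<open>u = \<eta> x s \<longleftrightarrow> s \<in> \<theta> x u\<close> says both that the inverse of \<open>\<theta> x\<close> is single-valued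
  and everywhere defined, and that it is \<open>\<eta> x\<close>.
\<close>

definition structure_condition ::
    "(real \<Rightarrow> real ^ 'n) \<Rightarrow> (real ^ 'n \<Rightarrow> real \<Rightarrow> real set) \<Rightarrow> (real ^ 'n \<Rightarrow> real \<Rightarrow> real) \<Rightarrow> bool"
  where "structure_condition A \<theta> \<eta> \<longleftrightarrow>
    continuous_on UNIV A \<and>
    (\<forall>x u. \<theta> x u \<noteq> {}) \<and>
    (AE x in lebesgue. maximal_monotone (\<theta> x) \<and> 0 \<in> \<theta> x 0) \<and>
    (AE x in lebesgue. (\<forall>s u. u = \<eta> x s \<longleftrightarrow> s \<in> \<theta> x u) \<and> continuous_on UNIV (\<eta> x)) \<and>
    (\<forall>l. L1_loc_space (\<lambda>x. least_abs (\<theta> x l)))"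

definition growth_condition :: "(real ^ 'n \<Rightarrow> real \<Rightarrow> real set) \<Rightarrow> bool"
  where "growth_condition \<theta> \<longleftrightarrow>
    (\<exists>h1 h2. continuous_on UNIV h1 \<and> continuous_on UNIV h2 \<and>
       filterlim h1 at_top at_infinity \<and>
       (AE x in lebesgue. \<forall>u. \<forall>s\<in>\<theta> x u. h1 u \<le> \<bar>s\<bar> \<and> \<bar>s\<bar> \<le> h2 u))"

definition flux_condition :: "(real \<Rightarrow> real ^ 'n) \<Rightarrow> (real ^ 'n \<Rightarrow> real \<Rightarrow> real) \<Rightarrow> bool"
  where "flux_condition A \<eta> \<longleftrightarrow>
    (\<exists>p R C. 1 \<le> p \<and> (CARD('n) > 1 \<longrightarrow> p \<le> real CARD('n) / (real CARD('n) - 1)) \<and>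
       0 < R \<and> 0 < C \<and>
       (\<forall>x s. R < norm x \<longrightarrow> norm (A s) powr p \<le> C * \<bar>\<eta> x s\<bar>))"

definition source_condition :: "(real \<Rightarrow> real ^ 'n \<Rightarrow> real \<Rightarrow> real) \<Rightarrow> bool"
  where "source_condition f \<longleftrightarrow>
    (\<forall>r. L1_loc_time_space (\<lambda>(t, x). f t x r)) \<and>
    (AE (t, x) in lebesgue. 0 < t \<longrightarrow> continuous_on UNIV (f t x) \<and> f t x 0 = 0) \<and>
    (AE (t, x) in lebesgue. 0 < t \<longrightarrow> (\<forall>r s. (f t x r - f t x s) * (r - s) \<le> 0))"

section \<open>Entropy weak solutions\<close>

definition entropy_weak_solution ::
    "(real \<Rightarrow> real ^ 'n) \<Rightarrow> (real ^ 'n \<Rightarrow> real \<Rightarrow> real) \<Rightarrow> (real \<Rightarrow> real ^ 'n \<Rightarrow> real \<Rightarrow> real) \<Rightarrow>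
     (real ^ 'n \<Rightarrow> real) \<Rightarrow> (real \<times> (real ^ 'n) \<Rightarrow> real) \<Rightarrow> bool"
  where "entropy_weak_solution A \<eta> f u0 v \<longleftrightarrow>
    L1_loc_space u0 \<and>
    L_inf v \<and> L_inf (\<lambda>(t, x). \<eta> x (v (t, x))) \<and> L_inf_L1 (\<lambda>(t, x). \<eta> x (v (t, x))) \<and>
    (\<forall>\<psi> \<in> test_functions UNIV. (\<forall>z. 0 \<le> \<psi> z) \<longrightarrow> (\<forall>k.
      (LINT (t, x) : time_space | lebesgue.
          max (\<eta> x (v (t, x)) - \<eta> x k) 0 * d_t \<psi> (t, x)
        + of_bool (v (t, x) > k) * ((A (v (t, x)) - A k) \<bullet> grad_x \<psi> (t, x))
        + of_bool (v (t, x) > k) * f t x (v (t, x)) * \<psi> (t, x))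
      \<ge> - (LINT x | lebesgue. max (u0 x - \<eta> x k) 0 * \<psi> (0, x))
      \<and>
      (LINT (t, x) : time_space | lebesgue.
          max (\<eta> x k - \<eta> x (v (t, x))) 0 * d_t \<psi> (t, x)
        + of_bool (k > v (t, x)) * ((A k - A (v (t, x))) \<bullet> grad_x \<psi> (t, x))
        - of_bool (k > v (t, x)) * f t x (v (t, x)) * \<psi> (t, x))
      \<ge> - (LINT x | lebesgue. max (\<eta> x k - u0 x) 0 * \<psi> (0, x))))"

end

theory Submission
  imports Defs
begin

text \<open>
  The inequalities compare two solutions by Kruzhkov's doubling of variables. The entropy inequality
  of \<open>v1\<close> at the point \<open>z = (t, x)\<close> is used with the constant \<open>k = v2 w\<close>, that of \<open>v2\<close> at
  \<open>w = (s, y)\<close> with \<open>k = v1 z\<close>; both are tested with \<open>\<psi> z * R (z - w)\<close>, where \<open>R \<ge> 0\<close> is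
  concentrated near \<open>0\<close>, integrated over the other point and added. The flux depends on the two
  points only through \<open>v1 z\<close> and \<open>v2 w\<close>, so the space derivatives of \<open>R\<close> cancel. The time
  derivatives of \<open>R\<close> do not: the entropies belong to \<open>\<eta> x\<close> in the first inequality and to \<open>\<eta> y\<close>
  in the second one. With \<open>\<zeta> = z - w\<close> the sum is
  \<open>0 \<le> \<integral>\<zeta>. R \<zeta> * (\<integral>z. bulk \<psi> \<zeta> z) + d_t R \<zeta> * (\<integral>z. mismatch \<psi> \<zeta> z)\<close> (lemma \<open>doubling\<close>).

  As \<open>\<eta>\<close> is merely measurable in \<open>x\<close>, the mismatch has no rate in \<open>x - y\<close> that could compete with
  a derivative of \<open>R\<close>. But it is small as soon as the space component of \<open>\<zeta>\<close> is small, whatever the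
  time component (\<open>mismatch_small\<close>), and it is multiplied by a time derivative only. So \<open>R\<close> is scaled
  anisotropically: its width \<open>1 / a\<close> in time is fixed first, which costs a factor \<open>a\<close> in
  \<open>d_t R\<close>, and its width \<open>1 / b\<close> in space is chosen afterwards. A rescaled copy of \<open>\<psi>\<close> itself serves
  as \<open>R\<close>. The bulk is treated by continuity of translations in \<open>L\<^sup>1\<close> (\<open>bulk_upper_limit\<close>). Only its
  upper limit is controlled: where \<open>v1 = v2\<close> the indicator of \<open>v1 z > v2 (z - \<zeta>)\<close> may oscillate, and
  the source then contributes at most its positive part, which accounts for the right-hand side of the
  second inequality. The outcome is \<open>kato_inequality\<close>.

  This argument needs Fubini's theorem and the joint measurability of \<open>(x, k) \<mapsto> \<eta> x k\<close>, so it is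
  carried out for Borel data without exceptional sets (the locale \<open>entropy_pair\<close>); the last part
  replaces the Lebesgue measurable data by Borel representatives. The first inequality is the sum of
  the second one for \<open>(v1, v2)\<close> and for \<open>(v2, v1)\<close>.
\<close>

section \<open>Test functions\<close>

lemma C_k_SucD:
  fixes f :: "'a::euclidean_space \<Rightarrow> real"
  shows "C_k (Suc k) f \<Longrightarrow> C_k k f"
proof (induction k arbitrary: f)
  case 0
  then show ?case
    by (auto intro!: continuous_at_imp_continuous_on differentiable_imp_continuous_within)
next
  case (Suc k)
  then show ?case
    by simp
qed

lemma C_k_add:
  fixes f g :: "'a::euclidean_space \<Rightarrow> real"
  shows "C_k k f \<Longrightarrow> C_k k g \<Longrightarrow> C_k k (\<lambda>z. f z + g z)"
proof (induction k arbitrary: f g)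
  case 0
  then show ?case
    by (auto intro: continuous_intros)
next
  case (Suc k)
  have "frechet_derivative (\<lambda>z. f z + g z) (at z)
      = (\<lambda>b. frechet_derivative f (at z) b + frechet_derivative g (at z) b)" for z
    using Suc.prems
    by (intro frechet_derivative_at[symmetric] has_derivative_add)
      (auto simp: frechet_derivative_works[symmetric])
  with Suc show ?case
    by (auto intro: differentiable_add)
qed

lemma C_k_mult:
  fixes f g :: "'a::euclidean_space \<Rightarrow> real"
  shows "C_k k f \<Longrightarrow> C_k k g \<Longrightarrow> C_k k (\<lambda>z. f z * g z)"
proof (induction k arbitrary: f g)
  case 0
  then show ?case
    by (auto intro: continuous_intros)
next
  case (Suc k)
  have "frechet_derivative (\<lambda>z. f z * g z) (at z)
      = (\<lambda>b. f z * frechet_derivative g (at z) b + frechet_derivative f (at z) b * g z)" for z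
    using Suc.prems
    by (intro frechet_derivative_at[symmetric] has_derivative_mult)
      (auto simp: frechet_derivative_works[symmetric])
  moreover have "C_k k f" "C_k k g"
    using Suc.prems C_k_SucD by blast+
  ultimately show ?case
    using Suc.prems by (auto intro!: C_k_add Suc.IH differentiable_mult)
qed

lemma frechet_derivative_affine:
  fixes f :: "'a::euclidean_space \<Rightarrow> real"
  assumes "\<And>z. f differentiable (at z)" and "bounded_linear L"
  shows "frechet_derivative (\<lambda>z. f (c + L z)) (at z) = (\<lambda>b. frechet_derivative f (at (c + L z)) (L b))"
    and "(\<lambda>z. f (c + L z)) differentiable (at z)"
proof -
  have "((\<lambda>z. c + L z) has_derivative L) (at z)"
    using has_derivative_add[OF has_derivative_const bounded_linear_imp_has_derivative[OF assms(2)]]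
    by simp
  then have *: "((\<lambda>z. f (c + L z)) has_derivative
      (\<lambda>b. frechet_derivative f (at (c + L z)) (L b))) (at z)"
    using has_derivative_compose[of "\<lambda>z. c + L z" L z UNIV f] assms(1) frechet_derivative_works
    by blast
  show "frechet_derivative (\<lambda>z. f (c + L z)) (at z)
      = (\<lambda>b. frechet_derivative f (at (c + L z)) (L b))"
    using * by (rule frechet_derivative_at[symmetric])
  show "(\<lambda>z. f (c + L z)) differentiable (at z)"
    using * by (auto simp: differentiable_def)
qed

text \<open>
  For a diagonal map \<open>L\<close> the partial derivatives of \<open>f (c + L z)\<close> are multiples of the
  corresponding partial derivatives of \<open>f\<close>; the factor \<open>r\<close> lets the induction absorb them.
\<close>

lemma C_k_affine:
  fixes f :: "'a::euclidean_space \<Rightarrow> real"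
  assumes L: "bounded_linear L" and diag: "\<And>b. b \<in> Basis \<Longrightarrow> L b = \<mu> b *\<^sub>R b"
  shows "C_k k f \<Longrightarrow> C_k k (\<lambda>z. r * f (c + L z))"
proof (induction k arbitrary: f r)
  case 0
  have "continuous_on UNIV L"
    using L by (simp add: linear_continuous_on)
  then have "continuous_on UNIV (\<lambda>z. f (c + L z))"
    using 0 by (intro continuous_on_compose2[of UNIV f UNIV "\<lambda>z. c + L z"] continuous_intros) auto
  then show ?case
    by (auto intro: continuous_intros)
next
  case (Suc k)
  then have d: "f differentiable (at z)" for z
    by simp
  note aff = frechet_derivative_affine[OF d L, of c]
  have "frechet_derivative (\<lambda>z. r * f (c + L z)) (at z)
      = (\<lambda>b. r * frechet_derivative f (at (c + L z)) (L b))" for z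
  proof -
    have "((\<lambda>z. f (c + L z)) has_derivative (\<lambda>b. frechet_derivative f (at (c + L z)) (L b))) (at z)"
      using aff[of z] frechet_derivative_works by metis
    then show ?thesis
      by (intro frechet_derivative_at[symmetric] has_derivative_mult_right)
  qed
  moreover have "frechet_derivative f (at y) (\<mu> b *\<^sub>R b) = \<mu> b * frechet_derivative f (at y) b" for y b
    using linear_scale[OF linear_frechet_derivative[OF d[of y]]] by simp
  moreover have "C_k k (\<lambda>z. (r * \<mu> b) * frechet_derivative f (at (c + L z)) b)" if "b \<in> Basis" for b
    using Suc that by (intro Suc.IH) simp
  ultimately show ?case
    using aff(2) by (auto simp: diag mult.assoc intro!: differentiable_mult)
qed

lemma smooth_mult: "smooth f \<Longrightarrow> smooth g \<Longrightarrow> smooth (\<lambda>z. f z * g z)"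
  by (simp add: smooth_def C_k_mult)

lemma smooth_affine:
  fixes f :: "'a::euclidean_space \<Rightarrow> real"
  assumes "smooth f" "bounded_linear L" "\<And>b. b \<in> Basis \<Longrightarrow> L b = \<mu> b *\<^sub>R b"
  shows "smooth (\<lambda>z. f (c + L z))"
  using C_k_affine[OF assms(2,3), of _ f 1 c] assms(1) by (simp add: smooth_def)

lemma smooth_const_mult: "smooth f \<Longrightarrow> smooth (\<lambda>z. r * f z)"
  using C_k_affine[OF bounded_linear_ident, of "\<lambda>_. 1" _ f r 0] by (simp add: smooth_def)

lemma smooth_shift: "smooth f \<Longrightarrow> smooth (\<lambda>z. f (z - w))"
  using smooth_affine[OF _ bounded_linear_ident, of f "\<lambda>_. 1" "- w"] by simp

lemma smooth_reflect: "smooth f \<Longrightarrow> smooth (\<lambda>w. f (z - w))"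
  using smooth_affine[OF _ bounded_linear_minus[OF bounded_linear_ident], of f "\<lambda>_. - 1" z] by simp

lemma smooth_continuous: "smooth f \<Longrightarrow> continuous_on UNIV f"
  unfolding smooth_def by (metis C_k.simps(1))

lemma smooth_differentiable: "smooth f \<Longrightarrow> f differentiable (at z)"
  unfolding smooth_def by (metis C_k.simps(2))

lemma smooth_partial_continuous:
  "smooth f \<Longrightarrow> b \<in> Basis \<Longrightarrow> continuous_on UNIV (\<lambda>z. frechet_derivative f (at z) b)"
  using C_k.simps(2)[of 0 f] unfolding smooth_def by (metis C_k.simps(1))

lemma continuous_on_d_t: "smooth \<psi> \<Longrightarrow> continuous_on UNIV (d_t \<psi>)"
  unfolding d_t_def using smooth_partial_continuous[of \<psi> "(1, 0)"] by (simp add: Basis_prod_def)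

lemma continuous_on_grad_x: "smooth \<psi> \<Longrightarrow> continuous_on UNIV (grad_x \<psi>)"
  for \<psi> :: "real \<times> (real ^ 'n) \<Rightarrow> real"
  unfolding grad_x_def
  by (intro continuous_on_vec_lambda smooth_partial_continuous)
    (auto simp: Basis_prod_def Basis_vec_def)

definition supp :: "('a::topological_space \<Rightarrow> real) \<Rightarrow> 'a set"
  where "supp \<psi> = closure {z. \<psi> z \<noteq> 0}"

lemma closed_supp: "closed (supp \<psi>)"
  by (simp add: supp_def)

lemma zero_outside_support: "z \<notin> supp \<psi> \<Longrightarrow> \<psi> z = 0"
  using closure_subset[of "{z. \<psi> z \<noteq> 0}"] by (auto simp: supp_def)

lemma frechet_derivative_outside_support:
  fixes \<psi> :: "'a::euclidean_space \<Rightarrow> real"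
  assumes "z \<notin> supp \<psi>"
  shows "frechet_derivative \<psi> (at z) = (\<lambda>_. 0)"
proof -
  have 0: "((\<lambda>_. 0::real) has_derivative (\<lambda>_. 0)) (at z)"
    by simp
  have "(\<psi> has_derivative (\<lambda>_. 0)) (at z)"
  proof (rule has_derivative_transform_within_open[OF 0, of "- supp \<psi>"])
    show "open (- supp \<psi>)"
      using closed_supp by blast
    show "z \<in> - supp \<psi>"
      using assms by blast
    show "0 = \<psi> x" if "x \<in> - supp \<psi>" for x
      using zero_outside_support[of x \<psi>] that by simp
  qed
  from frechet_derivative_at[OF this] show ?thesis
    by (rule sym)
qed

lemma frechet_derivative_worksI:
  "f differentiable (at z) \<Longrightarrow> (f has_derivative frechet_derivative f (at z)) (at z)"
  by (simp add: frechet_derivative_works)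

lemma d_t_outside_support: "z \<notin> supp \<psi> \<Longrightarrow> d_t \<psi> z = 0"
  by (simp add: d_t_def frechet_derivative_outside_support)

lemma grad_x_outside_support: "z \<notin> supp \<psi> \<Longrightarrow> grad_x \<psi> z = 0"
  by (simp add: grad_x_def frechet_derivative_outside_support vec_eq_iff)

lemma frechet_derivative_mult:
  assumes "smooth f" "smooth g"
  shows "frechet_derivative (\<lambda>z. f z * g z) (at z) b
    = f z * frechet_derivative g (at z) b + frechet_derivative f (at z) b * g z"
proof -
  have "((\<lambda>z. f z * g z) has_derivative
      (\<lambda>b. f z * frechet_derivative g (at z) b + frechet_derivative f (at z) b * g z)) (at z)"
    using assms[THEN smooth_differentiable, THEN frechet_derivative_worksI]
    by (intro has_derivative_mult)
  then show ?thesis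
    by (simp add: frechet_derivative_at[symmetric])
qed

lemma d_t_mult:
  "smooth f \<Longrightarrow> smooth g \<Longrightarrow> d_t (\<lambda>z. f z * g z) z = d_t f z * g z + f z * d_t g z"
  by (simp add: d_t_def frechet_derivative_mult)

lemma grad_x_mult:
  "smooth f \<Longrightarrow> smooth g \<Longrightarrow> grad_x (\<lambda>z. f z * g z) z = g z *\<^sub>R grad_x f z + f z *\<^sub>R grad_x g z"
  by (simp add: grad_x_def frechet_derivative_mult vec_eq_iff)

lemma d_t_shift: "smooth f \<Longrightarrow> d_t (\<lambda>z. f (z - w)) z = d_t f (z - w)"
  using frechet_derivative_affine(1)[OF smooth_differentiable bounded_linear_ident, of f "- w" z]
  by (simp add: d_t_def)

lemma grad_x_shift: "smooth f \<Longrightarrow> grad_x (\<lambda>z. f (z - w)) z = grad_x f (z - w)"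
  using frechet_derivative_affine(1)[OF smooth_differentiable bounded_linear_ident, of f "- w" z]
  by (simp add: grad_x_def)

lemma frechet_derivative_const_mult_reflect:
  assumes "smooth f"
  shows "frechet_derivative (\<lambda>w. r * f (z - w)) (at w) b
    = - r * frechet_derivative f (at (z - w)) b"
proof -
  have "frechet_derivative (\<lambda>w. f (z - w)) (at w) b = - frechet_derivative f (at (z - w)) b" for b
    using frechet_derivative_affine(1)[OF smooth_differentiable[OF assms]
        bounded_linear_minus[OF bounded_linear_ident], of z w]
      linear_neg[OF linear_frechet_derivative[OF smooth_differentiable[OF assms]]]
    by simp
  then have "((\<lambda>w. f (z - w)) has_derivative (\<lambda>b. - frechet_derivative f (at (z - w)) b)) (at w)"
    using frechet_derivative_worksI[OF smooth_differentiable[OF smooth_reflect[OF assms]], of z w]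
    by (metis ext)
  then have "((\<lambda>w. r * f (z - w)) has_derivative
      (\<lambda>b. r * - frechet_derivative f (at (z - w)) b)) (at w)"
    by (rule has_derivative_mult_right)
  then show ?thesis
    by (simp add: frechet_derivative_at[symmetric])
qed

lemma d_t_const_mult_reflect:
  "smooth f \<Longrightarrow> d_t (\<lambda>w. r * f (z - w)) w = - r * d_t f (z - w)"
  by (simp add: d_t_def frechet_derivative_const_mult_reflect)

lemma grad_x_const_mult_reflect:
  "smooth f \<Longrightarrow> grad_x (\<lambda>w. r * f (z - w)) w = - r *\<^sub>R grad_x f (z - w)"
  by (simp add: grad_x_def frechet_derivative_const_mult_reflect vec_eq_iff)

lemma test_functionsD:
  assumes "\<psi> \<in> test_functions \<Omega>"
  shows "smooth \<psi>" "compact (supp \<psi>)" "supp \<psi> \<subseteq> \<Omega>"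
  using assms by (auto simp: test_functions_def supp_def)

lemma test_functionsI:
  fixes \<psi> :: "'a::euclidean_space \<Rightarrow> real"
  assumes "smooth \<psi>" "compact K" "K \<subseteq> \<Omega>" "\<And>z. z \<notin> K \<Longrightarrow> \<psi> z = 0"
  shows "\<psi> \<in> test_functions \<Omega>"
proof -
  have *: "supp \<psi> \<subseteq> K"
    unfolding supp_def
  proof (rule closure_minimal)
    show "{z. \<psi> z \<noteq> 0} \<subseteq> K"
      using assms(4) by blast
    show "closed K"
      using assms(2) by (rule compact_imp_closed)
  qed
  have "compact (K \<inter> supp \<psi>)"
    using assms(2) closed_supp by (rule compact_Int_closed)
  then have "compact (supp \<psi>)"
    using * by (metis Int_absorb1)
  moreover have "supp \<psi> \<subseteq> \<Omega>"
    using * assms(3) by (rule order_trans)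
  ultimately show ?thesis
    using assms(1) unfolding test_functions_def supp_def by blast
qed

text \<open>
  The doubled test function \<open>\<psi> z * R (z - w)\<close> is admissible in \<open>z\<close> for fixed \<open>w\<close>, because of the
  factor \<open>\<psi> z\<close>, and in \<open>w\<close> for fixed \<open>z\<close>, where it is a multiple of the reflected \<open>R\<close>; in the second
  case \<open>R\<close> has to be supported so close to \<open>0\<close> that \<open>w\<close> stays in the domain.
\<close>

lemma test_function_mult_shift:
  assumes "\<psi> \<in> test_functions \<Omega>" "smooth R"
  shows "(\<lambda>z. \<psi> z * R (z - w)) \<in> test_functions \<Omega>"
proof (rule test_functionsI[where K = "supp \<psi>"])
  show "smooth (\<lambda>z. \<psi> z * R (z - w))"
    by (rule smooth_mult[OF test_functionsD(1)[OF assms(1)] smooth_shift[OF assms(2)]])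
  show "compact (supp \<psi>)"
    using assms(1) by (rule test_functionsD(2))
  show "supp \<psi> \<subseteq> \<Omega>"
    using assms(1) by (rule test_functionsD(3))
  show "\<psi> z * R (z - w) = 0" if "z \<notin> supp \<psi>" for z
    using zero_outside_support[of z \<psi>, OF that] by simp
qed

lemma test_function_const_mult_reflect:
  assumes "R \<in> test_functions UNIV" "\<And>\<zeta>. \<zeta> \<in> supp R \<Longrightarrow> z - \<zeta> \<in> \<Omega>"
  shows "(\<lambda>w. r * R (z - w)) \<in> test_functions \<Omega>"
proof (rule test_functionsI)
  show "smooth (\<lambda>w. r * R (z - w))"
    by (rule smooth_const_mult[OF smooth_reflect[OF test_functionsD(1)[OF assms(1)]]])
  show "compact ((\<lambda>\<zeta>. z - \<zeta>) ` supp R)"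
    using assms(1) by (intro compact_continuous_image continuous_intros test_functionsD)
  show "(\<lambda>\<zeta>. z - \<zeta>) ` supp R \<subseteq> \<Omega>"
    using assms(2) by auto
  show "r * R (z - w) = 0" if "w \<notin> (\<lambda>\<zeta>. z - \<zeta>) ` supp R" for w
  proof -
    have "z - w \<notin> supp R"
      using that by (auto simp: image_iff dest!: bspec[where x = "z - w"])
    then show ?thesis
      using zero_outside_support[of "z - w" R] by simp
  qed
qed

section \<open>Translations and products in the Lebesgue integral\<close>

lemma lborel_distr_reflect: "distr lborel borel (\<lambda>w. z - w) = (lborel :: 'a::euclidean_space measure)"
  by (subst (2) lborel_affine[of "-1" z]) (simp_all add: density_1)

lemma lborel_distr_shift: "distr lborel borel (\<lambda>z. z - w) = (lborel :: 'a::euclidean_space measure)"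
  by (subst (2) lborel_affine[of 1 "- w"]) (simp_all add: density_1)

lemma integral_shift:
  fixes f :: "'a::euclidean_space \<Rightarrow> real"
  assumes "f \<in> borel_measurable borel"
  shows "(\<integral>z. f (z - w) \<partial>lborel) = (\<integral>z. f z \<partial>lborel)"
proof -
  have "(\<integral>z. f z \<partial>lborel) = (\<integral>z. f z \<partial>distr lborel borel (\<lambda>z. z - w))"
    by (simp add: lborel_distr_shift)
  also have "\<dots> = (\<integral>z. f (z - w) \<partial>lborel)"
    using assms by (intro integral_distr) auto
  finally show ?thesis ..
qed

lemma integrable_shift:
  fixes f :: "'a::euclidean_space \<Rightarrow> real"
  assumes "integrable lborel f"
  shows "integrable lborel (\<lambda>z. f (z - w))"
proof -
  have "integrable (distr lborel borel (\<lambda>z. z - w)) f"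
    using assms by (simp add: lborel_distr_shift)
  then show ?thesis
    by (rule integrable_distr[rotated]) simp
qed

text \<open>
  The substitution \<open>w = z - \<zeta>\<close> preserves the Lebesgue measure on pairs, by Tonelli's theorem: for
  fixed \<open>z\<close> it is a reflection followed by a translation.
\<close>

lemma lborel_distr_shear:
  "distr lborel borel (\<lambda>(z, \<zeta>). (z, z - \<zeta>)) = (lborel :: ('a::euclidean_space \<times> 'a) measure)"
proof (rule measure_eqI)
  fix X :: "('a \<times> 'a) set"
  assume "X \<in> sets (distr lborel borel (\<lambda>(z, \<zeta>). (z, z - \<zeta>)))"
  then have X[measurable]: "X \<in> sets borel"
    by simp
  then have X'[measurable]: "X \<in> sets (borel \<Otimes>\<^sub>M borel)"
    by (subst borel_prod) (rule X)
  have S: "(\<lambda>(z, \<zeta>). (z, z - \<zeta>)) \<in> lborel \<rightarrow>\<^sub>M (borel :: ('a \<times> 'a) measure)"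
    by (simp, intro borel_measurable_continuous_onI) (auto simp: case_prod_beta intro!: continuous_intros)
  have "emeasure (distr lborel borel (\<lambda>(z, \<zeta>). (z, z - \<zeta>))) X
      = (\<integral>\<^sup>+p. indicator X p \<partial>distr lborel borel (\<lambda>(z, \<zeta>). (z, z - \<zeta>)))"
    by simp
  also have "\<dots> = (\<integral>\<^sup>+p. indicator X (case p of (z, \<zeta>) \<Rightarrow> (z, z - \<zeta>)) \<partial>(lborel \<Otimes>\<^sub>M lborel))"
    using X unfolding lborel_prod by (subst nn_integral_distr[OF S]) auto
  also have "\<dots> = (\<integral>\<^sup>+z. \<integral>\<^sup>+\<zeta>. indicator X (z, z - \<zeta>) \<partial>lborel \<partial>lborel)"
    by (subst lborel.nn_integral_fst[symmetric]) (auto simp: case_prod_beta)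
  also have "\<dots> = (\<integral>\<^sup>+z. \<integral>\<^sup>+w. indicator X (z, w) \<partial>lborel \<partial>lborel)"
  proof (rule nn_integral_cong)
    fix z :: 'a
    have "(\<integral>\<^sup>+w. indicator X (z, w) \<partial>lborel)
        = (\<integral>\<^sup>+w. indicator X (z, w) \<partial>distr lborel borel (\<lambda>w. z - w))"
      by (simp add: lborel_distr_reflect)
    also have "\<dots> = (\<integral>\<^sup>+\<zeta>. indicator X (z, z - \<zeta>) \<partial>lborel)"
      by (subst nn_integral_distr) auto
    finally show "(\<integral>\<^sup>+\<zeta>. indicator X (z, z - \<zeta>) \<partial>lborel) = (\<integral>\<^sup>+w. indicator X (z, w) \<partial>lborel)" ..
  qed
  also have "\<dots> = (\<integral>\<^sup>+p. indicator X p \<partial>(lborel \<Otimes>\<^sub>M lborel))"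
    by (subst lborel.nn_integral_fst[symmetric]) auto
  finally show "emeasure (distr lborel borel (\<lambda>(z, \<zeta>). (z, z - \<zeta>))) X = emeasure lborel X"
    by (simp add: lborel_prod)
qed simp

lemma
  fixes Q :: "'a::euclidean_space \<Rightarrow> 'a \<Rightarrow> real"
  assumes "integrable (lborel \<Otimes>\<^sub>M lborel) (\<lambda>(z, w). Q z w)"
  shows integrable_shear: "integrable (lborel \<Otimes>\<^sub>M lborel) (\<lambda>(z, \<zeta>). Q z (z - \<zeta>))"
    and integral_shear: "(\<integral>(z, \<zeta>). Q z (z - \<zeta>) \<partial>(lborel \<Otimes>\<^sub>M lborel)) = (\<integral>(z, w). Q z w \<partial>(lborel \<Otimes>\<^sub>M lborel))"
proof -
  have S: "(\<lambda>(z, \<zeta>). (z, z - \<zeta>)) \<in> (lborel :: ('a \<times> 'a) measure) \<rightarrow>\<^sub>M borel"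
    by (simp, intro borel_measurable_continuous_onI)
      (auto simp: case_prod_beta intro!: continuous_intros)
  have eq: "(\<lambda>(z, \<zeta>). Q z (z - \<zeta>)) = (\<lambda>p. (case_prod Q) (case p of (z, \<zeta>) \<Rightarrow> (z, z - \<zeta>)))"
    by auto
  have *: "integrable (distr lborel borel (\<lambda>(z, \<zeta>). (z, z - \<zeta>))) (case_prod Q)"
    using assms by (simp add: lborel_distr_shear lborel_prod)
  show "integrable (lborel \<Otimes>\<^sub>M lborel) (\<lambda>(z, \<zeta>). Q z (z - \<zeta>))"
    unfolding eq lborel_prod using integrable_distr[OF S *] .
  have "(\<integral>p. case_prod Q p \<partial>distr lborel borel (\<lambda>(z, \<zeta>). (z, z - \<zeta>)))
      = (\<integral>p. (case_prod Q) (case p of (z, \<zeta>) \<Rightarrow> (z, z - \<zeta>)) \<partial>lborel)"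
    using S borel_measurable_integrable[OF *] by (intro integral_distr) auto
  then show "(\<integral>(z, \<zeta>). Q z (z - \<zeta>) \<partial>(lborel \<Otimes>\<^sub>M lborel)) = (\<integral>(z, w). Q z w \<partial>(lborel \<Otimes>\<^sub>M lborel))"
    unfolding eq lborel_prod by (simp add: lborel_distr_shear)
qed

definition shift_defect :: "('a::euclidean_space \<Rightarrow> real) \<Rightarrow> 'a \<Rightarrow> real"
  where "shift_defect g \<zeta> = (\<integral>z. \<bar>g z - g (z - \<zeta>)\<bar> \<partial>lborel)"

text \<open>
  Inner regularity holds for finite Borel measures; it is applied to the restriction of the Lebesgue
  measure to \<open>A\<close>.
\<close>

lemma compact_inner_approximation:
  fixes A :: "'a::euclidean_space set"
  assumes [measurable]: "A \<in> sets borel" and fin: "emeasure lborel A < \<infinity>" and "0 < e"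
  obtains K where "compact K" "K \<subseteq> A" "measure lborel A < measure lborel K + e"
proof -
  let ?M = "density lborel (indicator A)"
  have em: "emeasure ?M X = emeasure lborel (A \<inter> X)" if "X \<in> sets borel" for X
    using that by (subst emeasure_density) (auto simp: nn_integral_indicator[symmetric] indicator_inter_arith
        simp del: nn_integral_indicator)
  have A: "emeasure ?M X = emeasure lborel X" if "X \<subseteq> A" "X \<in> sets borel" for X
    using em[OF that(2)] that(1) by (simp add: Int_absorb1)
  have "emeasure ?M A = (SUP K \<in> {K. K \<subseteq> A \<and> compact K}. emeasure ?M K)"
    using em[of UNIV] fin by (intro inner_regular) auto
  then have sup: "emeasure lborel A = (SUP K \<in> {K. K \<subseteq> A \<and> compact K}. emeasure lborel K)"
    using A[of A] A[OF _ borel_compact] by (simp cong: SUP_cong_simp)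
  have A_fin: "emeasure lborel A = ennreal (measure lborel A)"
    using fin by (intro emeasure_eq_ennreal_measure) auto
  show ?thesis
  proof (cases "measure lborel A < e")
    case True
    then show ?thesis
      by (intro that[of "{}"]) auto
  next
    case False
    then have "ennreal (measure lborel A - e) < emeasure lborel A"
      using \<open>0 < e\<close> unfolding A_fin by (intro ennreal_lessI) auto
    then obtain K where K: "K \<subseteq> A" "compact K" "ennreal (measure lborel A - e) < emeasure lborel K"
      unfolding sup less_SUP_iff by auto
    have "emeasure lborel K < \<infinity>"
      using K(2) by (rule emeasure_compact_finite)
    then have "emeasure lborel K = ennreal (measure lborel K)"
      by (intro emeasure_eq_ennreal_measure) auto
    with K(3) False have "measure lborel A - e < measure lborel K"
      by (simp add: ennreal_less_iff)
    with K(1,2) show ?thesis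
      by (intro that[of K]) auto
  qed
qed

text \<open>
  Choose \<open>K \<subseteq> A \<subseteq> U\<close> with \<open>K\<close> compact, \<open>U\<close> open and \<open>U - K\<close> small. A shift shorter than the
  distance from \<open>K\<close> to the complement of \<open>U\<close> maps \<open>K\<close> into \<open>U\<close>, in either direction. Hence the
  difference of the indicators of \<open>A\<close> and of its translate lies below the sum of two nonnegative
  differences of indicators of \<open>U\<close> and \<open>K\<close>, one of them shifted, whose integrals are
  \<open>measure U - measure K\<close> each.
\<close>

lemma shift_defect_indicator:
  fixes A :: "'a::euclidean_space set"
  assumes [measurable]: "A \<in> sets borel" and fin: "emeasure lborel A < \<infinity>" and "0 < e"
  shows "\<exists>d>0. \<forall>\<zeta>. norm \<zeta> < d \<longrightarrow> shift_defect (indicator A) \<zeta> < e"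
proof -
  obtain K where K: "compact K" "K \<subseteq> A" "measure lborel A < measure lborel K + e / 4"
    using compact_inner_approximation[OF assms(1,2), of "e / 4"] \<open>0 < e\<close> by auto
  obtain U where U: "open U" "A \<subseteq> U" "emeasure lborel (U - A) < ennreal (e / 4)"
    using outer_regular_lborel[OF assms(1), of "e / 4"] \<open>0 < e\<close> by auto
  note [measurable] = borel_open[OF U(1)] borel_compact[OF K(1)]
  have "emeasure lborel U = emeasure lborel A + emeasure lborel (U - A)"
    using U(2) by (subst plus_emeasure) (auto simp: Un_absorb1)
  then have U_fin: "emeasure lborel U < \<infinity>"
    using fin order.strict_trans[OF U(3), of top] by (simp add: ennreal_add_less_top)
  have K_fin: "emeasure lborel K < \<infinity>"
    using K(1) by (rule emeasure_compact_finite)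
  have "measure lborel (U - A) < e / 4"
    using U(3) \<open>0 < e\<close> order.strict_trans[OF U(3), of top]
    by (auto simp: emeasure_eq_ennreal_measure ennreal_less_iff less_top)
  moreover have "measure lborel (U - A) = measure lborel U - measure lborel A"
    using U(2) U_fin fin by (intro measure_Diff) auto
  ultimately have UK: "measure lborel U - measure lborel K < e / 2"
    using K(3) by simp
  have "\<exists>d>0. \<forall>x\<in>K. \<forall>y\<in>- U. d \<le> dist x y"
    using K(1,2) U(1,2) by (intro separate_compact_closed) auto
  then obtain d where d: "0 < d" "\<And>x y. x \<in> K \<Longrightarrow> y \<in> - U \<Longrightarrow> d \<le> dist x y"
    by blast
  have "shift_defect (indicator A) \<zeta> < e" if "norm \<zeta> < d" for \<zeta>
  proof -
    let ?b = "\<lambda>z. (indicator U z - indicator K (z - \<zeta>)) + (indicator U (z - \<zeta>) - indicator K z) :: real"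
    have shift: "z - \<zeta> \<in> K \<Longrightarrow> z \<in> U" "z \<in> K \<Longrightarrow> z - \<zeta> \<in> U" for z
      using d(2)[of "z - \<zeta>" z] d(2)[of z "z - \<zeta>"] that by (auto simp: dist_norm)
    have iU: "integrable lborel (indicator U :: 'a \<Rightarrow> real)" and iK: "integrable lborel (indicator K :: 'a \<Rightarrow> real)"
      and iA: "integrable lborel (indicator A :: 'a \<Rightarrow> real)"
      using U_fin K_fin fin by auto
    note int = iU iK iA iU[THEN integrable_shift] iK[THEN integrable_shift] iA[THEN integrable_shift]
    have "shift_defect (indicator A) \<zeta> \<le> (\<integral>z. ?b z \<partial>lborel)"
      unfolding shift_defect_def
    proof (rule integral_mono)
      show "\<bar>indicator A z - indicator A (z - \<zeta>)\<bar> \<le> ?b z" for z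
        using shift[of z] K(2) U(2) by (auto simp: indicator_def split: if_splits)
    qed (use int in auto)
    also have "\<dots> = 2 * (measure lborel U - measure lborel K)"
      using int by (simp add: integral_shift)
    finally show ?thesis
      using UK by simp
  qed
  with d(1) show ?thesis
    by blast
qed

lemma integrable_shift_defect:
  fixes g :: "'a::euclidean_space \<Rightarrow> real"
  shows "integrable lborel g \<Longrightarrow> integrable lborel (\<lambda>z. \<bar>g z - g (z - \<zeta>)\<bar>)"
  by (intro integrable_abs Bochner_Integration.integrable_diff integrable_shift)

text \<open>
  Translations are continuous in \<open>L\<^sup>1\<close>: this passes from indicators to linear combinations and, as
  a translation preserves the \<open>L\<^sup>1\<close> norm, to \<open>L\<^sup>1\<close> limits.
\<close>

lemma shift_defect_tendsto_0:
  fixes g :: "'a::euclidean_space \<Rightarrow> real"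
  assumes "integrable lborel g" and "0 < e"
  shows "\<exists>d>0. \<forall>\<zeta>. norm \<zeta> < d \<longrightarrow> shift_defect g \<zeta> < e"
  using assms
proof (induction arbitrary: e rule: integrable_induct)
  case (base A c)
  have eq: "shift_defect (\<lambda>z. indicator A z *\<^sub>R c) \<zeta> = shift_defect (indicator A) \<zeta> * \<bar>c\<bar>" for \<zeta>
    unfolding shift_defect_def
    by (subst integral_mult_left_zero[symmetric]) (simp flip: left_diff_distrib add: abs_mult)
  obtain d where d: "0 < d" "\<And>\<zeta>. norm \<zeta> < d \<Longrightarrow> shift_defect (indicator A) \<zeta> < e / (\<bar>c\<bar> + 1)"
    using shift_defect_indicator[of A "e / (\<bar>c\<bar> + 1)"] base by auto
  have *: "x * \<bar>c\<bar> < e" if "x < e / (\<bar>c\<bar> + 1)" for x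
  proof (cases "0 \<le> x")
    case True
    then have "x * \<bar>c\<bar> \<le> x * (\<bar>c\<bar> + 1)"
      by (intro mult_left_mono) auto
    also have "\<dots> < e"
      using that by (simp add: pos_less_divide_eq)
    finally show ?thesis .
  next
    case False
    then have "x * \<bar>c\<bar> \<le> 0"
      by (simp add: mult_nonpos_nonneg)
    then show ?thesis
      using base.prems by simp
  qed
  show ?case
    using d(1) *[OF d(2)] unfolding eq by (intro exI[of _ d]) simp
next
  case (add f g)
  obtain d1 where d1: "0 < d1" "\<And>\<zeta>. norm \<zeta> < d1 \<Longrightarrow> shift_defect f \<zeta> < e / 2"
    using add.IH(1)[of "e / 2"] add.prems by auto
  obtain d2 where d2: "0 < d2" "\<And>\<zeta>. norm \<zeta> < d2 \<Longrightarrow> shift_defect g \<zeta> < e / 2"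
    using add.IH(2)[of "e / 2"] add.prems by auto
  have *: "shift_defect (\<lambda>z. f z + g z) \<zeta> \<le> shift_defect f \<zeta> + shift_defect g \<zeta>" for \<zeta>
    unfolding shift_defect_def
    by (subst Bochner_Integration.integral_add[symmetric],
        (intro integrable_shift_defect add.hyps)+,
        intro integral_mono integrable_shift_defect Bochner_Integration.integrable_add add.hyps) auto
  have "shift_defect (\<lambda>z. f z + g z) \<zeta> < e" if "norm \<zeta> < min d1 d2" for \<zeta>
    using *[of \<zeta>] d1(2)[of \<zeta>] d2(2)[of \<zeta>] that by simp
  with d1(1) d2(1) show ?case
    by (intro exI[of _ "min d1 d2"]) simp
next
  case (lim f s)
  have "(\<lambda>i. \<integral>z. \<bar>s i z - f z\<bar> \<partial>lborel) \<longlonglongrightarrow> (\<integral>z. (0::real) \<partial>(lborel :: 'a measure))"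
  proof (rule integral_dominated_convergence[where w = "\<lambda>z. 3 * \<bar>f z\<bar>"])
    show "AE z in lborel. (\<lambda>i. \<bar>s i z - f z\<bar>) \<longlonglongrightarrow> 0"
      using lim.hyps(2) by (auto intro!: tendsto_rabs_zero LIM_zero)
    show "integrable lborel (\<lambda>z. 3 * \<bar>f z\<bar>)"
      using lim.hyps(4) by auto
    have "norm (s i z) \<le> 2 * norm (f z)" for i z
      by (rule lim.hyps(3)) simp
    then show "AE z in lborel. norm \<bar>s i z - f z\<bar> \<le> 3 * \<bar>f z\<bar>" for i
      by (intro AE_I2) (smt (verit) real_norm_def)
  qed (use lim.hyps in auto)
  then have "\<forall>\<^sub>F i in sequentially. (\<integral>z. \<bar>s i z - f z\<bar> \<partial>lborel) < e / 4"
    by (rule order_tendstoD(2)) (use lim.prems in simp)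
  then obtain i where i: "(\<integral>z. \<bar>s i z - f z\<bar> \<partial>lborel) < e / 4"
    by (auto simp: eventually_sequentially)
  obtain d where d: "0 < d" "\<And>\<zeta>. norm \<zeta> < d \<Longrightarrow> shift_defect (s i) \<zeta> < e / 2"
    using lim.IH[of "e / 2"] lim.prems by auto
  have "shift_defect f \<zeta> < e" if "norm \<zeta> < d" for \<zeta>
  proof -
    let ?r = "\<lambda>z. \<bar>s i z - f z\<bar>"
    have r: "integrable lborel ?r"
      using lim.hyps(1,4) by auto
    have "shift_defect f \<zeta> \<le> (\<integral>z. \<bar>s i z - s i (z - \<zeta>)\<bar> + (?r z + ?r (z - \<zeta>)) \<partial>lborel)"
      unfolding shift_defect_def
      using lim.hyps r
      by (intro integral_mono integrable_shift_defect Bochner_Integration.integrable_add r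
          integrable_shift[OF r]) auto
    also have "\<dots> = shift_defect (s i) \<zeta> + ((\<integral>z. ?r z \<partial>lborel) + (\<integral>z. ?r (z - \<zeta>) \<partial>lborel))"
      unfolding shift_defect_def using r integrable_shift[OF r] lim.hyps(1)
      by (simp add: integrable_shift_defect)
    also have "(\<integral>z. ?r (z - \<zeta>) \<partial>lborel) = (\<integral>z. ?r z \<partial>lborel)"
      using borel_measurable_integrable[OF r] by (intro integral_shift[of ?r]) simp
    finally show ?thesis
      using i d(2)[OF that] by simp
  qed
  with d(1) show ?case
    by blast
qed

lemma set_integrable_shift:
  fixes g :: "'a::euclidean_space \<Rightarrow> real"
  assumes "\<And>S. compact S \<Longrightarrow> set_integrable lborel S g" and S: "compact S"
  shows "set_integrable lborel S (\<lambda>z. g (z - \<zeta>))"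
proof -
  let ?T = "(\<lambda>z. z - \<zeta>) ` S"
  have "compact ?T"
    using S by (intro compact_continuous_image continuous_intros)
  then have "integrable lborel (\<lambda>z. indicator ?T (z - \<zeta>) *\<^sub>R g (z - \<zeta>))"
    using assms(1)[unfolded set_integrable_def] by (intro integrable_shift) blast
  moreover have "indicator ?T (z - \<zeta>) = (indicator S z :: real)" for z
    by (auto simp: indicator_def)
  ultimately show ?thesis
    by (simp add: set_integrable_def)
qed

lemma integrable_local_shift:
  fixes g :: "'a::euclidean_space \<Rightarrow> real"
  assumes g: "\<And>S. compact S \<Longrightarrow> set_integrable lborel S g" and S: "compact S"
  shows "integrable lborel (\<lambda>z. indicator S z * \<bar>g z - g (z - \<zeta>)\<bar>)"
proof -
  have "integrable lborel (\<lambda>z. \<bar>indicator S z *\<^sub>R (g z - g (z - \<zeta>))\<bar>)"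
    using set_integral_diff(1)[OF g[OF S] set_integrable_shift[OF g S]]
    unfolding set_integrable_def by (rule integrable_abs)
  then show ?thesis
    by (simp add: abs_mult)
qed

text \<open>
  For shifts shorter than \<open>1\<close> only the values of \<open>g\<close> at distance at most \<open>1\<close> from \<open>S\<close> enter, so
  \<open>g\<close> may be cut off to an integrable function.
\<close>

lemma local_shift_tendsto_0:
  fixes g :: "'a::euclidean_space \<Rightarrow> real"
  assumes g: "\<And>S. compact S \<Longrightarrow> set_integrable lborel S g" and S: "compact S"
  shows "((\<lambda>\<zeta>. \<integral>z. indicator S z * \<bar>g z - g (z - \<zeta>)\<bar> \<partial>lborel) \<longlongrightarrow> 0) (nhds 0)"
proof (rule tendstoI)
  fix \<epsilon> :: real
  assume "0 < \<epsilon>"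
  let ?S1 = "{z - u | z u. z \<in> S \<and> u \<in> cball 0 1}"
  let ?g = "\<lambda>z. indicator ?S1 z *\<^sub>R g z"
  have "compact ?S1"
    using S by (intro compact_differences compact_cball)
  then have g1: "integrable lborel ?g"
    using g unfolding set_integrable_def by blast
  then obtain d where d: "0 < d" "\<And>\<zeta>. norm \<zeta> < d \<Longrightarrow> shift_defect ?g \<zeta> < \<epsilon>"
    using shift_defect_tendsto_0[OF g1 \<open>0 < \<epsilon>\<close>] by blast
  have "dist (\<integral>z. indicator S z * \<bar>g z - g (z - \<zeta>)\<bar> \<partial>lborel) 0 < \<epsilon>" if "norm \<zeta> < min d 1" for \<zeta>
  proof -
    have "(\<integral>z. indicator S z * \<bar>g z - g (z - \<zeta>)\<bar> \<partial>lborel) \<le> shift_defect ?g \<zeta>"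
      unfolding shift_defect_def
    proof (rule integral_mono')
      show "integrable lborel (\<lambda>z. \<bar>?g z - ?g (z - \<zeta>)\<bar>)"
        by (rule integrable_shift_defect[OF g1])
      show "indicator S z * \<bar>g z - g (z - \<zeta>)\<bar> \<le> \<bar>?g z - ?g (z - \<zeta>)\<bar>" for z
      proof (cases "z \<in> S")
        case True
        then have "z \<in> ?S1" "z - \<zeta> \<in> ?S1"
          using that by (fastforce intro: exI[of _ z] exI[of _ 0] exI[of _ \<zeta>])+
        then show ?thesis
          using True by (simp only: indicator_simps) simp
      qed simp
    qed simp
    also have "\<dots> < \<epsilon>"
      using d(2) that by simp
    finally show ?thesis
      by (simp add: integral_nonneg_AE)
  qed
  then show "\<forall>\<^sub>F \<zeta> in nhds 0. dist (\<integral>z. indicator S z * \<bar>g z - g (z - \<zeta>)\<bar> \<partial>lborel) 0 < \<epsilon>"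
    using d(1) unfolding eventually_nhds_metric by (intro exI[of _ "min d 1"]) simp
qed

lemma integrable_continuous_compact_support:
  fixes \<phi> g :: "'a::euclidean_space \<Rightarrow> real"
  assumes "continuous_on UNIV \<phi>" "compact S" "\<And>z. z \<notin> S \<Longrightarrow> \<phi> z = 0"
    and "set_integrable lborel S g"
  shows "integrable lborel (\<lambda>z. g z * \<phi> z)"
proof -
  have "compact (\<phi> ` S)"
    using assms(1,2) by (intro compact_continuous_image) (auto intro: continuous_on_subset)
  then obtain C where C: "\<And>z. z \<in> S \<Longrightarrow> \<bar>\<phi> z\<bar> \<le> C"
    by (force dest!: compact_imp_bounded simp: bounded_iff)
  have [measurable]: "\<phi> \<in> borel_measurable borel"
    using assms(1) by (rule borel_measurable_continuous_onI)
  have eq: "g z * \<phi> z = (indicator S z *\<^sub>R g z) * \<phi> z" for z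
    using assms(3)[of z] by (auto simp: indicator_def)
  note [measurable] = borel_measurable_integrable[OF assms(4)[unfolded set_integrable_def]]
  have "integrable lborel (\<lambda>z. C * (indicator S z *\<^sub>R g z))"
    using assms(4) unfolding set_integrable_def by (rule integrable_mult_right)
  then show ?thesis
    unfolding eq
  proof (rule Bochner_Integration.integrable_bound)
    show "AE z in lborel. norm ((indicator S z *\<^sub>R g z) * \<phi> z) \<le> norm (C * (indicator S z *\<^sub>R g z))"
      using C by (intro AE_I2) (fastforce simp: indicator_def abs_mult mult.commute[of C] intro!: mult_left_mono)
  qed measurable
qed

lemma bounded_continuous_compact_support:
  fixes \<phi> :: "'a::euclidean_space \<Rightarrow> 'b::real_normed_vector"
  assumes "continuous_on UNIV \<phi>" "compact S" "\<And>z. z \<notin> S \<Longrightarrow> \<phi> z = 0"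
  obtains C where "0 \<le> C" "\<And>z. norm (\<phi> z) \<le> C"
proof -
  have "compact (\<phi> ` S)"
    using assms(1,2) by (intro compact_continuous_image) (auto intro: continuous_on_subset)
  then obtain C where C: "\<And>z. z \<in> S \<Longrightarrow> norm (\<phi> z) \<le> C"
    by (force dest!: compact_imp_bounded simp: bounded_iff)
  show thesis
  proof (rule that[of "max 0 C"])
    show "norm (\<phi> z) \<le> max 0 C" for z
      using C[of z] assms(3)[of z] by (cases "z \<in> S") auto
  qed simp
qed

lemma set_integrable_bounded_compact:
  fixes g :: "'a::euclidean_space \<Rightarrow> real"
  assumes [measurable]: "g \<in> borel_measurable borel" and "\<And>z. \<bar>g z\<bar> \<le> C" "compact S"
  shows "set_integrable lborel S g"
proof -
  have [measurable]: "S \<in> sets borel"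
    using assms(3) by (rule borel_compact)
  have "integrable lborel (\<lambda>z. indicator S z * C)"
    using emeasure_compact_finite[OF assms(3)] by simp
  then show ?thesis
    unfolding set_integrable_def
    by (rule Bochner_Integration.integrable_bound)
      (use order_trans[OF abs_ge_zero assms(2)] in \<open>auto simp: indicator_def assms(2)\<close>)
qed

lemma integrable_times_product:
  fixes a :: "'a::euclidean_space \<Rightarrow> real" and b :: "'b::euclidean_space \<Rightarrow> real"
  assumes "integrable lborel a" "integrable lborel b"
  shows "integrable (lborel \<Otimes>\<^sub>M lborel) (\<lambda>(z, w). a z * b w)"
proof (rule lborel_pair.Fubini_integrable)
  note [measurable] = assms[THEN borel_measurable_integrable]
  show "(\<lambda>(z, w). a z * b w) \<in> borel_measurable (lborel \<Otimes>\<^sub>M lborel)"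
    by measurable
  show "integrable lborel (\<lambda>z. \<integral>w. norm (case (z, w) of (z, w) \<Rightarrow> a z * b w) \<partial>lborel)"
    using assms by (simp add: abs_mult)
  show "AE z in lborel. integrable lborel (\<lambda>w. case (z, w) of (z, w) \<Rightarrow> a z * b w)"
    using assms by simp
qed

lemma integrable_dominated_product:
  fixes h :: "'a::euclidean_space \<Rightarrow> 'b::euclidean_space \<Rightarrow> real"
  assumes "(\<lambda>(z, w). h z w) \<in> borel_measurable (lborel \<Otimes>\<^sub>M lborel)"
    and "integrable lborel a" "integrable lborel b"
    and "\<And>z w. \<bar>h z w\<bar> \<le> C * (a z * b w)"
  shows "integrable (lborel \<Otimes>\<^sub>M lborel) (\<lambda>(z, w). h z w)"
proof -
  have "integrable (lborel \<Otimes>\<^sub>M lborel) (\<lambda>p. C * (case p of (z, w) \<Rightarrow> a z * b w))"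
    by (intro integrable_mult_right integrable_times_product assms)
  then show ?thesis
    using assms(1) by (rule Bochner_Integration.integrable_bound)
      (use assms(4) in \<open>auto intro!: AE_I2 intro: order_trans[OF _ abs_ge_self]\<close>)
qed

text \<open>
  The bound for terms with the factor \<open>\<psi> z * R (z - w)\<close>: the shear turns it into a product of
  functions of the two variables.
\<close>

lemma integrable_dominated_convolution:
  fixes h :: "'a::euclidean_space \<Rightarrow> 'a \<Rightarrow> real"
  assumes "(\<lambda>(z, w). h z w) \<in> borel_measurable (lborel \<Otimes>\<^sub>M lborel)"
    and "integrable lborel a" "integrable lborel b"
    and "\<And>z w. \<bar>h z w\<bar> \<le> C * (a z * b (z - w))"
  shows "integrable (lborel \<Otimes>\<^sub>M lborel) (\<lambda>(z, w). h z w)"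
proof -
  have "integrable (lborel \<Otimes>\<^sub>M lborel) (\<lambda>p. C * (case p of (z, w) \<Rightarrow> a z * b (z - w)))"
    by (intro integrable_mult_right integrable_shear[of "\<lambda>z w. a z * b w"] integrable_times_product assms)
  then show ?thesis
    using assms(1) by (rule Bochner_Integration.integrable_bound)
      (use assms(4) in \<open>auto intro!: AE_I2 intro: order_trans[OF _ abs_ge_self]\<close>)
qed

lemma integrable_of_bool_mult:
  fixes h :: "'a::euclidean_space \<Rightarrow> real"
  assumes "integrable lborel h" "Measurable.pred borel P"
  shows "integrable lborel (\<lambda>z. of_bool (P z) * h z)"
  using assms(1)
proof (rule Bochner_Integration.integrable_bound)
  note [measurable] = assms(2) borel_measurable_integrable[OF assms(1)]
  show "(\<lambda>z. of_bool (P z) * h z) \<in> borel_measurable lborel"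
    by measurable
qed auto

lemma borel_measurable_apply:
  fixes e :: "'a::topological_space \<Rightarrow> real \<Rightarrow> real"
  assumes "(\<lambda>(x, k). e x k) \<in> borel_measurable (borel \<Otimes>\<^sub>M borel)"
    and [measurable]: "f \<in> borel_measurable N" "h \<in> borel_measurable N"
  shows "(\<lambda>p. e (f p) (h p)) \<in> borel_measurable N"
  using measurable_compose[OF _ assms(1), of "\<lambda>p. (f p, h p)" N] by simp

section \<open>Doubling of variables\<close>

text \<open>
  Here \<open>e\<close> stands for \<open>\<eta>\<close>, and \<open>g1\<close>, \<open>g2\<close> for the sources evaluated along the solutions. The roles of
  the two functions are not symmetric: \<open>v1\<close> satisfies the inequalities for the entropies supported
  above \<open>k\<close>, and \<open>v2\<close> those for the entropies supported below \<open>k\<close>. Test functions vanish at time \<open>0\<close>,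
  so that no initial data occur.
\<close>

locale entropy_pair =
  fixes e :: "real ^ 'n \<Rightarrow> real \<Rightarrow> real" and A :: "real \<Rightarrow> real ^ 'n" and M B :: real
    and v1 v2 g1 g2 :: "real \<times> (real ^ 'n) \<Rightarrow> real"
  assumes e_borel: "(\<lambda>(x, k). e x k) \<in> borel_measurable (borel \<Otimes>\<^sub>M borel)"
    and e_mono: "mono (e x)"
    and e_continuous: "continuous_on UNIV (e x)"
    and e_bounded: "\<bar>k\<bar> \<le> M \<Longrightarrow> \<bar>e x k\<bar> \<le> B"
    and A_continuous: "continuous_on UNIV A"
    and borel [measurable]: "v1 \<in> borel_measurable borel" "v2 \<in> borel_measurable borel"
      "g1 \<in> borel_measurable borel" "g2 \<in> borel_measurable borel"
    and v_bounded: "\<bar>v1 z\<bar> \<le> M" "\<bar>v2 z\<bar> \<le> M"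
    and g_integrable: "compact S \<Longrightarrow> set_integrable lborel S g1" "compact S \<Longrightarrow> set_integrable lborel S g2"
    and entropy1: "\<phi> \<in> test_functions time_space \<Longrightarrow> (\<And>z. 0 \<le> \<phi> z) \<Longrightarrow>
      0 \<le> (\<integral>z. max (e (snd z) (v1 z) - e (snd z) k) 0 * d_t \<phi> z
        + of_bool (v1 z > k) * ((A (v1 z) - A k) \<bullet> grad_x \<phi> z)
        + of_bool (v1 z > k) * g1 z * \<phi> z \<partial>lborel)"
    and entropy2: "\<phi> \<in> test_functions time_space \<Longrightarrow> (\<And>z. 0 \<le> \<phi> z) \<Longrightarrow>
      0 \<le> (\<integral>w. max (e (snd w) k - e (snd w) (v2 w)) 0 * d_t \<phi> w
        + of_bool (k > v2 w) * ((A k - A (v2 w)) \<bullet> grad_x \<phi> w)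
        - of_bool (k > v2 w) * g2 w * \<phi> w \<partial>lborel)"
begin

lemma e_measurable [measurable (raw)]:
  assumes [measurable]: "f \<in> borel_measurable N" "h \<in> borel_measurable N"
  shows "(\<lambda>p. e (f p) (h p)) \<in> borel_measurable N"
  by (rule borel_measurable_apply[OF e_borel assms])

lemma A_measurable [measurable]: "A \<in> borel_measurable borel"
  using A_continuous by (rule borel_measurable_continuous_onI)

lemma B_nonneg: "0 \<le> B"
  by (rule order_trans[OF abs_ge_zero e_bounded[OF v_bounded(1)]])

definition A_bound :: real
  where "A_bound = (SOME C. \<forall>k. \<bar>k\<bar> \<le> M \<longrightarrow> norm (A k) \<le> C)"

lemma A_bounded: "\<bar>k\<bar> \<le> M \<Longrightarrow> norm (A k) \<le> A_bound"
proof -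
  have "compact (A ` {- M..M})"
    using A_continuous by (intro compact_continuous_image) (auto intro: continuous_on_subset)
  then obtain C where "\<forall>y\<in>A ` {- M..M}. norm y \<le> C"
    by (auto dest!: compact_imp_bounded simp: bounded_iff)
  then have "\<forall>k. \<bar>k\<bar> \<le> M \<longrightarrow> norm (A k) \<le> C"
    by (auto simp: abs_le_iff)
  then have "\<forall>k. \<bar>k\<bar> \<le> M \<longrightarrow> norm (A k) \<le> A_bound"
    unfolding A_bound_def by (rule someI)
  then show "\<bar>k\<bar> \<le> M \<Longrightarrow> norm (A k) \<le> A_bound"
    by blast
qed

text \<open>
  Kruzhkov's semi-entropy and its flux.
\<close>

definition ent :: "real ^ 'n \<Rightarrow> real \<Rightarrow> real \<Rightarrow> real"
  where "ent x a b = max (e x a - e x b) 0"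

definition flux :: "real \<Rightarrow> real \<Rightarrow> real ^ 'n"
  where "flux a b = of_bool (a > b) *\<^sub>R (A a - A b)"

lemma ent_measurable [measurable (raw)]:
  assumes [measurable]: "f \<in> borel_measurable N" "a \<in> borel_measurable N" "b \<in> borel_measurable N"
  shows "(\<lambda>p. ent (f p) (a p) (b p)) \<in> borel_measurable N"
  unfolding ent_def by measurable

lemma flux_measurable [measurable (raw)]:
  assumes [measurable]: "a \<in> borel_measurable N" "b \<in> borel_measurable N"
  shows "(\<lambda>p. flux (a p) (b p)) \<in> borel_measurable N"
  unfolding flux_def by measurable

lemma snd_measurable [measurable]: "snd \<in> (borel :: (real \<times> (real ^ 'n)) measure) \<rightarrow>\<^sub>M borel"
  by (intro borel_measurable_continuous_onI continuous_intros)

lemma ent_bounded: "\<bar>a\<bar> \<le> M \<Longrightarrow> \<bar>b\<bar> \<le> M \<Longrightarrow> \<bar>ent x a b\<bar> \<le> 2 * B"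
  using e_bounded[of a x] e_bounded[of b x] by (auto simp: ent_def)

lemma flux_bounded: "\<bar>a\<bar> \<le> M \<Longrightarrow> \<bar>b\<bar> \<le> M \<Longrightarrow> norm (flux a b) \<le> 2 * A_bound"
  using A_bounded[of a] A_bounded[of b] norm_triangle_ineq4[of "A a" "A b"] norm_ge_zero[of "A a"]
    norm_ge_zero[of "A b"]
  by (simp add: flux_def del: norm_ge_zero)

text \<open>
  The integrands of the two entropy inequalities for the doubled test function \<open>\<psi> z * R (z - w)\<close>, with
  its derivatives expanded: first in \<open>z\<close> with \<open>k = v2 w\<close>, then in \<open>w\<close> with \<open>k = v1 z\<close>, where the
  derivatives fall on \<open>R\<close> alone.
\<close>

definition integrand1 where
  "integrand1 \<psi> R z w = ent (snd z) (v1 z) (v2 w) * (d_t \<psi> z * R (z - w) + \<psi> z * d_t R (z - w))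
     + flux (v1 z) (v2 w) \<bullet> (R (z - w) *\<^sub>R grad_x \<psi> z + \<psi> z *\<^sub>R grad_x R (z - w))
     + of_bool (v1 z > v2 w) * g1 z * (\<psi> z * R (z - w))"

definition integrand2 where
  "integrand2 \<psi> R z w = ent (snd w) (v1 z) (v2 w) * (- \<psi> z * d_t R (z - w))
     + flux (v1 z) (v2 w) \<bullet> (- \<psi> z *\<^sub>R grad_x R (z - w))
     - of_bool (v1 z > v2 w) * g2 w * (\<psi> z * R (z - w))"

lemma integral_integrand1_nonneg:
  assumes "\<psi> \<in> test_functions time_space" "\<And>z. 0 \<le> \<psi> z"
    and "R \<in> test_functions UNIV" "\<And>\<zeta>. 0 \<le> R \<zeta>"
  shows "0 \<le> (\<integral>z. integrand1 \<psi> R z w \<partial>lborel)"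
proof -
  note sm = test_functionsD(1)[OF assms(1)] test_functionsD(1)[OF assms(3)]
  have "integrand1 \<psi> R z w = max (e (snd z) (v1 z) - e (snd z) (v2 w)) 0 * d_t (\<lambda>z. \<psi> z * R (z - w)) z
        + of_bool (v1 z > v2 w) * ((A (v1 z) - A (v2 w)) \<bullet> grad_x (\<lambda>z. \<psi> z * R (z - w)) z)
        + of_bool (v1 z > v2 w) * g1 z * (\<psi> z * R (z - w))" for z
    unfolding integrand1_def ent_def flux_def
      d_t_mult[OF sm(1) smooth_shift[OF sm(2)]] grad_x_mult[OF sm(1) smooth_shift[OF sm(2)]]
      d_t_shift[OF sm(2)] grad_x_shift[OF sm(2)]
    by simp
  then show ?thesis
    using entropy1[OF test_function_mult_shift[OF assms(1) sm(2)], of w "v2 w"] assms(2,4) by simp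
qed

lemma integral_integrand2_nonneg:
  assumes "\<psi> \<in> test_functions time_space" "\<And>z. 0 \<le> \<psi> z"
    and "R \<in> test_functions UNIV" "\<And>\<zeta>. 0 \<le> R \<zeta>"
    and "\<And>z \<zeta>. z \<in> supp \<psi> \<Longrightarrow> \<zeta> \<in> supp R \<Longrightarrow> z - \<zeta> \<in> time_space"
  shows "0 \<le> (\<integral>w. integrand2 \<psi> R z w \<partial>lborel)"
proof (cases "z \<in> supp \<psi>")
  case True
  note sm = test_functionsD(1)[OF assms(3)]
  have "integrand2 \<psi> R z w = max (e (snd w) (v1 z) - e (snd w) (v2 w)) 0 * d_t (\<lambda>w. \<psi> z * R (z - w)) w
        + of_bool (v1 z > v2 w) * ((A (v1 z) - A (v2 w)) \<bullet> grad_x (\<lambda>w. \<psi> z * R (z - w)) w)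
        - of_bool (v1 z > v2 w) * g2 w * (\<psi> z * R (z - w))" for w
    unfolding integrand2_def ent_def flux_def d_t_const_mult_reflect[OF sm] grad_x_const_mult_reflect[OF sm]
    by simp
  then show ?thesis
    using entropy2[OF test_function_const_mult_reflect[OF assms(3), of z time_space "\<psi> z"], of "v1 z"]
      assms(2,4) assms(5)[OF True] by simp
next
  case False
  then have "\<psi> z = 0"
    by (rule zero_outside_support)
  then show ?thesis
    by (simp add: integrand2_def)
qed

text \<open>
  Each term is a bounded function times one of \<open>z\<close> and one of \<open>z - w\<close>, except that \<open>g2 w\<close> is neither;
  there the factor \<open>R (z - w)\<close> is bounded, and \<open>w\<close> is confined to the compact set of differences of the
  two supports.
\<close>

lemma integrable_integrands:
  assumes \<psi>: "\<psi> \<in> test_functions time_space" and R: "R \<in> test_functions UNIV"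
  shows "integrable (lborel \<Otimes>\<^sub>M lborel) (\<lambda>(z, w). integrand1 \<psi> R z w)"
    and "integrable (lborel \<Otimes>\<^sub>M lborel) (\<lambda>(z, w). integrand2 \<psi> R z w)"
proof -
  note \<psi>D = test_functionsD[OF \<psi>] and RD = test_functionsD[OF R]
  have ab: "\<bar>v1 z\<bar> \<le> M" "\<bar>v2 z\<bar> \<le> M" for z
    by (rule v_bounded)+
  have one: "set_integrable lborel S (\<lambda>_. 1 :: real)" if "compact S" for S :: "(real \<times> (real ^ 'n)) set"
    using that by (intro set_integrable_bounded_compact[where C = 1]) auto
  note cont = smooth_continuous[OF \<psi>D(1)] continuous_on_d_t[OF \<psi>D(1)] continuous_on_grad_x[OF \<psi>D(1)]
    smooth_continuous[OF RD(1)] continuous_on_d_t[OF RD(1)] continuous_on_grad_x[OF RD(1)]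
  note [measurable] = cont[THEN borel_measurable_continuous_onI]
  have int: "integrable lborel (\<lambda>z. \<bar>\<psi> z\<bar>)" "integrable lborel (\<lambda>z. \<bar>d_t \<psi> z\<bar>)"
    "integrable lborel (\<lambda>z. norm (grad_x \<psi> z))" "integrable lborel (\<lambda>z. \<bar>g1 z * \<psi> z\<bar>)"
    "integrable lborel (\<lambda>z. \<bar>R z\<bar>)" "integrable lborel (\<lambda>z. \<bar>d_t R z\<bar>)"
    "integrable lborel (\<lambda>z. norm (grad_x R z))"
    using integrable_continuous_compact_support[OF cont(1) \<psi>D(2) _ one[OF \<psi>D(2)]]
      integrable_continuous_compact_support[OF cont(2) \<psi>D(2) _ one[OF \<psi>D(2)]]
      integrable_continuous_compact_support[OF continuous_on_norm[OF cont(3)] \<psi>D(2) _ one[OF \<psi>D(2)]]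
      integrable_continuous_compact_support[OF cont(1) \<psi>D(2) _ g_integrable(1)[OF \<psi>D(2)]]
      integrable_continuous_compact_support[OF cont(4) RD(2) _ one[OF RD(2)]]
      integrable_continuous_compact_support[OF cont(5) RD(2) _ one[OF RD(2)]]
      integrable_continuous_compact_support[OF continuous_on_norm[OF cont(6)] RD(2) _ one[OF RD(2)]]
      zero_outside_support[of _ \<psi>] zero_outside_support[of _ R] d_t_outside_support[of _ \<psi>]
      d_t_outside_support[of _ R] grad_x_outside_support[of _ \<psi>] grad_x_outside_support[of _ R]
    by auto
  have i1: "integrable (lborel \<Otimes>\<^sub>M lborel) (\<lambda>(z, w). ent (snd z) (v1 z) (v2 w) * (d_t \<psi> z * R (z - w)))"
    by (rule integrable_dominated_convolution[OF _ int(2,5), of _ "2 * B"], measurable)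
      (auto simp: abs_mult intro!: mult_right_mono ent_bounded ab)
  have i2: "integrable (lborel \<Otimes>\<^sub>M lborel) (\<lambda>(z, w). ent (snd z) (v1 z) (v2 w) * (\<psi> z * d_t R (z - w)))"
    by (rule integrable_dominated_convolution[OF _ int(1,6), of _ "2 * B"], measurable)
      (auto simp: abs_mult intro!: mult_right_mono ent_bounded ab)
  have i3: "integrable (lborel \<Otimes>\<^sub>M lborel) (\<lambda>(z, w). ent (snd w) (v1 z) (v2 w) * (\<psi> z * d_t R (z - w)))"
    by (rule integrable_dominated_convolution[OF _ int(1,6), of _ "2 * B"], measurable)
      (auto simp: abs_mult intro!: mult_right_mono ent_bounded ab)
  have cs: "\<bar>flux (v1 z) (v2 w) \<bullet> y\<bar> \<le> 2 * A_bound * norm y" for z w y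
    using Cauchy_Schwarz_ineq2[of "flux (v1 z) (v2 w)" y]
      mult_right_mono[OF flux_bounded[OF ab(1)[of z] ab(2)[of w]], of "norm y"]
    by force
  have i4: "integrable (lborel \<Otimes>\<^sub>M lborel) (\<lambda>(z, w). flux (v1 z) (v2 w) \<bullet> (R (z - w) *\<^sub>R grad_x \<psi> z))"
    by (rule integrable_dominated_convolution[OF _ int(3,5), of _ "2 * A_bound"], measurable)
      (rule order_trans[OF cs], simp)
  have i5: "integrable (lborel \<Otimes>\<^sub>M lborel) (\<lambda>(z, w). flux (v1 z) (v2 w) \<bullet> (\<psi> z *\<^sub>R grad_x R (z - w)))"
    by (rule integrable_dominated_convolution[OF _ int(1,7), of _ "2 * A_bound"], measurable)
      (rule order_trans[OF cs], simp)
  have i6: "integrable (lborel \<Otimes>\<^sub>M lborel) (\<lambda>(z, w). of_bool (v1 z > v2 w) * g1 z * (\<psi> z * R (z - w)))"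
    by (rule integrable_dominated_convolution[OF _ int(4,5), of _ 1], measurable)
      (auto simp: abs_mult)
  let ?T = "{z - \<zeta> | z \<zeta>. z \<in> supp \<psi> \<and> \<zeta> \<in> supp R}"
  have T: "compact ?T"
    by (rule compact_differences[OF \<psi>D(2) RD(2)])
  obtain c where c: "0 \<le> c" "\<And>\<zeta>. norm (R \<zeta>) \<le> c"
    using bounded_continuous_compact_support[OF cont(4) RD(2)] zero_outside_support[of _ R] by metis
  have g2T: "integrable lborel (\<lambda>w. \<bar>indicator ?T w * g2 w\<bar>)"
    using g_integrable(2)[OF T] unfolding set_integrable_def by (intro integrable_abs) simp
  have i7: "integrable (lborel \<Otimes>\<^sub>M lborel) (\<lambda>(z, w). of_bool (v1 z > v2 w) * g2 w * (\<psi> z * R (z - w)))"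
  proof (rule integrable_dominated_product[OF _ int(1) g2T, of _ c])
    show "\<bar>of_bool (v1 z > v2 w) * g2 w * (\<psi> z * R (z - w))\<bar>
        \<le> c * (\<bar>\<psi> z\<bar> * \<bar>indicator ?T w * g2 w\<bar>)" for z w
    proof (cases "z \<in> supp \<psi> \<and> z - w \<in> supp R")
      case True
      then have "w \<in> ?T"
        by (intro CollectI exI[of _ z] exI[of _ "z - w"]) simp
      then show ?thesis
        using mult_right_mono[OF c(2)[of "z - w"], of "\<bar>\<psi> z\<bar> * \<bar>g2 w\<bar>"] c(1)
        by (auto simp: abs_mult ac_simps)
    next
      case False
      then have "\<psi> z * R (z - w) = 0"
        using zero_outside_support[of z \<psi>] zero_outside_support[of "z - w" R] by auto
      moreover have "of_bool (v1 z > v2 w) * g2 w * (\<psi> z * R (z - w)) = 0"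
        using calculation by simp
      ultimately show ?thesis
        using c(1) by (simp only: abs_zero) simp
    qed
  qed measurable
  have t1: "(\<lambda>(z, w). integrand1 \<psi> R z w) = (\<lambda>p.
      (case p of (z, w) \<Rightarrow> ent (snd z) (v1 z) (v2 w) * (d_t \<psi> z * R (z - w)))
      + (case p of (z, w) \<Rightarrow> ent (snd z) (v1 z) (v2 w) * (\<psi> z * d_t R (z - w)))
      + (case p of (z, w) \<Rightarrow> flux (v1 z) (v2 w) \<bullet> (R (z - w) *\<^sub>R grad_x \<psi> z))
      + (case p of (z, w) \<Rightarrow> flux (v1 z) (v2 w) \<bullet> (\<psi> z *\<^sub>R grad_x R (z - w)))
      + (case p of (z, w) \<Rightarrow> of_bool (v1 z > v2 w) * g1 z * (\<psi> z * R (z - w))))"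
    by (auto simp: integrand1_def fun_eq_iff algebra_simps inner_add_right)
  show "integrable (lborel \<Otimes>\<^sub>M lborel) (\<lambda>(z, w). integrand1 \<psi> R z w)"
    unfolding t1 by (intro Bochner_Integration.integrable_add i1 i2 i4 i5 i6)
  have t2: "(\<lambda>(z, w). integrand2 \<psi> R z w) = (\<lambda>p.
      - (case p of (z, w) \<Rightarrow> ent (snd w) (v1 z) (v2 w) * (\<psi> z * d_t R (z - w)))
      - (case p of (z, w) \<Rightarrow> flux (v1 z) (v2 w) \<bullet> (\<psi> z *\<^sub>R grad_x R (z - w)))
      - (case p of (z, w) \<Rightarrow> of_bool (v1 z > v2 w) * g2 w * (\<psi> z * R (z - w))))"
    by (auto simp: integrand2_def fun_eq_iff algebra_simps)
  show "integrable (lborel \<Otimes>\<^sub>M lborel) (\<lambda>(z, w). integrand2 \<psi> R z w)"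
    unfolding t2 by (intro Bochner_Integration.integrable_diff Bochner_Integration.integrable_minus i3 i5 i7)
qed

text \<open>
  In terms of \<open>\<zeta> = z - w\<close>, the coefficients of \<open>R \<zeta>\<close> and of \<open>d_t R \<zeta>\<close> in the sum of the two
  integrands.
\<close>

definition bulk where
  "bulk \<psi> \<zeta> z = ent (snd z) (v1 z) (v2 (z - \<zeta>)) * d_t \<psi> z
     + flux (v1 z) (v2 (z - \<zeta>)) \<bullet> grad_x \<psi> z
     + of_bool (v1 z > v2 (z - \<zeta>)) * (g1 z - g2 (z - \<zeta>)) * \<psi> z"

definition mismatch where
  "mismatch \<psi> \<zeta> z = (ent (snd z) (v1 z) (v2 (z - \<zeta>)) - ent (snd z - snd \<zeta>) (v1 z) (v2 (z - \<zeta>))) * \<psi> z"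

text \<open>
  The first inequality is integrated over \<open>w\<close>, the second over \<open>z\<close>, and Fubini's theorem allows to
  add the results. The gradients of \<open>R\<close> cancel, since both multiply the same flux with opposite signs.
\<close>

proposition doubling:
  assumes \<psi>: "\<psi> \<in> test_functions time_space" "\<And>z. 0 \<le> \<psi> z"
    and R: "R \<in> test_functions UNIV" "\<And>\<zeta>. 0 \<le> R \<zeta>"
    and "\<And>z \<zeta>. z \<in> supp \<psi> \<Longrightarrow> \<zeta> \<in> supp R \<Longrightarrow> z - \<zeta> \<in> time_space"
  defines "I \<equiv> \<lambda>\<zeta>. \<integral>z. R \<zeta> * bulk \<psi> \<zeta> z + d_t R \<zeta> * mismatch \<psi> \<zeta> z \<partial>lborel"
  shows "integrable lborel I" "0 \<le> (\<integral>\<zeta>. I \<zeta> \<partial>lborel)"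
proof -
  let ?Q = "\<lambda>z w. integrand1 \<psi> R z w + integrand2 \<psi> R z w"
  note int = integrable_integrands[OF \<psi>(1) R(1)]
  have Q: "integrable (lborel \<Otimes>\<^sub>M lborel) (\<lambda>(z, w). ?Q z w)"
    using Bochner_Integration.integrable_add[OF int] by (simp add: case_prod_unfold)
  have "0 \<le> (\<integral>w. \<integral>z. integrand1 \<psi> R z w \<partial>lborel \<partial>lborel)"
    by (intro integral_nonneg_AE AE_I2 integral_integrand1_nonneg[OF \<psi> R])
  then have "0 \<le> (\<integral>p. (case p of (z, w) \<Rightarrow> integrand1 \<psi> R z w) \<partial>(lborel \<Otimes>\<^sub>M lborel))"
    by (simp add: lborel_pair.integral_snd[OF int(1)])
  moreover have "0 \<le> (\<integral>z. \<integral>w. integrand2 \<psi> R z w \<partial>lborel \<partial>lborel)"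
    by (intro integral_nonneg_AE AE_I2 integral_integrand2_nonneg[OF \<psi> R]) (rule assms(5))
  then have "0 \<le> (\<integral>p. (case p of (z, w) \<Rightarrow> integrand2 \<psi> R z w) \<partial>(lborel \<Otimes>\<^sub>M lborel))"
    by (simp add: lborel_pair.integral_fst[OF int(2)])
  ultimately have "0 \<le> (\<integral>p. (case p of (z, w) \<Rightarrow> ?Q z w) \<partial>(lborel \<Otimes>\<^sub>M lborel))"
    using Bochner_Integration.integral_add[OF int] by (simp add: case_prod_unfold)
  then have pos: "0 \<le> (\<integral>p. (case p of (z, \<zeta>) \<Rightarrow> ?Q z (z - \<zeta>)) \<partial>(lborel \<Otimes>\<^sub>M lborel))"
    using integral_shear[OF Q] by simp
  have Q': "integrable (lborel \<Otimes>\<^sub>M lborel) (\<lambda>(z, \<zeta>). ?Q z (z - \<zeta>))"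
    by (rule integrable_shear[OF Q])
  have I: "I \<zeta> = (\<integral>z. ?Q z (z - \<zeta>) \<partial>lborel)" for \<zeta>
    unfolding I_def
    by (intro Bochner_Integration.integral_cong refl)
      (simp add: bulk_def mismatch_def integrand1_def integrand2_def algebra_simps inner_add_right)
  show "integrable lborel I"
    unfolding I by (rule lborel_pair.integrable_snd[OF Q'])
  show "0 \<le> (\<integral>\<zeta>. I \<zeta> \<partial>lborel)"
    unfolding I using pos by (simp add: lborel_pair.integral_snd[OF Q'])
qed

end

section \<open>Letting the two points coincide\<close>

context entropy_pair
begin

lemma v2_integrable: "compact S \<Longrightarrow> set_integrable lborel S v2"
  by (rule set_integrable_bounded_compact[of v2 M]) (auto simp: v_bounded)

text \<open>
  In this form the flux is visibly continuous, in spite of the indicator.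
\<close>

lemma flux_eq_min: "flux a b = A a - A (min a b)"
  by (simp add: flux_def min_def)

text \<open>
  The bulk at \<open>\<zeta> = 0\<close>, with the largest limit that its source term can have where \<open>v1 = v2\<close>.
\<close>

definition kato where
  "kato \<psi> z = ent (snd z) (v1 z) (v2 z) * d_t \<psi> z
     + flux (v1 z) (v2 z) \<bullet> grad_x \<psi> z
     + (of_bool (v1 z > v2 z) * (g1 z - g2 z) + of_bool (v1 z = v2 z) * max (g1 z - g2 z) 0) * \<psi> z"

context
  fixes \<psi> :: "real \<times> (real ^ 'n) \<Rightarrow> real"
  assumes \<psi>: "\<psi> \<in> test_functions time_space" and \<psi>_nonneg: "\<And>z. 0 \<le> \<psi> z"
begin

lemmas \<psi>D = test_functionsD[OF \<psi>]

lemma \<psi>_continuous: "continuous_on UNIV \<psi>" "continuous_on UNIV (d_t \<psi>)" "continuous_on UNIV (grad_x \<psi>)"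
  using \<psi>D(1) by (simp_all add: smooth_continuous continuous_on_d_t continuous_on_grad_x)

lemmas [measurable] = \<psi>_continuous[THEN borel_measurable_continuous_onI]

lemma integrable_times_\<psi>:
  assumes "set_integrable lborel (supp \<psi>) g"
  shows "integrable lborel (\<lambda>z. g z * \<psi> z)" "integrable lborel (\<lambda>z. g z * d_t \<psi> z)"
    "integrable lborel (\<lambda>z. g z * norm (grad_x \<psi> z))"
  using integrable_continuous_compact_support[OF \<psi>_continuous(1) \<psi>D(2) _ assms]
    integrable_continuous_compact_support[OF \<psi>_continuous(2) \<psi>D(2) _ assms]
    integrable_continuous_compact_support[OF continuous_on_norm[OF \<psi>_continuous(3)] \<psi>D(2) _ assms]
    zero_outside_support[of _ \<psi>] d_t_outside_support[of _ \<psi>] grad_x_outside_support[of _ \<psi>]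
  by auto

lemma set_integrable_const_supp: "set_integrable lborel (supp \<psi>) (\<lambda>_. c :: real)"
  by (rule set_integrable_bounded_compact[where C = "\<bar>c\<bar>"]) (auto simp: \<psi>D)

lemma integrable_ent_flux:
  assumes "a \<in> borel_measurable borel" "b \<in> borel_measurable borel" "y \<in> borel_measurable borel"
    and "\<And>z. \<bar>a z\<bar> \<le> M" "\<And>z. \<bar>b z\<bar> \<le> M"
  shows "integrable lborel (\<lambda>z. ent (y z) (a z) (b z) * d_t \<psi> z)"
    and "integrable lborel (\<lambda>z. ent (y z) (a z) (b z) * \<psi> z)"
    and "integrable lborel (\<lambda>z. flux (a z) (b z) \<bullet> grad_x \<psi> z)"
proof -
  note [measurable] = assms(1-3)
  have ent: "set_integrable lborel (supp \<psi>) (\<lambda>z. ent (y z) (a z) (b z))"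
    by (rule set_integrable_bounded_compact[where C = "2 * B"]) (auto simp: \<psi>D assms intro!: ent_bounded)
  show "integrable lborel (\<lambda>z. ent (y z) (a z) (b z) * d_t \<psi> z)"
    "integrable lborel (\<lambda>z. ent (y z) (a z) (b z) * \<psi> z)"
    by (rule integrable_times_\<psi>[OF ent])+
  show "integrable lborel (\<lambda>z. flux (a z) (b z) \<bullet> grad_x \<psi> z)"
  proof (rule Bochner_Integration.integrable_bound[OF integrable_times_\<psi>(3)[OF set_integrable_const_supp]])
    show "AE z in lborel. norm (flux (a z) (b z) \<bullet> grad_x \<psi> z) \<le> norm ((2 * A_bound) * norm (grad_x \<psi> z))"
    proof (rule AE_I2)
      fix z
      have "norm (flux (a z) (b z) \<bullet> grad_x \<psi> z) \<le> norm (flux (a z) (b z)) * norm (grad_x \<psi> z)"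
        by (simp add: Cauchy_Schwarz_ineq2)
      also have "\<dots> \<le> (2 * A_bound) * norm (grad_x \<psi> z)"
        using assms(4,5) by (intro mult_right_mono flux_bounded) auto
      finally show "norm (flux (a z) (b z) \<bullet> grad_x \<psi> z) \<le> norm ((2 * A_bound) * norm (grad_x \<psi> z))"
        by simp
    qed
  qed measurable
qed

lemma integrable_g_\<psi>:
  "integrable lborel (\<lambda>z. g1 z * \<psi> z)" "integrable lborel (\<lambda>z. g2 (z - \<zeta>) * \<psi> z)"
proof -
  show "integrable lborel (\<lambda>z. g1 z * \<psi> z)"
    by (rule integrable_times_\<psi>(1)[OF g_integrable(1)[OF \<psi>D(2)]])
  show "integrable lborel (\<lambda>z. g2 (z - \<zeta>) * \<psi> z)"
    by (rule integrable_times_\<psi>(1)[OF set_integrable_shift[OF g_integrable(2) \<psi>D(2)]])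
qed

lemma integrable_bulk: "integrable lborel (bulk \<psi> \<zeta>)"
proof -
  have "integrable lborel (\<lambda>z. of_bool (v1 z > v2 (z - \<zeta>)) * (g1 z * \<psi> z - g2 (z - \<zeta>) * \<psi> z))"
    by (intro integrable_of_bool_mult Bochner_Integration.integrable_diff integrable_g_\<psi>) measurable
  then have "integrable lborel (\<lambda>z. of_bool (v1 z > v2 (z - \<zeta>)) * (g1 z - g2 (z - \<zeta>)) * \<psi> z)"
    by (simp add: algebra_simps)
  then show ?thesis
    unfolding bulk_def
    by (intro Bochner_Integration.integrable_add integrable_ent_flux v_bounded) measurable
qed

lemma integrable_mismatch: "integrable lborel (mismatch \<psi> \<zeta>)"
proof -
  have "integrable lborel (\<lambda>z. ent (snd z) (v1 z) (v2 (z - \<zeta>)) * \<psi> z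
      - ent (snd z - snd \<zeta>) (v1 z) (v2 (z - \<zeta>)) * \<psi> z)"
    by (intro Bochner_Integration.integrable_diff integrable_ent_flux v_bounded) measurable
  then show ?thesis
    by (simp add: mismatch_def[abs_def] algebra_simps)
qed

text \<open>
  Otherwise some sequence of shifts \<open>\<xi> n\<close> tending to \<open>0\<close> violates the bound. Along a subsequence the
  shifted \<open>v2\<close> converges almost everywhere on the support of \<open>\<psi>\<close>, so the entropy and the flux
  converge. The indicator of \<open>v1 z > v2 (z - \<xi> n)\<close> converges where \<open>v1 z \<noteq> v2 z\<close>; elsewhere
  the source is bounded by its positive part. Dominated convergence then contradicts the violation.
\<close>

lemma bulk_upper_limit:
  assumes "0 < \<epsilon>"
  shows "\<exists>\<delta>>0. \<forall>\<zeta>. norm \<zeta> < \<delta> \<longrightarrow> (\<integral>z. bulk \<psi> \<zeta> z \<partial>lborel) < (\<integral>z. kato \<psi> z \<partial>lborel) + \<epsilon>"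
proof (rule ccontr)
  assume "\<not> ?thesis"
  then have "\<exists>\<zeta>. norm \<zeta> < 1 / real (Suc n) \<and> (\<integral>z. kato \<psi> z \<partial>lborel) + \<epsilon> \<le> (\<integral>z. bulk \<psi> \<zeta> z \<partial>lborel)" for n
    by (metis not_less zero_less_divide_1_iff of_nat_0_less_iff zero_less_Suc)
  then obtain \<xi> where \<xi>: "\<And>n. norm (\<xi> n) < 1 / real (Suc n)"
      "\<And>n. (\<integral>z. kato \<psi> z \<partial>lborel) + \<epsilon> \<le> (\<integral>z. bulk \<psi> (\<xi> n) z \<partial>lborel)"
    by metis
  have \<xi>0: "\<xi> \<longlonglongrightarrow> 0"
    using \<xi>(1) by (intro Lim_null_comparison[OF _ LIMSEQ_Suc[OF lim_1_over_n]] always_eventually) (auto intro: less_imp_le)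
  let ?S = "supp \<psi>"
  have S[measurable]: "?S \<in> sets borel"
    using \<psi>D(2) by (rule borel_compact)
  have lim: "(\<lambda>n. \<integral>z. indicator ?S z * \<bar>g z - g (z - \<xi> n)\<bar> \<partial>lborel) \<longlonglongrightarrow> 0"
    if "\<And>S. compact S \<Longrightarrow> set_integrable lborel S g" for g :: "_ \<Rightarrow> real"
    using filterlim_compose[OF local_shift_tendsto_0[OF that \<psi>D(2)] \<xi>0] .
  have diff_int: "integrable lborel (\<lambda>z. indicator ?S z * \<bar>g z - g (z - \<xi> n)\<bar>)"
    if "\<And>S. compact S \<Longrightarrow> set_integrable lborel S g" for g :: "_ \<Rightarrow> real" and n
    by (rule integrable_local_shift[OF that \<psi>D(2)])
  have "\<exists>r. strict_mono r \<and> (AE z in lborel. (\<lambda>n. indicator ?S z * \<bar>v2 z - v2 (z - \<xi> (r n))\<bar>) \<longlonglongrightarrow> 0)"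
    using lim[OF v2_integrable] diff_int[OF v2_integrable]
    by (intro tendsto_L1_AE_subseq) auto
  then obtain r where r: "strict_mono r"
    "AE z in lborel. (\<lambda>n. indicator ?S z * \<bar>v2 z - v2 (z - \<xi> (r n))\<bar>) \<longlonglongrightarrow> 0"
    by blast
  obtain C where C: "0 \<le> C" "\<And>z. norm (\<psi> z) \<le> C"
    using bounded_continuous_compact_support[OF \<psi>_continuous(1) \<psi>D(2)] zero_outside_support[of _ \<psi>] by metis
  \<comment> \<open>The source of the second solution is frozen at the point \<open>z\<close>, at the price of a small error.\<close>
  define U where "U n z = ent (snd z) (v1 z) (v2 (z - \<xi> (r n))) * d_t \<psi> z
     + flux (v1 z) (v2 (z - \<xi> (r n))) \<bullet> grad_x \<psi> z
     + (of_bool (v1 z \<noteq> v2 z) * of_bool (v1 z > v2 (z - \<xi> (r n))) * (g1 z - g2 z)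
        + of_bool (v1 z = v2 z) * max (g1 z - g2 z) 0) * \<psi> z" for n z
  let ?E = "\<lambda>n z. C * (indicator ?S z * \<bar>g2 z - g2 (z - \<xi> (r n))\<bar>)"
  have bulk_le: "bulk \<psi> (\<xi> (r n)) z \<le> U n z + ?E n z" for n z
  proof -
    let ?b = "of_bool (v1 z > v2 (z - \<xi> (r n))) :: real"
    have "?b * (g1 z - g2 (z - \<xi> (r n))) \<le> (of_bool (v1 z \<noteq> v2 z) * ?b * (g1 z - g2 z)
        + of_bool (v1 z = v2 z) * max (g1 z - g2 z) 0) + \<bar>g2 z - g2 (z - \<xi> (r n))\<bar>"
      by auto
    then have "?b * (g1 z - g2 (z - \<xi> (r n))) * \<psi> z \<le> (of_bool (v1 z \<noteq> v2 z) * ?b * (g1 z - g2 z)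
        + of_bool (v1 z = v2 z) * max (g1 z - g2 z) 0) * \<psi> z + \<bar>g2 z - g2 (z - \<xi> (r n))\<bar> * \<psi> z"
      using mult_right_mono[OF _ \<psi>_nonneg[of z]] by (metis distrib_right)
    moreover have "\<bar>g2 z - g2 (z - \<xi> (r n))\<bar> * \<psi> z \<le> ?E n z"
      using C(2)[of z] zero_outside_support[of z \<psi>] mult_right_mono[of "\<psi> z" C "\<bar>g2 z - g2 (z - \<xi> (r n))\<bar>"]
      by (cases "z \<in> ?S") (auto simp: mult.commute)
    ultimately show ?thesis
      by (simp add: bulk_def U_def)
  qed
  let ?W = "\<lambda>z. \<bar>2 * B * d_t \<psi> z\<bar> + 2 * A_bound * norm (grad_x \<psi> z) + (\<bar>g1 z * \<psi> z\<bar> + \<bar>g2 z * \<psi> z\<bar>)"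
  have W: "integrable lborel ?W"
  proof -
    have "integrable lborel (\<lambda>z. g2 z * \<psi> z)"
      using integrable_g_\<psi>(2)[of 0] by simp
    then show ?thesis
      by (intro Bochner_Integration.integrable_add integrable_abs integrable_g_\<psi>(1)
          integrable_times_\<psi>(2)[OF set_integrable_const_supp]
          integrable_times_\<psi>(3)[OF set_integrable_const_supp])
  qed
  have U_meas [measurable]: "U n \<in> borel_measurable lborel" for n
    unfolding U_def by measurable
  have UW: "norm (U n z) \<le> ?W z" for n z
  proof -
    let ?s = "of_bool (v1 z \<noteq> v2 z) * of_bool (v1 z > v2 (z - \<xi> (r n))) * (g1 z - g2 z)
        + of_bool (v1 z = v2 z) * max (g1 z - g2 z) 0"
    have "\<bar>ent (snd z) (v1 z) (v2 (z - \<xi> (r n))) * d_t \<psi> z\<bar> \<le> \<bar>2 * B * d_t \<psi> z\<bar>"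
      using mult_right_mono[OF ent_bounded[OF v_bounded(1)[of z] v_bounded(2)[of "z - \<xi> (r n)"], of "snd z"], of "\<bar>d_t \<psi> z\<bar>"]
        B_nonneg by (simp add: abs_mult)
    moreover have "\<bar>flux (v1 z) (v2 (z - \<xi> (r n))) \<bullet> grad_x \<psi> z\<bar> \<le> 2 * A_bound * norm (grad_x \<psi> z)"
      using Cauchy_Schwarz_ineq2[of "flux (v1 z) (v2 (z - \<xi> (r n)))" "grad_x \<psi> z"]
        mult_right_mono[OF flux_bounded[OF v_bounded(1)[of z] v_bounded(2)[of "z - \<xi> (r n)"]], of "norm (grad_x \<psi> z)"]
      by simp
    moreover have "\<bar>?s\<bar> \<le> \<bar>g1 z\<bar> + \<bar>g2 z\<bar>"
      by auto
    then have "\<bar>?s * \<psi> z\<bar> \<le> \<bar>g1 z * \<psi> z\<bar> + \<bar>g2 z * \<psi> z\<bar>"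
      using mult_right_mono[of "\<bar>?s\<bar>" "\<bar>g1 z\<bar> + \<bar>g2 z\<bar>" "\<bar>\<psi> z\<bar>"]
      unfolding abs_mult by (simp only: distrib_right abs_ge_zero)
    ultimately show ?thesis
      unfolding U_def real_norm_def by linarith
  qed
  have U_int: "integrable lborel (U n)" for n
    by (rule Bochner_Integration.integrable_bound[OF W U_meas]) (rule AE_I2, rule order_trans[OF UW], simp)
  have "(\<lambda>n. \<integral>z. U n z \<partial>lborel) \<longlonglongrightarrow> (\<integral>z. kato \<psi> z \<partial>lborel)"
  proof (rule integral_dominated_convergence[OF _ U_meas W _ AE_I2[OF UW]])
    show "kato \<psi> \<in> borel_measurable lborel"
      unfolding kato_def[abs_def] by measurable
    show "AE z in lborel. (\<lambda>n. U n z) \<longlonglongrightarrow> kato \<psi> z"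
      using r(2)
    proof (rule AE_mp, intro AE_I2 impI)
      fix z
      assume z: "(\<lambda>n. indicator ?S z * \<bar>v2 z - v2 (z - \<xi> (r n))\<bar>) \<longlonglongrightarrow> 0"
      show "(\<lambda>n. U n z) \<longlonglongrightarrow> kato \<psi> z"
      proof (cases "z \<in> ?S")
        case False
        then show ?thesis
          using zero_outside_support[of z \<psi>] d_t_outside_support[of z \<psi>] grad_x_outside_support[of z \<psi>]
          by (simp add: U_def kato_def)
      next
        case True
        then have "(\<lambda>n. \<bar>v2 z - v2 (z - \<xi> (r n))\<bar>) \<longlonglongrightarrow> 0"
          using z by simp
        then have "(\<lambda>n. v2 z - v2 (z - \<xi> (r n))) \<longlonglongrightarrow> 0"
          by (rule tendsto_rabs_zero_cancel)
        from tendsto_diff[OF tendsto_const[of "v2 z"] this]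
        have v: "(\<lambda>n. v2 (z - \<xi> (r n))) \<longlonglongrightarrow> v2 z"
          by simp
        have e: "(\<lambda>n. e (snd z) (v2 (z - \<xi> (r n)))) \<longlonglongrightarrow> e (snd z) (v2 z)"
          by (rule continuous_on_tendsto_compose[OF e_continuous v]) auto
        have f: "(\<lambda>n. flux (v1 z) (v2 (z - \<xi> (r n)))) \<longlonglongrightarrow> flux (v1 z) (v2 z)"
          unfolding flux_eq_min
          by (intro tendsto_diff tendsto_const continuous_on_tendsto_compose[OF A_continuous] tendsto_min v) auto
        have b: "(\<lambda>n. of_bool (v1 z \<noteq> v2 z) * of_bool (v1 z > v2 (z - \<xi> (r n))))
            \<longlonglongrightarrow> (of_bool (v1 z > v2 z) :: real)"
        proof (cases "v1 z" "v2 z" rule: linorder_cases)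
          case less
          then have "\<forall>\<^sub>F n in sequentially. v1 z < v2 (z - \<xi> (r n))"
            using v by (intro order_tendstoD(1))
          then show ?thesis
            using less by (intro tendsto_eventually) (auto elim: eventually_mono)
        next
          case greater
          then have "\<forall>\<^sub>F n in sequentially. v1 z > v2 (z - \<xi> (r n))"
            using v by (intro order_tendstoD(2))
          then show ?thesis
            using greater by (intro tendsto_eventually) (auto elim: eventually_mono)
        qed simp
        show ?thesis
          unfolding U_def kato_def ent_def
          by (intro tendsto_intros e f b)
      qed
    qed
  qed
  moreover have "(\<lambda>n. \<integral>z. ?E n z \<partial>lborel) \<longlonglongrightarrow> 0"
    using tendsto_mult_right_zero[OF LIMSEQ_subseq_LIMSEQ[OF lim[OF g_integrable(2)] r(1)], of C]
    by (simp add: o_def)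
  ultimately have "(\<lambda>n. (\<integral>z. U n z \<partial>lborel) + (\<integral>z. ?E n z \<partial>lborel)) \<longlonglongrightarrow> (\<integral>z. kato \<psi> z \<partial>lborel) + 0"
    by (rule tendsto_add)
  then have "\<forall>\<^sub>F n in sequentially. (\<integral>z. U n z \<partial>lborel) + (\<integral>z. ?E n z \<partial>lborel) < (\<integral>z. kato \<psi> z \<partial>lborel) + \<epsilon>"
    using assms by (intro order_tendstoD(2)) auto
  then obtain n where n: "(\<integral>z. U n z \<partial>lborel) + (\<integral>z. ?E n z \<partial>lborel) < (\<integral>z. kato \<psi> z \<partial>lborel) + \<epsilon>"
    by (auto simp: eventually_sequentially)
  have E_int: "integrable lborel (?E n)"
    using diff_int[OF g_integrable(2), of "r n"] by (rule integrable_mult_right)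
  have "(\<integral>z. bulk \<psi> (\<xi> (r n)) z \<partial>lborel) \<le> (\<integral>z. U n z + ?E n z \<partial>lborel)"
    by (rule integral_mono[OF integrable_bulk Bochner_Integration.integrable_add[OF U_int E_int] bulk_le])
  also have "\<dots> = (\<integral>z. U n z \<partial>lborel) + (\<integral>z. ?E n z \<partial>lborel)"
    by (rule Bochner_Integration.integral_add[OF U_int E_int])
  finally show False
    using n \<xi>(2)[of "r n"] by simp
qed

text \<open>
  The nodes with \<open>j \<le> Suc J\<close> divide \<open>[- M, M]\<close> into \<open>J + 1\<close> cells, and \<open>osc J x\<close> is the largest
  increment of the monotone function \<open>e x\<close> over a cell. They reduce the comparison of \<open>e x\<close> with
  \<open>e y\<close>, uniformly on \<open>[- M, M]\<close>, to finitely many measurable functions of the space variable.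
\<close>

definition node :: "nat \<Rightarrow> nat \<Rightarrow> real"
  where "node J j = - M + 2 * M * real j / real (Suc J)"

definition osc :: "nat \<Rightarrow> real ^ 'n \<Rightarrow> real"
  where "osc J x = Max ((\<lambda>j. e x (node J (Suc j)) - e x (node J j)) ` {..J})"

lemma M_nonneg: "0 \<le> M"
  by (rule order_trans[OF abs_ge_zero v_bounded(1)])

lemma node_bounded: "j \<le> Suc J \<Longrightarrow> \<bar>node J j\<bar> \<le> M"
proof -
  assume "j \<le> Suc J"
  then have "2 * M * (real j / real (Suc J)) \<le> 2 * M * 1"
    using M_nonneg by (intro mult_left_mono) (auto simp: divide_le_eq_1)
  moreover have "0 \<le> 2 * M * (real j / real (Suc J))"
    using M_nonneg by simp
  ultimately show ?thesis
    unfolding node_def abs_le_iff times_divide_eq_right by linarith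
qed

lemma node_mono: "node J j \<le> node J (Suc j)"
  unfolding node_def using M_nonneg by (intro add_left_mono divide_right_mono mult_left_mono) auto

lemma node_cell:
  assumes "\<bar>k\<bar> \<le> M"
  obtains j where "j \<le> J" "node J j \<le> k" "k \<le> node J (Suc j)"
proof -
  define j where "j = (LEAST j. k \<le> node J (Suc j))"
  have last: "k \<le> node J (Suc J)"
    using assms by (simp add: node_def del: of_nat_Suc)
  then have "k \<le> node J (Suc j)"
    unfolding j_def by (rule LeastI)
  moreover have "j \<le> J"
    unfolding j_def using last by (rule Least_le)
  moreover have "node J j \<le> k"
  proof (cases j)
    case 0
    then show ?thesis
      using assms by (simp add: node_def)
  next
    case (Suc i)
    then have "\<not> k \<le> node J (Suc i)"
      using not_less_Least[of i "\<lambda>j. k \<le> node J (Suc j)"] by (simp add: j_def)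
    then show ?thesis
      using Suc by simp
  qed
  ultimately show thesis
    using that by blast
qed

lemma osc_ge: "j \<le> J \<Longrightarrow> e x (node J (Suc j)) - e x (node J j) \<le> osc J x"
  unfolding osc_def by (rule Max_ge[OF finite_imageI[OF finite_atMost] image_eqI[OF refl]]) simp

lemma osc_bounds: "0 \<le> osc J x" "osc J x \<le> 2 * B"
proof -
  have "0 \<le> e x (node J (Suc 0)) - e x (node J 0)"
    using monoD[OF e_mono node_mono[of J 0], of x] by simp
  also have "e x (node J (Suc 0)) - e x (node J 0) \<le> osc J x"
    by (rule osc_ge) simp
  finally show "0 \<le> osc J x" .
  have "e x (node J (Suc j)) - e x (node J j) \<le> 2 * B" if "j \<le> J" for j
    using e_bounded[OF node_bounded, of "Suc j" J x] e_bounded[OF node_bounded, of j J x] that by simp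
  then show "osc J x \<le> 2 * B"
    unfolding osc_def by (subst Max_le_iff) auto
qed

lemma osc_measurable [measurable]: "osc J \<in> borel_measurable borel"
  unfolding osc_def[abs_def] by measurable

text \<open>
  By monotonicity \<open>e x k\<close> and \<open>e y k\<close> lie between their values at the ends of the cell of \<open>k\<close>. The
  oscillation is needed at \<open>x\<close> only, because the values at \<open>y\<close> are compared with those at \<open>x\<close> at the
  nodes.
\<close>

lemma discretisation:
  assumes "\<bar>k\<bar> \<le> M"
  shows "\<bar>e x k - e y k\<bar> \<le> (\<Sum>j\<le>Suc J. \<bar>e x (node J j) - e y (node J j)\<bar>) + osc J x"
proof -
  obtain j where j: "j \<le> J" "node J j \<le> k" "k \<le> node J (Suc j)"
    using node_cell[OF assms] .
  have "e u (node J j) \<le> e u k" "e u k \<le> e u (node J (Suc j))" for u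
    using j(2,3) monoD[OF e_mono] by auto
  note this[of x] this[of y]
  moreover have "e x (node J (Suc j)) - e x (node J j) \<le> osc J x"
    using j(1) by (rule osc_ge)
  moreover have "\<bar>e x (node J i) - e y (node J i)\<bar> \<le> (\<Sum>j\<le>Suc J. \<bar>e x (node J j) - e y (node J j)\<bar>)"
    if "i \<le> Suc J" for i
    using that by (intro member_le_sum) auto
  from this[of j] this[of "Suc j"] j(1)
  have "\<bar>e x (node J j) - e y (node J j)\<bar> \<le> (\<Sum>j\<le>Suc J. \<bar>e x (node J j) - e y (node J j)\<bar>)"
    "\<bar>e x (node J (Suc j)) - e y (node J (Suc j))\<bar> \<le> (\<Sum>j\<le>Suc J. \<bar>e x (node J j) - e y (node J j)\<bar>)"
    by auto
  ultimately show ?thesis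
    by linarith
qed

lemma osc_tendsto_0: "(\<lambda>J. osc J x) \<longlonglongrightarrow> 0"
proof (rule LIMSEQ_I)
  fix r :: real
  assume "0 < r"
  have "uniformly_continuous_on {- M..M} (e x)"
    using e_continuous by (intro compact_uniformly_continuous) (auto intro: continuous_on_subset)
  then obtain d where d: "0 < d" "\<And>k l. k \<in> {- M..M} \<Longrightarrow> l \<in> {- M..M} \<Longrightarrow> dist l k < d \<Longrightarrow> dist (e x l) (e x k) < r"
    using \<open>0 < r\<close> unfolding uniformly_continuous_on_def by metis
  obtain J0 :: nat where J0: "2 * M / d < real J0"
    using reals_Archimedean2 by blast
  have "norm (osc J x - 0) < r" if "J0 \<le> J" for J
  proof -
    have "2 * M / d < real (Suc J)"
      using J0 that by simp
    then have step: "2 * M / real (Suc J) < d"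
      using d(1) by (simp add: divide_less_eq mult.commute del: of_nat_Suc)
    have "e x (node J (Suc j)) - e x (node J j) < r" if "j \<le> J" for j
    proof -
      have "node J (Suc j) - node J j = 2 * M / real (Suc J)"
        by (simp add: node_def field_simps del: of_nat_Suc) (simp add: algebra_simps)
      then have "dist (node J (Suc j)) (node J j) < d"
        using step M_nonneg by (simp add: dist_real_def)
      then have "dist (e x (node J (Suc j))) (e x (node J j)) < r"
        using node_bounded[of j J] node_bounded[of "Suc j" J] that by (intro d(2)) (auto simp: abs_le_iff)
      then show ?thesis
        by (simp add: dist_real_def)
    qed
    then have "osc J x < r"
      unfolding osc_def by (subst Max_less_iff) auto
    then show ?thesis
      using osc_bounds(1)[of J x] by simp
  qed
  then show "\<exists>J0. \<forall>J\<ge>J0. norm (osc J x - 0) < r"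
    by blast
qed

text \<open>
  The mismatch compares \<open>e\<close> at \<open>x\<close> and at \<open>x - h\<close>, where \<open>h = snd \<zeta>\<close>, at values from \<open>[- M, M]\<close>.
  By \<open>discretisation\<close> it is bounded by the oscillation, which is small in the mean for a fine grid,
  and by the shift defects of the functions \<open>e (snd z) (node J j)\<close>, which do not see the time component
  of \<open>\<zeta>\<close>. The grid is fixed first; then \<open>h\<close> is made small.
\<close>

lemma mismatch_small:
  assumes "0 < \<epsilon>"
  shows "\<exists>\<delta>>0. \<forall>\<zeta>. norm (snd \<zeta>) < \<delta> \<longrightarrow> \<bar>\<integral>z. mismatch \<psi> \<zeta> z \<partial>lborel\<bar> < \<epsilon>"
proof -
  let ?S = "supp \<psi>"
  have S[measurable]: "?S \<in> sets borel"
    using \<psi>D(2) by (rule borel_compact)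
  obtain C where C: "0 \<le> C" "\<And>z. norm (\<psi> z) \<le> C"
    using bounded_continuous_compact_support[OF \<psi>_continuous(1) \<psi>D(2)] zero_outside_support[of _ \<psi>] by metis
  have osc_int: "integrable lborel (\<lambda>z. osc J (snd z) * \<psi> z)" for J
    using osc_bounds \<psi>D(2)
    by (intro integrable_times_\<psi> set_integrable_bounded_compact[where C = "2 * B"]) auto
  have "(\<lambda>J. \<integral>z. osc J (snd z) * \<psi> z \<partial>lborel) \<longlonglongrightarrow> (\<integral>z. 0 * \<psi> z \<partial>lborel)"
  proof (rule integral_dominated_convergence)
    show "integrable lborel (\<lambda>z. 2 * B * \<psi> z)"
      by (rule integrable_times_\<psi>[OF set_integrable_const_supp])
    show "AE z in lborel. (\<lambda>J. osc J (snd z) * \<psi> z) \<longlonglongrightarrow> 0 * \<psi> z"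
      by (intro AE_I2 tendsto_intros osc_tendsto_0)
    show "AE z in lborel. norm (osc J (snd z) * \<psi> z) \<le> 2 * B * \<psi> z" for J
      using osc_bounds \<psi>_nonneg by (intro AE_I2) (simp add: abs_mult mult_right_mono)
  qed measurable
  then have "\<forall>\<^sub>F J in sequentially. (\<integral>z. osc J (snd z) * \<psi> z \<partial>lborel) < \<epsilon> / 4"
    by (rule order_tendstoD(2)) (use assms in simp)
  then obtain J where J: "(\<integral>z. osc J (snd z) * \<psi> z \<partial>lborel) < \<epsilon> / 4"
    by (auto simp: eventually_sequentially)
  define p where "p j z = e (snd z) (node J j)" for j and z :: "real \<times> (real ^ 'n)"
  have p_meas[measurable]: "p j \<in> borel_measurable borel" for j
    unfolding p_def by measurable
  have p_int: "set_integrable lborel S (p j)" if "j \<le> Suc J" "compact S" for j S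
    using that by (intro set_integrable_bounded_compact[where C = B]) (auto simp: p_def intro!: e_bounded node_bounded)
  define N where "N h = (\<Sum>j\<le>Suc J. \<integral>z. indicator ?S z * \<bar>p j z - p j (z - (0, h))\<bar> \<partial>lborel)" for h
  have "((\<lambda>h. 2 * C * N h) \<longlongrightarrow> 2 * C * (\<Sum>j\<le>Suc J. 0)) (nhds 0)"
    unfolding N_def
  proof (intro tendsto_mult tendsto_const tendsto_sum)
    fix j
    assume "j \<in> {..Suc J}"
    then have "((\<lambda>\<zeta>. \<integral>z. indicator ?S z * \<bar>p j z - p j (z - \<zeta>)\<bar> \<partial>lborel) \<longlongrightarrow> 0) (nhds 0)"
      by (intro local_shift_tendsto_0 p_int \<psi>D) auto
    moreover have "((\<lambda>h::real ^ 'n. (0::real, h)) \<longlongrightarrow> (0, 0)) (nhds 0)"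
      by (intro tendsto_intros filterlim_ident)
    ultimately show "((\<lambda>h. \<integral>z. indicator ?S z * \<bar>p j z - p j (z - (0, h))\<bar> \<partial>lborel) \<longlongrightarrow> 0) (nhds 0)"
      unfolding zero_prod_def by (rule filterlim_compose)
  qed
  then have "\<forall>\<^sub>F h in nhds 0. 2 * C * N h < \<epsilon> / 2"
    by (rule order_tendstoD(2)) (use assms in simp)
  then obtain \<delta> where \<delta>: "0 < \<delta>" "\<And>h. norm h < \<delta> \<Longrightarrow> 2 * C * N h < \<epsilon> / 2"
    unfolding eventually_nhds_metric by auto
  have "\<bar>\<integral>z. mismatch \<psi> \<zeta> z \<partial>lborel\<bar> < \<epsilon>" if "norm (snd \<zeta>) < \<delta>" for \<zeta>
  proof -
    let ?h = "snd \<zeta>"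
    let ?d = "\<lambda>j z. indicator ?S z * \<bar>p j z - p j (z - (0, ?h))\<bar>"
    let ?D = "\<lambda>z. 2 * C * (\<Sum>j\<le>Suc J. ?d j z) + 2 * (osc J (snd z) * \<psi> z)"
    have d_int: "integrable lborel (?d j)" if "j \<le> Suc J" for j
      by (rule integrable_local_shift[OF p_int[OF that] \<psi>D(2)])
    have s_int: "integrable lborel (\<lambda>z. \<Sum>j\<le>Suc J. ?d j z)"
      by (rule Bochner_Integration.integrable_sum) (simp only: d_int atMost_iff)
    have D_int: "integrable lborel ?D"
      by (rule Bochner_Integration.integrable_add[OF integrable_mult_right[OF s_int] integrable_mult_right[OF osc_int]])
    have mD: "\<bar>mismatch \<psi> \<zeta> z\<bar> \<le> ?D z" for z
    proof (cases "z \<in> ?S")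
      case True
      let ?x = "snd z" and ?y = "snd z - ?h" and ?a = "v1 z" and ?b = "v2 (z - \<zeta>)"
      let ?s = "\<Sum>j\<le>Suc J. \<bar>p j z - p j (z - (0, ?h))\<bar>"
      have s: "?s = (\<Sum>j\<le>Suc J. \<bar>e ?x (node J j) - e ?y (node J j)\<bar>)"
        by (simp add: p_def)
      have "\<bar>ent ?x ?a ?b - ent ?y ?a ?b\<bar> \<le> \<bar>e ?x ?a - e ?y ?a\<bar> + \<bar>e ?x ?b - e ?y ?b\<bar>"
        by (auto simp: ent_def max_def)
      also have "\<dots> \<le> 2 * ?s + 2 * osc J ?x"
        using discretisation[OF v_bounded(1), of ?x z ?y J] discretisation[OF v_bounded(2), of ?x "z - \<zeta>" ?y J]
        unfolding s by linarith
      finally have "\<bar>mismatch \<psi> \<zeta> z\<bar> \<le> (2 * ?s + 2 * osc J ?x) * \<psi> z"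
        using \<psi>_nonneg[of z] by (simp add: mismatch_def abs_mult mult_right_mono)
      also have "\<dots> = 2 * (\<psi> z * ?s) + 2 * (osc J ?x * \<psi> z)"
        by (simp add: algebra_simps)
      also have "\<psi> z * ?s \<le> C * ?s"
        using C(2)[of z] by (intro mult_right_mono sum_nonneg) auto
      finally show ?thesis
        using True by simp
    next
      case False
      then show ?thesis
        using zero_outside_support[of z \<psi>] by (simp add: mismatch_def)
    qed
    have "\<bar>\<integral>z. mismatch \<psi> \<zeta> z \<partial>lborel\<bar> \<le> (\<integral>z. \<bar>mismatch \<psi> \<zeta> z\<bar> \<partial>lborel)"
      by (rule integral_abs_bound)
    also have "\<dots> \<le> (\<integral>z. ?D z \<partial>lborel)"
      using mD by (intro integral_mono integrable_abs integrable_mismatch D_int)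
    also have "\<dots> = (\<integral>z. 2 * C * (\<Sum>j\<le>Suc J. ?d j z) \<partial>lborel)
        + (\<integral>z. 2 * (osc J (snd z) * \<psi> z) \<partial>lborel)"
      by (rule Bochner_Integration.integral_add[OF integrable_mult_right[OF s_int] integrable_mult_right[OF osc_int]])
    also have "\<dots> = 2 * C * N ?h + 2 * (\<integral>z. osc J (snd z) * \<psi> z \<partial>lborel)"
      unfolding integral_mult_right_zero N_def using d_int
      by (subst Bochner_Integration.integral_sum) (simp_all only: atMost_iff)
    also have "\<dots> < \<epsilon>"
      using \<delta>(2)[OF that] J by simp
    finally show ?thesis .
  qed
  with \<delta>(1) show ?thesis
    by blast
qed

end

end

section \<open>Anisotropic rescaling of test functions\<close>

definition stretch :: "real \<Rightarrow> real \<Rightarrow> real \<times> (real ^ 'n) \<Rightarrow> real \<times> (real ^ 'n)"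
  where "stretch a b \<zeta> = (a * fst \<zeta>, b *\<^sub>R snd \<zeta>)"

lemma bounded_linear_stretch: "bounded_linear (stretch a b)"
  unfolding stretch_def[abs_def]
  by (intro bounded_linear_Pair bounded_linear_const_mult bounded_linear_fst
      bounded_linear_const_scaleR bounded_linear_snd)

lemma stretch_Basis:
  "u \<in> Basis \<Longrightarrow> stretch a b u = (if u = (1, 0) then a else b) *\<^sub>R u"
  by (auto simp: stretch_def Basis_prod_def)

lemma stretch_sum:
  fixes \<zeta> :: "real \<times> (real ^ 'n)"
  shows "stretch a b \<zeta> = (\<Sum>u\<in>Basis. ((if u = (1, 0) then a else b) * (\<zeta> \<bullet> u)) *\<^sub>R u)"
proof -
  have "stretch a b \<zeta> = stretch a b (\<Sum>u\<in>Basis. (\<zeta> \<bullet> u) *\<^sub>R u)"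
    by (simp add: euclidean_representation)
  also have "\<dots> = (\<Sum>u\<in>Basis. (\<zeta> \<bullet> u) *\<^sub>R stretch a b u)"
    by (simp add: linear_sum[OF bounded_linear.linear[OF bounded_linear_stretch]]
        linear_scale[OF bounded_linear.linear[OF bounded_linear_stretch]])
  also have "\<dots> = (\<Sum>u\<in>Basis. ((if u = (1, 0) then a else b) * (\<zeta> \<bullet> u)) *\<^sub>R u)"
    by (intro sum.cong refl) (simp only: stretch_Basis scaleR_scaleR mult.commute)
  finally show ?thesis .
qed

text \<open>
  The Jacobian \<open>s\<close> is left unspecified since it cancels: in \<open>kato_inequality\<close> it is common to the
  integrals of \<open>R\<close> and of \<open>d_t R\<close>, whose quotient is thus independent of \<open>b\<close>.
\<close>

lemma integral_stretch:
  fixes z0 :: "real \<times> (real ^ 'n)"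
  assumes "a \<noteq> 0" "b \<noteq> 0"
  obtains s :: real where "0 < s"
    "\<And>f :: _ \<Rightarrow> real. f \<in> borel_measurable borel \<Longrightarrow>
      (\<integral>z. f z \<partial>lborel) = s * (\<integral>\<zeta>. f (z0 + stretch a b \<zeta>) \<partial>lborel)"
proof -
  let ?c = "\<lambda>u :: real \<times> (real ^ 'n). if u = (1, 0) then a else b"
  let ?s = "\<Prod>u\<in>Basis. \<bar>?c u\<bar>"
  have c: "\<And>u. u \<in> Basis \<Longrightarrow> ?c u \<noteq> 0"
    using assms by simp
  have L: "lborel = density (distr lborel borel (\<lambda>\<zeta>. z0 + stretch a b \<zeta>)) (\<lambda>_. ennreal ?s)"
    unfolding stretch_sum by (rule lborel_affine_euclidean[OF c])
  have cont: "continuous_on UNIV (\<lambda>\<zeta>. z0 + stretch a b \<zeta>)"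
    by (intro continuous_intros linear_continuous_on bounded_linear_stretch)
  have T: "(\<lambda>\<zeta>. z0 + stretch a b \<zeta>) \<in> lborel \<rightarrow>\<^sub>M borel"
    using cont by (simp add: borel_measurable_continuous_onI)
  have "0 < ?s"
    using c by (intro prod_pos) simp
  moreover have "(\<integral>z. f z \<partial>lborel) = ?s * (\<integral>\<zeta>. f (z0 + stretch a b \<zeta>) \<partial>lborel)"
    if f: "f \<in> borel_measurable borel" for f :: "_ \<Rightarrow> real"
  proof -
    have "(\<integral>z. f z \<partial>lborel) = (\<integral>z. ?s * f z \<partial>distr lborel borel (\<lambda>\<zeta>. z0 + stretch a b \<zeta>))"
      using f \<open>0 < ?s\<close> by (subst L, subst integral_density) auto
    also have "\<dots> = (\<integral>\<zeta>. ?s * f (z0 + stretch a b \<zeta>) \<partial>lborel)"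
      using f T by (intro integral_distr) auto
    finally show ?thesis
      by simp
  qed
  ultimately show thesis
    by (rule that)
qed

text \<open>
  The test function \<open>\<psi>\<close>, recentred at \<open>z0\<close> and contracted by \<open>a\<close> in time and by \<open>b\<close> in space, serves
  as the function \<open>R\<close> of the doubling argument.
\<close>

lemma test_function_stretch:
  fixes \<psi> :: "real \<times> (real ^ 'n) \<Rightarrow> real" and z0 :: "real \<times> (real ^ 'n)"
  assumes \<psi>: "\<psi> \<in> test_functions \<Omega>" and ab: "a \<noteq> 0" "b \<noteq> 0"
  defines "R \<equiv> \<lambda>\<zeta>. \<psi> (z0 + stretch a b \<zeta>)"
  shows "R \<in> test_functions UNIV"
    and "d_t R \<zeta> = a * d_t \<psi> (z0 + stretch a b \<zeta>)"
    and "\<zeta> \<in> supp R \<Longrightarrow> z0 + stretch a b \<zeta> \<in> supp \<psi>"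
proof -
  note \<psi>D = test_functionsD[OF \<psi>]
  let ?K = "(\<lambda>y. stretch (1 / a) (1 / b) (y - z0)) ` supp \<psi>"
  have K: "\<zeta> \<in> ?K" if "z0 + stretch a b \<zeta> \<in> supp \<psi>" for \<zeta>
    using ab by (intro image_eqI[OF _ that]) (simp add: stretch_def)
  show "R \<in> test_functions UNIV"
  proof (rule test_functionsI)
    show "smooth R"
      unfolding R_def by (rule smooth_affine[OF \<psi>D(1) bounded_linear_stretch stretch_Basis])
    show "compact ?K"
      using \<psi>D(2)
      by (intro compact_continuous_image linear_continuous_on_compose[OF _ bounded_linear.linear[OF bounded_linear_stretch]]
          continuous_intros)
    show "R \<zeta> = 0" if "\<zeta> \<notin> ?K" for \<zeta>
      using K[of \<zeta>] that zero_outside_support[of "z0 + stretch a b \<zeta>" \<psi>] unfolding R_def by blast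
  qed simp
  have "d_t R \<zeta> = frechet_derivative \<psi> (at (z0 + stretch a b \<zeta>)) (stretch a b (1, 0))"
    unfolding R_def d_t_def
    using frechet_derivative_affine(1)[OF smooth_differentiable[OF \<psi>D(1)] bounded_linear_stretch] by metis
  also have "stretch a b (1, 0) = a *\<^sub>R (1, 0 :: real ^ 'n)"
    by (simp add: stretch_def)
  finally show "d_t R \<zeta> = a * d_t \<psi> (z0 + stretch a b \<zeta>)"
    unfolding d_t_def
    by (simp only: linear_scale[OF linear_frechet_derivative[OF smooth_differentiable[OF \<psi>D(1)]]] real_scaleR_def)
  have cont: "continuous_on UNIV (\<lambda>\<zeta>. z0 + stretch a b \<zeta>)"
    by (intro continuous_intros linear_continuous_on bounded_linear_stretch)
  have "closed ((\<lambda>\<zeta>. z0 + stretch a b \<zeta>) -` supp \<psi>)"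
    by (rule closed_vimage[OF closed_supp cont])
  moreover have "\<zeta> \<in> (\<lambda>\<zeta>. z0 + stretch a b \<zeta>) -` supp \<psi>" if "R \<zeta> \<noteq> 0" for \<zeta>
    using that zero_outside_support[of "z0 + stretch a b \<zeta>" \<psi>] unfolding R_def by blast
  ultimately have "supp R \<subseteq> (\<lambda>\<zeta>. z0 + stretch a b \<zeta>) -` supp \<psi>"
    unfolding supp_def[of R] by (intro closure_minimal) blast+
  then show "\<zeta> \<in> supp R \<Longrightarrow> z0 + stretch a b \<zeta> \<in> supp \<psi>"
    by auto
qed

lemma integral_pos_of_continuous:
  fixes f :: "'a::euclidean_space \<Rightarrow> real"
  assumes "continuous_on UNIV f" "\<And>z. 0 \<le> f z" "integrable lborel f" "0 < f z0"
  shows "0 < (\<integral>z. f z \<partial>lborel)"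
proof -
  have "isCont f z0"
    using assms(1) by (simp add: continuous_on_eq_continuous_at)
  then obtain d where d: "0 < d" "\<And>z. dist z z0 < d \<Longrightarrow> \<bar>f z - f z0\<bar> < f z0 / 2"
    using assms(4) unfolding continuous_at_eps_delta dist_real_def by (metis half_gt_zero)
  have "0 < f z0 / 2 * measure lborel (ball z0 d)"
    using assms(4) content_ball_pos[OF d(1)] by simp
  also have "\<dots> = (\<integral>z. f z0 / 2 * indicator (ball z0 d) z \<partial>lborel)"
    by simp
  also have "\<dots> \<le> (\<integral>z. f z \<partial>lborel)"
  proof (rule integral_mono[OF _ assms(3)])
    show "integrable lborel (\<lambda>z. f z0 / 2 * indicator (ball z0 d) z)"
      using emeasure_bounded_finite[OF bounded_ball, of z0 d]
      by (intro integrable_mult_right integrable_real_indicator) auto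
    show "f z0 / 2 * indicator (ball z0 d) z \<le> f z" for z
    proof (cases "z \<in> ball z0 d")
      case True
      then have "\<bar>f z - f z0\<bar> < f z0 / 2"
        by (intro d(2)) (simp add: dist_commute)
      then have "f z0 / 2 \<le> f z"
        by linarith
      with True show ?thesis
        by simp
    next
      case False
      with assms(2)[of z] show ?thesis
        by simp
    qed
  qed
  finally show ?thesis .
qed

section \<open>Kato's inequality for Borel data\<close>

context entropy_pair
begin

text \<open>
  If \<open>\<psi>\<close> is positive at \<open>z0\<close>, then \<open>doubling\<close> with the contracted copy of \<open>\<psi>\<close> gives
  \<open>0 \<le> (\<integral>z. kato \<psi> z) + \<epsilon>\<close> for every \<open>\<epsilon> > 0\<close>, once the contraction \<open>a\<close> in time and then, depending
  on \<open>a\<close>, the contraction \<open>b\<close> in space are large enough.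
\<close>

theorem kato_inequality:
  assumes \<psi>: "\<psi> \<in> test_functions time_space" and nonneg: "\<And>z. 0 \<le> \<psi> z"
  shows "0 \<le> (\<integral>z. kato \<psi> z \<partial>lborel)"
proof (cases "\<exists>z. 0 < \<psi> z")
  case False
  then have "\<psi> z = 0" for z
  proof -
    have "\<not> 0 < \<psi> z"
      using False by blast
    with nonneg[of z] show ?thesis
      by linarith
  qed
  then have "supp \<psi> = {}" and \<psi>0: "\<And>z. \<psi> z = 0"
    by (auto simp: supp_def)
  then have "kato \<psi> z = 0" for z
    using d_t_outside_support[of z \<psi>] grad_x_outside_support[of z \<psi>] \<psi>0[of z] by (simp add: kato_def)
  then show ?thesis
    by simp
next
  case True
  then obtain z0 where z0: "0 < \<psi> z0"
    by blast
  note \<psi>D = test_functionsD[OF \<psi>]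
  note cont = smooth_continuous[OF \<psi>D(1)] continuous_on_d_t[OF \<psi>D(1)]
  note [measurable] = cont[THEN borel_measurable_continuous_onI]
  have z0_supp: "z0 \<in> supp \<psi>"
    using zero_outside_support[of z0 \<psi>] z0 by force
  obtain \<rho> where \<rho>: "0 < \<rho>" "\<And>y. y \<in> supp \<psi> \<Longrightarrow> dist z0 y \<le> \<rho>"
  proof -
    obtain r where "\<forall>y\<in>supp \<psi>. dist z0 y \<le> r"
      using compact_imp_bounded[OF \<psi>D(2)] bounded_any_center[of _ z0] by blast
    then show thesis
      by (intro that[of "max r 1"]) (auto simp: le_max_iff_disj)
  qed
  obtain y0 where y0: "y0 \<in> supp \<psi>" "\<And>y. y \<in> supp \<psi> \<Longrightarrow> fst y0 \<le> fst y"
    using continuous_attains_inf[OF \<psi>D(2), of fst] z0_supp continuous_on_fst[OF continuous_on_id] by blast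
  define \<delta>0 where "\<delta>0 = fst y0"
  have \<delta>0: "0 < \<delta>0" "\<And>y. y \<in> supp \<psi> \<Longrightarrow> \<delta>0 \<le> fst y"
    using y0 \<psi>D(3) by (auto simp: \<delta>0_def)
  have int_\<psi>: "integrable lborel \<psi>" and int_d: "integrable lborel (\<lambda>z. \<bar>d_t \<psi> z\<bar>)"
    using integrable_times_\<psi>(1,2)[OF \<psi> nonneg set_integrable_const_supp[OF \<psi> nonneg, of 1]] by auto
  define c where "c = (\<integral>z. \<psi> z \<partial>lborel)"
  define C where "C = (\<integral>z. \<bar>d_t \<psi> z\<bar> \<partial>lborel)"
  have c: "0 < c"
    unfolding c_def by (rule integral_pos_of_continuous[OF cont(1) nonneg int_\<psi> z0])
  have C: "0 \<le> C"
    by (simp add: C_def)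
  show ?thesis
  proof (rule field_le_epsilon)
    fix \<epsilon> :: real
    assume \<epsilon>: "0 < \<epsilon>"
    let ?k = "\<integral>z. kato \<psi> z \<partial>lborel"
    obtain \<delta> where \<delta>: "0 < \<delta>" "\<And>\<zeta>. norm \<zeta> < \<delta> \<Longrightarrow> (\<integral>z. bulk \<psi> \<zeta> z \<partial>lborel) < ?k + \<epsilon> / 2"
      using bulk_upper_limit[OF \<psi> nonneg, of "\<epsilon> / 2"] \<epsilon> by auto
    \<comment> \<open>The terms of \<open>a\<close> put the time component of \<open>\<zeta>\<close> below \<open>\<delta> / 2\<close> and below \<open>\<delta>0\<close>, the distance
      of the support of \<open>\<psi>\<close> from the initial time.\<close>
    define a where "a = 2 * \<rho> / \<delta> + \<rho> / \<delta>0 + 1"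
    have a: "0 < a" "\<rho> / a < \<delta> / 2" "\<rho> / a < \<delta>0"
      using \<rho>(1) \<delta>(1) \<delta>0(1) by (auto simp: a_def field_simps add_pos_pos)
    \<comment> \<open>The tolerance for the mismatch absorbs the factor \<open>a\<close> produced by the time derivative of \<open>R\<close>.\<close>
    define \<epsilon>' where "\<epsilon>' = \<epsilon> / 2 * c / (a * C + 1)"
    have aC: "0 < a * C + 1"
      using a(1) C by (intro add_nonneg_pos mult_nonneg_nonneg) auto
    then have \<epsilon>': "0 < \<epsilon>'"
      using \<epsilon> c by (simp add: \<epsilon>'_def)
    have "\<epsilon>' * (a * C + 1) = \<epsilon> / 2 * c"
      using aC nonzero_eq_divide_eq[of "a * C + 1" \<epsilon>' "\<epsilon> / 2 * c"] by (simp add: \<epsilon>'_def)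
    then have \<epsilon>'_le: "\<epsilon>' * (a * C) \<le> \<epsilon> / 2 * c"
      using \<epsilon>' by (simp add: algebra_simps)
    obtain \<delta>' where \<delta>': "0 < \<delta>'" "\<And>\<zeta>. norm (snd \<zeta>) < \<delta>' \<Longrightarrow> \<bar>\<integral>z. mismatch \<psi> \<zeta> z \<partial>lborel\<bar> < \<epsilon>'"
      using mismatch_small[OF \<psi> nonneg \<epsilon>'] by blast
    define b where "b = 2 * \<rho> / \<delta> + \<rho> / \<delta>' + 1"
    have b: "0 < b" "\<rho> / b < \<delta> / 2" "\<rho> / b < \<delta>'"
      using \<rho>(1) \<delta>(1) \<delta>'(1) by (auto simp: b_def field_simps add_pos_pos)
    have ab: "a \<noteq> 0" "b \<noteq> 0"
      using a(1) b(1) by auto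
    define R where "R = (\<lambda>\<zeta>. \<psi> (z0 + stretch a b \<zeta>))"
    note R = test_function_stretch[OF \<psi> ab, where ?z0.0 = z0, folded R_def]
    note RD = test_functionsD[OF R(1)]
    have R_nonneg: "0 \<le> R \<zeta>" for \<zeta>
      by (simp add: R_def nonneg)
    have R_supp: "\<bar>fst \<zeta>\<bar> \<le> \<rho> / a" "norm (snd \<zeta>) \<le> \<rho> / b" if "\<zeta> \<in> supp R" for \<zeta>
    proof -
      have "norm (stretch a b \<zeta>) \<le> \<rho>"
        using \<rho>(2)[OF R(3)[OF that]] by (simp add: dist_norm)
      then have "norm (a * fst \<zeta>) \<le> \<rho>" "norm (b *\<^sub>R snd \<zeta>) \<le> \<rho>"
        using norm_fst_le[of "a * fst \<zeta>" "b *\<^sub>R snd \<zeta>"] norm_snd_le[of "b *\<^sub>R snd \<zeta>" "a * fst \<zeta>"]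
        by (auto simp: stretch_def)
      then show "\<bar>fst \<zeta>\<bar> \<le> \<rho> / a" "norm (snd \<zeta>) \<le> \<rho> / b"
        using a(1) b(1) by (auto simp: abs_mult field_simps)
    qed
    have shift: "z - \<zeta> \<in> time_space" if "z \<in> supp \<psi>" "\<zeta> \<in> supp R" for z \<zeta>
      using \<delta>0(2)[OF that(1)] R_supp(1)[OF that(2)] a(3) by (cases z, cases \<zeta>) auto
    define I where "I \<zeta> = (\<integral>z. R \<zeta> * bulk \<psi> \<zeta> z + d_t R \<zeta> * mismatch \<psi> \<zeta> z \<partial>lborel)" for \<zeta>
    have I: "integrable lborel I" "0 \<le> (\<integral>\<zeta>. I \<zeta> \<partial>lborel)"
      using doubling[OF \<psi> nonneg R(1) R_nonneg shift] unfolding I_def[abs_def] by auto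
    have I_le: "I \<zeta> \<le> (?k + \<epsilon> / 2) * R \<zeta> + \<epsilon>' * \<bar>d_t R \<zeta>\<bar>" for \<zeta>
    proof (cases "\<zeta> \<in> supp R")
      case True
      have "norm \<zeta> \<le> \<bar>fst \<zeta>\<bar> + norm (snd \<zeta>)"
        using norm_Pair_le[of "fst \<zeta>" "snd \<zeta>"] by simp
      also have "\<dots> < \<delta>"
        using R_supp[OF True] a(2) b(2) by linarith
      finally have bulk: "(\<integral>z. bulk \<psi> \<zeta> z \<partial>lborel) \<le> ?k + \<epsilon> / 2"
        using \<delta>(2) by (simp add: less_imp_le)
      have mismatch: "\<bar>\<integral>z. mismatch \<psi> \<zeta> z \<partial>lborel\<bar> \<le> \<epsilon>'"
        using \<delta>'(2)[of \<zeta>] R_supp(2)[OF True] b(3) by simp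
      have "I \<zeta> = R \<zeta> * (\<integral>z. bulk \<psi> \<zeta> z \<partial>lborel) + d_t R \<zeta> * (\<integral>z. mismatch \<psi> \<zeta> z \<partial>lborel)"
        unfolding I_def
        using integrable_bulk[OF \<psi> nonneg, of \<zeta>] integrable_mismatch[OF \<psi> nonneg, of \<zeta>] by simp
      also have "\<dots> \<le> R \<zeta> * (?k + \<epsilon> / 2) + \<bar>d_t R \<zeta>\<bar> * \<epsilon>'"
        using mult_left_mono[OF bulk R_nonneg] mult_left_mono[OF mismatch abs_ge_zero[of "d_t R \<zeta>"]]
          abs_ge_self[of "d_t R \<zeta> * (\<integral>z. mismatch \<psi> \<zeta> z \<partial>lborel)"]
        unfolding abs_mult by (meson add_mono order_trans)
      finally show ?thesis
        by (simp add: mult.commute)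
    next
      case False
      then show ?thesis
        using zero_outside_support[of \<zeta> R] d_t_outside_support[of \<zeta> R] by (simp add: I_def)
    qed
    obtain s where s: "0 < s" "\<And>f :: _ \<Rightarrow> real. f \<in> borel_measurable borel \<Longrightarrow>
        (\<integral>z. f z \<partial>lborel) = s * (\<integral>\<zeta>. f (z0 + stretch a b \<zeta>) \<partial>lborel)"
      using integral_stretch[OF ab, of z0] by blast
    have one: "set_integrable lborel (supp R) (\<lambda>_. 1 :: real)"
      by (rule set_integrable_bounded_compact[where C = 1]) (auto simp: RD)
    have int_R: "integrable lborel R"
      using integrable_continuous_compact_support[OF smooth_continuous[OF RD(1)] RD(2) _ one]
        zero_outside_support[of _ R] by simp
    have int_dR: "integrable lborel (\<lambda>\<zeta>. \<bar>d_t R \<zeta>\<bar>)"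
      using integrable_continuous_compact_support[OF continuous_on_d_t[OF RD(1)] RD(2) _ one]
        d_t_outside_support[of _ R] by simp
    have "c = s * (\<integral>\<zeta>. R \<zeta> \<partial>lborel)"
      unfolding c_def R_def by (rule s(2)) measurable
    moreover have "C = s * (\<integral>\<zeta>. \<bar>d_t \<psi> (z0 + stretch a b \<zeta>)\<bar> \<partial>lborel)"
      unfolding C_def by (rule s(2)) measurable
    then have "a * C = s * (\<integral>\<zeta>. \<bar>d_t R \<zeta>\<bar> \<partial>lborel)"
      using a(1) by (simp add: R(2) abs_mult)
    moreover have "0 \<le> (?k + \<epsilon> / 2) * (\<integral>\<zeta>. R \<zeta> \<partial>lborel) + \<epsilon>' * (\<integral>\<zeta>. \<bar>d_t R \<zeta>\<bar> \<partial>lborel)"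
    proof -
      have "(\<integral>\<zeta>. I \<zeta> \<partial>lborel) \<le> (\<integral>\<zeta>. (?k + \<epsilon> / 2) * R \<zeta> + \<epsilon>' * \<bar>d_t R \<zeta>\<bar> \<partial>lborel)"
        using int_R int_dR by (intro integral_mono I(1) I_le) auto
      also have "\<dots> = (?k + \<epsilon> / 2) * (\<integral>\<zeta>. R \<zeta> \<partial>lborel) + \<epsilon>' * (\<integral>\<zeta>. \<bar>d_t R \<zeta>\<bar> \<partial>lborel)"
        using int_R int_dR by simp
      finally show ?thesis
        using I(2) by simp
    qed
    then have "0 \<le> s * ((?k + \<epsilon> / 2) * (\<integral>\<zeta>. R \<zeta> \<partial>lborel) + \<epsilon>' * (\<integral>\<zeta>. \<bar>d_t R \<zeta>\<bar> \<partial>lborel))"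
      using s(1) by (intro mult_nonneg_nonneg) auto
    ultimately have "0 \<le> (?k + \<epsilon> / 2) * c + \<epsilon>' * (a * C)"
      by (simp add: algebra_simps)
    also have "\<dots> \<le> (?k + \<epsilon>) * c"
      using \<epsilon>'_le by (simp add: algebra_simps)
    finally show "0 \<le> ?k + \<epsilon>"
      using c by (simp add: zero_le_mult_iff)
  qed
qed

lemma integrable_kato_terms:
  assumes \<psi>: "\<psi> \<in> test_functions time_space" and nonneg: "\<And>z. 0 \<le> \<psi> z"
  shows "integrable lborel (\<lambda>z. ent (snd z) (v1 z) (v2 z) * d_t \<psi> z)"
    and "integrable lborel (\<lambda>z. flux (v1 z) (v2 z) \<bullet> grad_x \<psi> z)"
    and "integrable lborel (\<lambda>z. of_bool (v1 z > v2 z) * (g1 z - g2 z) * \<psi> z)"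
    and "integrable lborel (\<lambda>z. of_bool (v1 z = v2 z) * max (g1 z - g2 z) 0 * \<psi> z)"
proof -
  show "integrable lborel (\<lambda>z. ent (snd z) (v1 z) (v2 z) * d_t \<psi> z)"
    by (rule integrable_ent_flux(1)[OF \<psi> nonneg borel(1,2) snd_measurable v_bounded])
  show "integrable lborel (\<lambda>z. flux (v1 z) (v2 z) \<bullet> grad_x \<psi> z)"
    by (rule integrable_ent_flux(3)[OF \<psi> nonneg borel(1,2) snd_measurable v_bounded])
  note g = integrable_g_\<psi>(1)[OF \<psi> nonneg] integrable_g_\<psi>(2)[OF \<psi> nonneg, of 0, simplified]
  have d: "integrable lborel (\<lambda>z. (g1 z - g2 z) * \<psi> z)"
    using Bochner_Integration.integrable_diff[OF g] by (simp add: left_diff_distrib)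
  have "integrable lborel (\<lambda>z. of_bool (v1 z > v2 z) * ((g1 z - g2 z) * \<psi> z))"
    by (rule integrable_of_bool_mult[OF d]) measurable
  then show "integrable lborel (\<lambda>z. of_bool (v1 z > v2 z) * (g1 z - g2 z) * \<psi> z)"
    by (simp add: mult.assoc)
  have "integrable lborel (\<lambda>z. of_bool (v1 z = v2 z \<and> g1 z > g2 z) * ((g1 z - g2 z) * \<psi> z))"
    by (rule integrable_of_bool_mult[OF d]) measurable
  moreover have "of_bool (v1 z = v2 z \<and> g1 z > g2 z) * ((g1 z - g2 z) * \<psi> z)
      = of_bool (v1 z = v2 z) * max (g1 z - g2 z) 0 * \<psi> z" for z
    by (auto simp: max_def)
  ultimately show "integrable lborel (\<lambda>z. of_bool (v1 z = v2 z) * max (g1 z - g2 z) 0 * \<psi> z)"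
    by simp
qed

corollary kato_inequality_terms:
  assumes \<psi>: "\<psi> \<in> test_functions time_space" and nonneg: "\<And>z. 0 \<le> \<psi> z"
  shows "0 \<le> (\<integral>z. ent (snd z) (v1 z) (v2 z) * d_t \<psi> z \<partial>lborel)
    + (\<integral>z. flux (v1 z) (v2 z) \<bullet> grad_x \<psi> z \<partial>lborel)
    + (\<integral>z. of_bool (v1 z > v2 z) * (g1 z - g2 z) * \<psi> z \<partial>lborel)
    + (\<integral>z. of_bool (v1 z = v2 z) * max (g1 z - g2 z) 0 * \<psi> z \<partial>lborel)"
proof -
  note i = integrable_kato_terms[OF \<psi> nonneg]
  have "kato \<psi> z = ent (snd z) (v1 z) (v2 z) * d_t \<psi> z + flux (v1 z) (v2 z) \<bullet> grad_x \<psi> z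
      + of_bool (v1 z > v2 z) * (g1 z - g2 z) * \<psi> z
      + of_bool (v1 z = v2 z) * max (g1 z - g2 z) 0 * \<psi> z" for z
    unfolding kato_def by (simp only: distrib_right add.assoc)
  then show ?thesis
    using kato_inequality[OF \<psi> nonneg] i by simp
qed

end

section \<open>Borel representatives\<close>

text \<open>
  As the Lebesgue measure is complete, a function that agrees almost everywhere with a Borel function is
  measurable and has the same integral.
\<close>

lemma set_integral_eq_lborel:
  fixes f h :: "'a::euclidean_space \<Rightarrow> real"
  assumes [measurable]: "h \<in> borel_measurable borel"
    and "AE z in lebesgue. indicator \<Omega> z * f z = h z"
  shows "(LINT z : \<Omega> | lebesgue. f z) = (\<integral>z. h z \<partial>lborel)"
proof -
  have h: "h \<in> borel_measurable lebesgue"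
    by (rule measurable_completion) simp
  have "AE z in lebesgue. h z = indicator \<Omega> z * f z"
    using assms(2) by (rule AE_mp) simp
  with h have "(\<lambda>z. indicator \<Omega> z * f z) \<in> borel_measurable lebesgue"
    by (rule borel_measurable_AE)
  then have "(\<integral>z. indicator \<Omega> z * f z \<partial>lebesgue) = (\<integral>z. h z \<partial>lebesgue)"
    using h assms(2) by (intro integral_cong_AE)
  then show ?thesis
    by (simp add: set_lebesgue_integral_def integral_completion)
qed

lemma AE_lborel_snd:
  assumes "AE x in lborel. P x"
  shows "AE z in (lborel :: ('b::euclidean_space \<times> 'a::euclidean_space) measure). P (snd z)"
proof -
  obtain N where N: "\<And>x. x \<in> space lborel - N \<Longrightarrow> P x" "N \<in> null_sets lborel"
    using AE_E3[OF assms] by blast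
  have "emeasure (lborel \<Otimes>\<^sub>M lborel) ((UNIV :: 'b set) \<times> N) = emeasure lborel (UNIV :: 'b set) * emeasure lborel N"
    using N(2) by (intro lborel.emeasure_pair_measure_Times) auto
  then have "UNIV \<times> N \<in> null_sets (lborel \<Otimes>\<^sub>M lborel :: ('b \<times> 'a) measure)"
    using N(2) by (intro null_setsI) auto
  then have "AE z in (lborel :: ('b \<times> 'a) measure). z \<notin> UNIV \<times> N"
    unfolding lborel_prod by (rule AE_not_in)
  then show ?thesis
  proof (rule AE_mp, intro AE_I2 impI)
    show "P (snd z)" if "z \<notin> UNIV \<times> N" for z :: "'b \<times> 'a"
      using N(1)[of "snd z"] that by (cases z) simp
  qed
qed

text \<open>
  A Caratheodory function may be composed with a measurable one: rounding \<open>v x\<close> down to a multiple of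
  \<open>1 / (n + 1)\<close> leaves countably many rational values, and \<open>n\<close> tends to infinity.
\<close>

lemma caratheodory_measurable:
  fixes f :: "'a \<Rightarrow> real \<Rightarrow> real"
  assumes f: "\<And>q. q \<in> \<rat> \<Longrightarrow> (\<lambda>x. f x q) \<in> borel_measurable N"
    and cont: "\<And>x. x \<in> space N \<Longrightarrow> continuous_on UNIV (f x)"
    and v [measurable]: "v \<in> borel_measurable N"
  shows "(\<lambda>x. f x (v x)) \<in> borel_measurable N"
proof (rule borel_measurable_LIMSEQ_real)
  let ?q = "\<lambda>n (i::int). of_int i / real (Suc n)"
  show "(\<lambda>x. f x (?q n \<lfloor>v x * real (Suc n)\<rfloor>)) \<in> borel_measurable N" for n
  proof (rule measurable_compose_countable[where f = "\<lambda>i x. f x (?q n i)"])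
    show "(\<lambda>x. f x (?q n i)) \<in> borel_measurable N" for i
      by (rule f) simp
    show "(\<lambda>x. \<lfloor>v x * real (Suc n)\<rfloor>) \<in> N \<rightarrow>\<^sub>M count_space UNIV"
      by measurable
  qed
  show "(\<lambda>n. f x (?q n \<lfloor>v x * real (Suc n)\<rfloor>)) \<longlonglongrightarrow> f x (v x)" if "x \<in> space N" for x
  proof (rule continuous_on_tendsto_compose[OF cont[OF that]])
    have "\<bar>?q n \<lfloor>v x * real (Suc n)\<rfloor> - v x\<bar> \<le> 1 / real (Suc n)" for n
    proof -
      have "\<bar>of_int \<lfloor>v x * real (Suc n)\<rfloor> - v x * real (Suc n)\<bar> \<le> 1"
        by linarith
      then have "\<bar>of_int \<lfloor>v x * real (Suc n)\<rfloor> - v x * real (Suc n)\<bar> / real (Suc n) \<le> 1 / real (Suc n)"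
        by (rule divide_right_mono) simp
      moreover have "?q n \<lfloor>v x * real (Suc n)\<rfloor> - v x
          = (of_int \<lfloor>v x * real (Suc n)\<rfloor> - v x * real (Suc n)) / real (Suc n)"
        by (simp add: diff_divide_distrib del: of_nat_Suc)
      ultimately show ?thesis
        by (simp only: abs_divide abs_of_nat)
    qed
    then have "(\<lambda>n. ?q n \<lfloor>v x * real (Suc n)\<rfloor> - v x) \<longlonglongrightarrow> 0"
      by (intro Lim_null_comparison[OF _ LIMSEQ_Suc[OF lim_1_over_n]] always_eventually) auto
    then show "(\<lambda>n. ?q n \<lfloor>v x * real (Suc n)\<rfloor>) \<longlonglongrightarrow> v x"
      by (rule LIM_zero_cancel)
  qed auto
qed

lemma borel_measurable_of_compacts:
  fixes f :: "'a::euclidean_space \<Rightarrow> real"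
  assumes "\<And>K. compact K \<Longrightarrow> (\<lambda>x. indicator K x * f x) \<in> borel_measurable lebesgue"
  shows "f \<in> borel_measurable lebesgue"
proof (rule borel_measurable_LIMSEQ_real)
  show "(\<lambda>x. indicator (cball 0 (real n)) x * f x) \<in> borel_measurable lebesgue" for n
    by (rule assms) simp
  show "(\<lambda>n. indicator (cball 0 (real n)) x * f x) \<longlonglongrightarrow> f x" for x
  proof (rule tendsto_eventually)
    obtain n0 :: nat where "norm x \<le> real n0"
      using real_arch_simple by blast
    then show "\<forall>\<^sub>F n in sequentially. indicator (cball 0 (real n)) x * f x = f x"
      by (intro eventually_sequentiallyI[of n0]) (simp add: indicator_def)
  qed
qed

text \<open>
  The structure condition yields this for \<open>\<theta> x\<close> and \<open>\<eta> x\<close> at almost every \<open>x\<close>.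
\<close>

definition inverse_operator :: "(real \<Rightarrow> real set) \<Rightarrow> (real \<Rightarrow> real) \<Rightarrow> bool"
  where "inverse_operator T h \<longleftrightarrow> monotone_operator T \<and> (\<forall>u. T u \<noteq> {})
    \<and> (\<forall>s u. u = h s \<longleftrightarrow> s \<in> T u) \<and> continuous_on UNIV h"

lemma inverse_operator_mem: "inverse_operator T h \<Longrightarrow> s \<in> T (h s)"
  by (metis inverse_operator_def)

lemma inverse_operator_continuous: "inverse_operator T h \<Longrightarrow> continuous_on UNIV h"
  unfolding inverse_operator_def by (elim conjE)

lemma inverse_operator_mono:
  assumes "inverse_operator T h"
  shows "mono h"
proof (rule monoI, rule ccontr)
  fix k l :: real
  assume "k \<le> l" and *: "\<not> h k \<le> h l"
  then have "k < l"
    by (cases "k = l") auto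
  have "k \<in> T (h k)" "l \<in> T (h l)"
    using assms by (rule inverse_operator_mem)+
  then have "0 \<le> (k - l) * (h k - h l)"
    using assms unfolding inverse_operator_def monotone_operator_def by blast
  moreover have "(k - l) * (h k - h l) < 0"
    using \<open>k < l\<close> * by (intro mult_neg_pos) auto
  ultimately show False
    by simp
qed

text \<open>
  The set \<open>T u\<close> is closed and nonempty, so the least absolute value is attained. If it were attained at
  two points \<open>s\<close> and \<open>- s\<close>, then, \<open>h\<close> being monotone, also \<open>0\<close> would belong to \<open>T u\<close>.
\<close>

lemma least_abs_mem:
  assumes "inverse_operator T h"
  shows "least_abs (T u) \<in> T u"
proof -
  have "s \<in> T u \<longleftrightarrow> u = h s" for s
    using assms unfolding inverse_operator_def by blast
  then have T: "T u = {s. h s = u}"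
    by auto
  have "closed (T u)"
    using assms continuous_closed_vimage[of "{u}" h]
    unfolding T inverse_operator_def by (auto simp: vimage_def continuous_on_eq_continuous_at)
  moreover have "T u \<noteq> {}"
    using assms by (simp add: inverse_operator_def)
  ultimately obtain s where s: "s \<in> T u" "\<And>r. r \<in> T u \<Longrightarrow> \<bar>s\<bar> \<le> \<bar>r\<bar>"
    using distance_attains_inf[of "T u" 0] by (auto simp: dist_real_def)
  have "least_abs (T u) = s"
    unfolding least_abs_def
  proof (rule the_equality)
    fix r
    assume r: "r \<in> T u \<and> (\<forall>r'\<in>T u. \<bar>r\<bar> \<le> \<bar>r'\<bar>)"
    then have abs: "\<bar>r\<bar> = \<bar>s\<bar>"
      using s by (intro antisym) auto
    show "r = s"
    proof (rule ccontr)
      assume "r \<noteq> s"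
      then have "r = - s"
        using abs by linarith
      then have "h (- \<bar>s\<bar>) = u" "h \<bar>s\<bar> = u"
        using r s(1) unfolding T by (auto simp: abs_if)
      moreover have "h (- \<bar>s\<bar>) \<le> h 0" "h 0 \<le> h \<bar>s\<bar>"
        using monoD[OF inverse_operator_mono[OF assms]] by auto
      ultimately have "0 \<in> T u"
        unfolding T by simp
      then have "s = 0"
        using s(2) by fastforce
      with \<open>r = - s\<close> \<open>r \<noteq> s\<close> show False
        by simp
    qed
  qed (use s in blast)
  with s(1) show ?thesis
    by simp
qed

text \<open>
  Measurability in \<open>x\<close> is assumed for the least elements of \<open>\<theta> x u\<close>; this expresses the superlevel
  sets of \<open>\<eta>\<close> through countably many of them.
\<close>

lemma inverse_operator_gt_iff:
  assumes "inverse_operator T h"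
  shows "a < h k \<longleftrightarrow> (\<exists>u\<in>\<rat>. a < u \<and> least_abs (T u) < k)"
proof
  have h_least: "h (least_abs (T u)) = u" for u
    using least_abs_mem[OF assms] assms unfolding inverse_operator_def by metis
  {
    assume "a < h k"
    then obtain u where u: "u \<in> \<rat>" "a < u" "u < h k"
      using Rats_dense_in_real by blast
    have "least_abs (T u) < k"
    proof (rule ccontr)
      assume "\<not> least_abs (T u) < k"
      then have "h k \<le> h (least_abs (T u))"
        by (intro monoD[OF inverse_operator_mono[OF assms]]) simp
      with u(3) show False
        by (simp add: h_least)
    qed
    with u show "\<exists>u\<in>\<rat>. a < u \<and> least_abs (T u) < k"
      by blast
  next
    assume "\<exists>u\<in>\<rat>. a < u \<and> least_abs (T u) < k"
    then obtain u where u: "a < u" "least_abs (T u) < k"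
      by blast
    have "h (least_abs (T u)) \<le> h k"
      using u(2) by (intro monoD[OF inverse_operator_mono[OF assms]]) simp
    with u(1) show "a < h k"
      by (simp add: h_least)
  }
qed

lemma structure_inverse:
  assumes "structure_condition A \<theta> \<eta>"
  shows "AE x in lebesgue. inverse_operator (\<theta> x) (\<eta> x)"
proof -
  have 1: "AE x in lebesgue. maximal_monotone (\<theta> x) \<and> 0 \<in> \<theta> x 0"
    and 2: "AE x in lebesgue. (\<forall>s u. u = \<eta> x s \<longleftrightarrow> s \<in> \<theta> x u) \<and> continuous_on UNIV (\<eta> x)"
    and 3: "\<forall>x u. \<theta> x u \<noteq> {}"
    using assms unfolding structure_condition_def by blast+
  from 1 2 show ?thesis
    by eventually_elim (simp add: inverse_operator_def maximal_monotone_def 3)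
qed

lemma eta_measurable:
  assumes st: "structure_condition A \<theta> \<eta>"
  shows "(\<lambda>x. \<eta> x k) \<in> borel_measurable lebesgue"
proof -
  have "(\<lambda>x. least_abs (\<theta> x u)) \<in> borel_measurable lebesgue" for u
  proof (rule borel_measurable_of_compacts)
    fix K :: "(real ^ 'a) set"
    assume "compact K"
    then have "set_integrable lebesgue K (\<lambda>x. least_abs (\<theta> x u))"
      using st unfolding structure_condition_def L1_loc_space_def by blast
    then show "(\<lambda>x. indicator K x * least_abs (\<theta> x u)) \<in> borel_measurable lebesgue"
      unfolding set_integrable_def by (simp add: borel_measurable_integrable)
  qed
  note [measurable] = this
  show ?thesis
    unfolding borel_measurable_iff_greater
  proof
    fix a
    let ?G = "\<Union>u\<in>{u \<in> \<rat>. a < u}. {x \<in> space lebesgue. least_abs (\<theta> x u) < k}"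
    have "countable {u \<in> \<rat>. a < (u::real)}"
      by (rule countable_subset[OF _ countable_rat]) auto
    then have G: "?G \<in> sets lebesgue"
    proof (rule sets.countable_UN')
      have "{x \<in> space lebesgue. least_abs (\<theta> x u) < k} \<in> sets lebesgue" for u
        by measurable
      then show "(\<lambda>u. {x \<in> space lebesgue. least_abs (\<theta> x u) < k}) ` {u \<in> \<rat>. a < u} \<subseteq> sets lebesgue"
        by blast
    qed
    have ae: "AE x in lebesgue. x \<in> ?G \<longleftrightarrow> x \<in> {w \<in> space lebesgue. a < \<eta> w k}"
      using structure_inverse[OF st]
    proof eventually_elim
      case (elim x)
      from inverse_operator_gt_iff[OF this, of a k] show ?case
        by auto
    qed
    show "{w \<in> space lebesgue. a < \<eta> w k} \<in> sets lebesgue"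
      by (rule completion.in_sets_AE[OF ae G]) simp
  qed
qed

text \<open>
  Outside one null set of \<open>x\<close>, the functions \<open>\<eta> x q\<close> with rational \<open>q\<close> agree with Borel functions;
  continuity extends this to all \<open>k\<close>. The bound comes from the growth condition: \<open>h1 (\<eta> x k) \<le> \<bar>k\<bar>\<close>
  since \<open>k\<close> belongs to \<open>\<theta> x (\<eta> x k)\<close>, and \<open>h1\<close> tends to infinity.
\<close>

lemma eta_borel_representative:
  fixes \<eta> :: "real ^ 'n \<Rightarrow> real \<Rightarrow> real"
  assumes st: "structure_condition A \<theta> \<eta>" and gr: "growth_condition \<theta>"
  obtains e B where "(\<lambda>(x, k). e x k) \<in> borel_measurable (borel \<Otimes>\<^sub>M borel)"
    "\<And>x. mono (e x)" "\<And>x. continuous_on UNIV (e x)" "\<And>x k. \<bar>k\<bar> \<le> M \<Longrightarrow> \<bar>e x k\<bar> \<le> B"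
    "AE x in lborel. e x = \<eta> x"
proof -
  obtain h1 h2 where h: "filterlim h1 at_top at_infinity"
    "AE x in lebesgue. \<forall>u. \<forall>s\<in>\<theta> x u. h1 u \<le> \<bar>s\<bar> \<and> \<bar>s\<bar> \<le> (h2 u :: real)"
    using gr unfolding growth_condition_def by blast
  have "\<forall>\<^sub>F u in at_infinity. M + 1 \<le> h1 u"
    using h(1) unfolding filterlim_at_top by blast
  then obtain B where B: "\<And>u :: real. B \<le> norm u \<Longrightarrow> M + 1 \<le> h1 u"
    unfolding eventually_at_infinity by blast
  have "\<exists>f\<in>borel_measurable lborel. AE x in lborel. \<eta> x q = f x" for q
    by (rule completion_ex_borel_measurable_real[OF eta_measurable[OF st]])
  then obtain f where f: "\<And>q. f q \<in> borel_measurable lborel" "\<And>q. AE x in lborel. \<eta> x q = f q x"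
    by metis
  have "AE x in lborel. \<forall>q\<in>\<rat>. \<eta> x q = f q x"
    using f(2) by (intro AE_ball_countable' countable_rat) auto
  moreover have "AE x in lborel. inverse_operator (\<theta> x) (\<eta> x)"
    using structure_inverse[OF st] by (simp add: AE_completion_iff)
  moreover have "AE x in lborel. \<forall>u. \<forall>s\<in>\<theta> x u. h1 u \<le> \<bar>s\<bar> \<and> \<bar>s\<bar> \<le> h2 u"
    using h(2) by (simp add: AE_completion_iff)
  ultimately have "AE x in lborel. (\<forall>q\<in>\<rat>. \<eta> x q = f q x) \<and> inverse_operator (\<theta> x) (\<eta> x)
      \<and> (\<forall>u. \<forall>s\<in>\<theta> x u. h1 u \<le> \<bar>s\<bar> \<and> \<bar>s\<bar> \<le> h2 u)"
    by eventually_elim blast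
  from AE_E3[OF this] obtain N where N: "N \<in> null_sets lborel"
    and *: "\<And>x. x \<in> space lborel - N \<Longrightarrow> (\<forall>q\<in>\<rat>. \<eta> x q = f q x) \<and> inverse_operator (\<theta> x) (\<eta> x)
      \<and> (\<forall>u. \<forall>s\<in>\<theta> x u. h1 u \<le> \<bar>s\<bar> \<and> \<bar>s\<bar> \<le> h2 u)"
    by metis
  have good: "x \<notin> N \<Longrightarrow> q \<in> \<rat> \<Longrightarrow> \<eta> x q = f q x"
      "x \<notin> N \<Longrightarrow> inverse_operator (\<theta> x) (\<eta> x)"
      "x \<notin> N \<Longrightarrow> s \<in> \<theta> x u \<Longrightarrow> h1 u \<le> \<bar>s\<bar>" for x q s u
    using *[of x] by simp_all
  have [measurable]: "N \<in> sets borel"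
    using N by auto
  define e where "e x k = (if x \<in> N then 0 else \<eta> x k)" for x k
  have e_eq: "x \<notin> N \<Longrightarrow> e x = \<eta> x" "x \<in> N \<Longrightarrow> e x = (\<lambda>_. 0)" for x
    by (simp_all add: e_def fun_eq_iff)
  have cont: "continuous_on UNIV (e x)" for x
  proof (cases "x \<in> N")
    case False
    show ?thesis
      unfolding e_eq(1)[OF False] by (rule inverse_operator_continuous[OF good(2)[OF False]])
  qed (simp add: e_eq(2))
  show thesis
  proof (rule that[of e "max B 0"])
    show "(\<lambda>(x, k). e x k) \<in> borel_measurable (borel \<Otimes>\<^sub>M borel)"
    proof -
      have "(\<lambda>p :: (real ^ 'n) \<times> real. e (fst p) (snd p)) \<in> borel_measurable (borel \<Otimes>\<^sub>M borel)"
      proof (rule caratheodory_measurable[where f = "\<lambda>p. e (fst p)" and v = snd])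
        fix q :: real
        assume "q \<in> \<rat>"
        then have eq: "(\<lambda>p :: (real ^ 'n) \<times> real. e (fst p) q) = (\<lambda>p. indicator (- N) (fst p) * f q (fst p))"
          using good(1) by (auto simp: e_def)
        have [measurable]: "f q \<in> borel_measurable borel"
          using f(1) by simp
        show "(\<lambda>p :: (real ^ 'n) \<times> real. e (fst p) q) \<in> borel_measurable (borel \<Otimes>\<^sub>M borel)"
          unfolding eq by measurable
      qed (use cont in simp_all)
      then show ?thesis
        by (simp add: case_prod_unfold)
    qed
    show "mono (e x)" for x
    proof (cases "x \<in> N")
      case False
      show ?thesis
        unfolding e_eq(1)[OF False] by (rule inverse_operator_mono[OF good(2)[OF False]])
    qed (simp add: e_eq(2) monoI)
    show "continuous_on UNIV (e x)" for x
      by (rule cont)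
    show "\<bar>e x k\<bar> \<le> max B 0" if "\<bar>k\<bar> \<le> M" for x k
    proof (cases "x \<in> N")
      case False
      from good(3)[OF False inverse_operator_mem[OF good(2)[OF False]], of k] that
      have "h1 (\<eta> x k) \<le> M"
        by linarith
      then have "\<bar>\<eta> x k\<bar> < B"
        using B[of "\<eta> x k"] by (cases "B \<le> \<bar>\<eta> x k\<bar>") auto
      with False show ?thesis
        by (simp add: e_def)
    qed (simp add: e_def)
    show "AE x in lborel. e x = \<eta> x"
      using AE_not_in[OF N] by eventually_elim (simp add: e_def fun_eq_iff)
  qed
qed

lemma L_inf_borel_representative:
  assumes "L_inf v"
  obtains v' C where "v' \<in> borel_measurable borel" "\<And>z. \<bar>v' z\<bar> \<le> C"
    "AE z in lebesgue. z \<in> time_space \<longrightarrow> v z = v' z"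
proof -
  have v: "v \<in> borel_measurable (lebesgue_on time_space)"
    using assms by (simp add: L_inf_def)
  obtain C where C: "AE z in lebesgue. z \<in> time_space \<longrightarrow> \<bar>v z\<bar> \<le> C"
    using assms by (auto simp: L_inf_def)
  have "time_space \<in> sets (lebesgue :: (real \<times> (real ^ 'a)) measure)"
    by (intro sets_completionI_sets) (simp add: open_Times borel_open)
  then have "(\<lambda>z. if z \<in> time_space then v z else 0) \<in> borel_measurable lebesgue"
    using v by (simp only: borel_measurable_if)
  then obtain w where w: "w \<in> borel_measurable lborel"
    "AE z in lborel. (if z \<in> time_space then v z else 0) = w z"
    using completion_ex_borel_measurable_real by blast
  let ?v = "\<lambda>z. max (- max C 0) (min (max C 0) (w z))"
  show thesis
  proof (rule that[of ?v "max C 0"])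
    show "?v \<in> borel_measurable borel"
      using w(1) by simp
    show "\<bar>?v z\<bar> \<le> max C 0" for z
      by linarith
    show "AE z in lebesgue. z \<in> time_space \<longrightarrow> v z = ?v z"
      using C AE_completion[OF w(2)] by eventually_elim (auto simp: abs_le_iff)
  qed
qed

text \<open>
  Dominates the source along a bounded solution by its values at the two constants \<open>M\<close> and \<open>- M\<close>, which
  are locally integrable.
\<close>

lemma decreasing_abs_le:
  fixes F :: "real \<Rightarrow> real"
  assumes F: "\<And>r s. (F r - F s) * (r - s) \<le> 0" and "F 0 = 0" and "\<bar>r\<bar> \<le> M"
  shows "\<bar>F r\<bar> \<le> \<bar>F M\<bar> + \<bar>F (- M)\<bar>"
proof -
  have mono: "F s \<le> F r" if "r \<le> s" for r s
  proof (cases "r = s")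
    case False
    then have "0 \<le> F r - F s"
      using F[of r s] that by (simp add: mult_le_0_iff)
    then show ?thesis
      by simp
  qed simp
  show ?thesis
    using mono[of "- M" r] mono[of r M] mono[of 0 r] mono[of r 0] assms(2,3)
    by (cases "0 \<le> r") (auto simp: abs_le_iff)
qed

lemma source_borel_representative:
  fixes f :: "real \<Rightarrow> real ^ 'n \<Rightarrow> real \<Rightarrow> real"
  assumes src: "source_condition f" and v: "v \<in> borel_measurable borel" "\<And>z. \<bar>v z\<bar> \<le> M"
  obtains g where "g \<in> borel_measurable borel" "\<And>S. compact S \<Longrightarrow> set_integrable lborel S g"
    "AE z in lebesgue. z \<in> time_space \<longrightarrow> f (fst z) (snd z) (v z) = g z"
proof -
  define good where "good z \<longleftrightarrow> z \<in> time_space \<and> continuous_on UNIV (f (fst z) (snd z))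
    \<and> f (fst z) (snd z) 0 = 0
    \<and> (\<forall>r s. (f (fst z) (snd z) r - f (fst z) (snd z) s) * (r - s) \<le> 0)" for z
  have "AE z in lebesgue. 0 < fst z \<longrightarrow> continuous_on UNIV (f (fst z) (snd z)) \<and> f (fst z) (snd z) 0 = 0"
    "AE z in lebesgue. 0 < fst z \<longrightarrow> (\<forall>r s. (f (fst z) (snd z) r - f (fst z) (snd z) s) * (r - s) \<le> 0)"
    using src unfolding source_condition_def case_prod_unfold by blast+
  then have good: "AE z in lebesgue. z \<in> time_space \<longrightarrow> good z"
    by eventually_elim (auto simp: good_def)
  define F where "F z r = (if good z then f (fst z) (snd z) r else 0)" for z r
  have F_int: "set_integrable lebesgue S (\<lambda>z. F z r)" if S: "compact S" for S r
  proof -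
    have "compact (fst ` S)" "compact (snd ` S)"
      using S by (intro compact_continuous_image continuous_intros; simp)+
    obtain T where T: "\<forall>t\<in>fst ` S. norm t \<le> T"
      using compact_imp_bounded[OF \<open>compact (fst ` S)\<close>] unfolding bounded_iff by blast
    let ?D = "{0<..<\<bar>T\<bar> + 1} \<times> snd ` S"
    have "set_integrable lebesgue ?D (\<lambda>z. f (fst z) (snd z) r)"
      using src \<open>compact (snd ` S)\<close>
      unfolding source_condition_def L1_loc_time_space_def case_prod_unfold by auto
    moreover have "S \<inter> time_space \<in> sets borel"
      by (intro sets.Int[OF borel_compact[OF S]] borel_open open_Times) auto
    then have "S \<inter> time_space \<in> sets lebesgue"
      by (intro sets_completionI_sets) simp
    moreover have "S \<inter> time_space \<subseteq> ?D"
      using T by (force simp: image_iff)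
    ultimately have "set_integrable lebesgue (S \<inter> time_space) (\<lambda>z. f (fst z) (snd z) r)"
      by (blast intro: set_integrable_subset)
    then have int: "integrable lebesgue (\<lambda>z. indicator (S \<inter> time_space) z *\<^sub>R f (fst z) (snd z) r)"
      by (simp add: set_integrable_def)
    have ae: "AE z in lebesgue. indicator (S \<inter> time_space) z *\<^sub>R f (fst z) (snd z) r = indicator S z *\<^sub>R F z r"
      using good by eventually_elim (auto simp: F_def good_def indicator_def)
    have "(\<lambda>z. indicator S z *\<^sub>R F z r) \<in> borel_measurable lebesgue"
      by (rule borel_measurable_AE[OF borel_measurable_integrable[OF int] ae])
    then show ?thesis
      unfolding set_integrable_def by (rule integrable_cong_AE_imp[OF int _ ae])
  qed
  have F_meas: "(\<lambda>z. F z r) \<in> borel_measurable lebesgue" for r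
  proof (rule borel_measurable_of_compacts)
    fix S :: "(real \<times> (real ^ 'n)) set"
    assume "compact S"
    from borel_measurable_integrable[OF F_int[OF this, unfolded set_integrable_def]]
    show "(\<lambda>z. indicator S z * F z r) \<in> borel_measurable lebesgue"
      by (simp only: real_scaleR_def)
  qed
  have h_meas: "(\<lambda>z. F z (v z)) \<in> borel_measurable lebesgue"
  proof (rule caratheodory_measurable[where f = F and v = v])
    show "continuous_on UNIV (F z)" for z
    proof (cases "good z")
      case True
      then have "F z = f (fst z) (snd z)"
        by (simp add: F_def fun_eq_iff)
      with True show ?thesis
        by (simp add: good_def)
    next
      case False
      then have "F z = (\<lambda>_. 0)"
        by (simp add: F_def fun_eq_iff)
      then show ?thesis
        by simp
    qed
    show "v \<in> borel_measurable lebesgue"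
      using v(1) by (intro measurable_completion) simp
  qed (rule F_meas)
  obtain g where g: "g \<in> borel_measurable lborel" "AE z in lborel. F z (v z) = g z"
    using completion_ex_borel_measurable_real[OF h_meas] by blast
  show thesis
  proof (rule that[of g])
    show "g \<in> borel_measurable borel"
      using g(1) by simp
    show "AE z in lebesgue. z \<in> time_space \<longrightarrow> f (fst z) (snd z) (v z) = g z"
      using AE_completion[OF g(2)] good
    proof eventually_elim
      case (elim z)
      show ?case
      proof
        assume "z \<in> time_space"
        with elim(2) have "good z"
          by (rule mp)
        with elim(1) show "f (fst z) (snd z) (v z) = g z"
          by (simp add: F_def)
      qed
    qed
    show "set_integrable lborel S g" if S: "compact S" for S
    proof -
      have [measurable]: "S \<in> sets borel"
        using S by (rule borel_compact)
      have [measurable]: "g \<in> borel_measurable borel"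
        using g(1) by simp
      have meas: "(\<lambda>z. indicator S z *\<^sub>R g z) \<in> borel_measurable lborel"
        by measurable
      have "integrable lebesgue (\<lambda>z. \<bar>indicator S z *\<^sub>R F z M\<bar> + \<bar>indicator S z *\<^sub>R F z (- M)\<bar>)"
        using F_int[OF S, unfolded set_integrable_def]
        by (intro Bochner_Integration.integrable_add integrable_abs)
      then have "integrable lebesgue (\<lambda>z. indicator S z *\<^sub>R g z)"
      proof (rule Bochner_Integration.integrable_bound)
        show "(\<lambda>z. indicator S z *\<^sub>R g z) \<in> borel_measurable lebesgue"
          using meas by (rule measurable_completion)
        show "AE z in lebesgue. norm (indicator S z *\<^sub>R g z)
            \<le> norm (\<bar>indicator S z *\<^sub>R F z M\<bar> + \<bar>indicator S z *\<^sub>R F z (- M)\<bar>)"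
          using AE_completion[OF g(2)]
        proof eventually_elim
          case (elim z)
          have "\<bar>F z (v z)\<bar> \<le> \<bar>F z M\<bar> + \<bar>F z (- M)\<bar>"
          proof (cases "good z")
            case True
            have "\<bar>f (fst z) (snd z) (v z)\<bar> \<le> \<bar>f (fst z) (snd z) M\<bar> + \<bar>f (fst z) (snd z) (- M)\<bar>"
              by (rule decreasing_abs_le) (use True v(2) in \<open>simp_all add: good_def\<close>)
            with True show ?thesis
              by (simp add: F_def)
          qed (simp add: F_def)
          with elim show ?case
            by (simp add: indicator_def)
        qed
      qed
      then show ?thesis
        unfolding set_integrable_def using meas by (simp add: integrable_completion)
    qed
  qed
qed

text \<open>
  The representatives agree with the data almost everywhere on the domain, and the test function
  vanishes elsewhere, in particular at time \<open>0\<close>, which removes the initial datum.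
\<close>

lemma entropy_inequalities_lborel:
  fixes v v' g :: "real \<times> (real ^ 'n) \<Rightarrow> real" and e :: "real ^ 'n \<Rightarrow> real \<Rightarrow> real"
  assumes sol: "entropy_weak_solution A \<eta> f u0 v"
    and A: "continuous_on UNIV A"
    and e: "(\<lambda>(x, k). e x k) \<in> borel_measurable (borel \<Otimes>\<^sub>M borel)"
    and [measurable]: "v' \<in> borel_measurable borel" "g \<in> borel_measurable borel"
    and eq: "AE x in lborel. e x = \<eta> x"
      "AE z in lebesgue. z \<in> time_space \<longrightarrow> v z = v' z"
      "AE z in lebesgue. z \<in> time_space \<longrightarrow> f (fst z) (snd z) (v' z) = g z"
    and \<phi>: "\<phi> \<in> test_functions time_space" "\<And>z. 0 \<le> \<phi> z"
  shows "0 \<le> (\<integral>z. max (e (snd z) (v' z) - e (snd z) k) 0 * d_t \<phi> z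
        + of_bool (v' z > k) * ((A (v' z) - A k) \<bullet> grad_x \<phi> z)
        + of_bool (v' z > k) * g z * \<phi> z \<partial>lborel)" (is "0 \<le> (\<integral>z. ?h1 z \<partial>lborel)")
    and "0 \<le> (\<integral>z. max (e (snd z) k - e (snd z) (v' z)) 0 * d_t \<phi> z
        + of_bool (k > v' z) * ((A k - A (v' z)) \<bullet> grad_x \<phi> z)
        - of_bool (k > v' z) * g z * \<phi> z \<partial>lborel)" (is "0 \<le> (\<integral>z. ?h2 z \<partial>lborel)")
proof -
  note \<phi>D = test_functionsD[OF \<phi>(1)]
  have [measurable]: "\<phi> \<in> borel_measurable borel" "d_t \<phi> \<in> borel_measurable borel"
    "grad_x \<phi> \<in> borel_measurable borel" "A \<in> borel_measurable borel"
    using smooth_continuous continuous_on_d_t continuous_on_grad_x \<phi>D(1) A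
    by (blast intro: borel_measurable_continuous_onI)+
  have [measurable]: "snd \<in> (borel :: (real \<times> (real ^ 'n)) measure) \<rightarrow>\<^sub>M borel"
    by (intro borel_measurable_continuous_onI continuous_intros)
  have [measurable]: "(\<lambda>z. e (snd z) (v' z)) \<in> borel_measurable borel"
    "(\<lambda>z :: real \<times> (real ^ 'n). e (snd z) k) \<in> borel_measurable borel"
    by (rule borel_measurable_apply[OF e]; measurable)+
  have h: "?h1 \<in> borel_measurable borel" "?h2 \<in> borel_measurable borel"
    by measurable
  have out: "\<phi> z = 0" "d_t \<phi> z = 0" "grad_x \<phi> z = 0" if "z \<notin> time_space" for z
    using that \<phi>D(3) zero_outside_support[of z \<phi>] d_t_outside_support[of z \<phi>] grad_x_outside_support[of z \<phi>]
    by blast+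
  have \<phi>_UNIV: "\<phi> \<in> test_functions UNIV"
    using \<phi>(1) by (simp add: test_functions_def)
  have eq': "AE z in (lebesgue :: (real \<times> (real ^ 'n)) measure). e (snd z) = \<eta> (snd z)"
    by (rule AE_completion[OF AE_lborel_snd[OF eq(1)]])
  have init: "\<phi> (0, x) = 0" for x
    by (rule out) simp
  have 1: "(LINT (t, x) : time_space | lebesgue.
          max (\<eta> x (v (t, x)) - \<eta> x k) 0 * d_t \<phi> (t, x)
        + of_bool (v (t, x) > k) * ((A (v (t, x)) - A k) \<bullet> grad_x \<phi> (t, x))
        + of_bool (v (t, x) > k) * f t x (v (t, x)) * \<phi> (t, x)) = (\<integral>z. ?h1 z \<partial>lborel)"
  proof (rule set_integral_eq_lborel[OF h(1)])
    show "AE z in lebesgue. indicator time_space z * (case z of (t, x) \<Rightarrow>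
          max (\<eta> x (v (t, x)) - \<eta> x k) 0 * d_t \<phi> (t, x)
        + of_bool (v (t, x) > k) * ((A (v (t, x)) - A k) \<bullet> grad_x \<phi> (t, x))
        + of_bool (v (t, x) > k) * f t x (v (t, x)) * \<phi> (t, x)) = ?h1 z"
      using eq' eq(2,3)
    proof eventually_elim
      case (elim z)
      show ?case
      proof (cases "z \<in> time_space")
        case True
        with elim show ?thesis
          by (cases z) simp
      next
        case False
        from out[OF this] False show ?thesis
          by (simp only: indicator_simps mult_zero_left mult_zero_right inner_zero_right) simp
      qed
    qed
  qed
  have 2: "(LINT (t, x) : time_space | lebesgue.
          max (\<eta> x k - \<eta> x (v (t, x))) 0 * d_t \<phi> (t, x)
        + of_bool (k > v (t, x)) * ((A k - A (v (t, x))) \<bullet> grad_x \<phi> (t, x))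
        - of_bool (k > v (t, x)) * f t x (v (t, x)) * \<phi> (t, x)) = (\<integral>z. ?h2 z \<partial>lborel)"
  proof (rule set_integral_eq_lborel[OF h(2)])
    show "AE z in lebesgue. indicator time_space z * (case z of (t, x) \<Rightarrow>
          max (\<eta> x k - \<eta> x (v (t, x))) 0 * d_t \<phi> (t, x)
        + of_bool (k > v (t, x)) * ((A k - A (v (t, x))) \<bullet> grad_x \<phi> (t, x))
        - of_bool (k > v (t, x)) * f t x (v (t, x)) * \<phi> (t, x)) = ?h2 z"
      using eq' eq(2,3)
    proof eventually_elim
      case (elim z)
      show ?case
      proof (cases "z \<in> time_space")
        case True
        with elim show ?thesis
          by (cases z) simp
      next
        case False
        from out[OF this] False show ?thesis
          by (simp only: indicator_simps mult_zero_left mult_zero_right inner_zero_right) simp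
      qed
    qed
  qed
  note ent = sol[unfolded entropy_weak_solution_def, THEN conjunct2, THEN conjunct2, THEN conjunct2,
      THEN conjunct2, THEN bspec, OF \<phi>_UNIV, THEN mp, OF allI, OF \<phi>(2), THEN spec, of k]
  from ent[unfolded 1 2] show "0 \<le> (\<integral>z. ?h1 z \<partial>lborel)" "0 \<le> (\<integral>z. ?h2 z \<partial>lborel)"
    by (simp_all add: init)
qed

section \<open>Comparison of two solutions\<close>

text \<open>
  The four integrals of the second inequality are those of Kato's inequality for Borel representatives
  of \<open>(v1, v2)\<close>. Adding the same inequality for \<open>(v2, v1)\<close> yields the first one, as
  \<open>\<bar>r\<bar> = max r 0 + max (- r) 0\<close> and \<open>sgn r = of_bool (r > 0) - of_bool (r < 0)\<close>.
\<close>

theorem lemma2p2: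
  fixes A :: "real \<Rightarrow> real ^ 'n"
    and \<theta> :: "real ^ 'n \<Rightarrow> real \<Rightarrow> real set"
    and \<eta> :: "real ^ 'n \<Rightarrow> real \<Rightarrow> real"
    and f1 f2 :: "real \<Rightarrow> real ^ 'n \<Rightarrow> real \<Rightarrow> real"
    and u01 u02 :: "real ^ 'n \<Rightarrow> real"
    and v1 v2 :: "real \<times> (real ^ 'n) \<Rightarrow> real"
  assumes "structure_condition A \<theta> \<eta>"
    and "growth_condition \<theta>"
    and "flux_condition A \<eta>"
    and "source_condition f1"
    and "source_condition f2"
    and "entropy_weak_solution A \<eta> f1 u01 v1"
    and "entropy_weak_solution A \<eta> f2 u02 v2"
  shows "(\<forall>\<psi> \<in> test_functions time_space. (\<forall>z. 0 \<le> \<psi> z) \<longrightarrow>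
      (LINT (t, x) : time_space | lebesgue.
          \<bar>\<eta> x (v1 (t, x)) - \<eta> x (v2 (t, x))\<bar> * d_t \<psi> (t, x))
    + (LINT (t, x) : time_space | lebesgue.
          sgn (v1 (t, x) - v2 (t, x)) * ((A (v1 (t, x)) - A (v2 (t, x))) \<bullet> grad_x \<psi> (t, x)))
    + (LINT (t, x) : time_space | lebesgue.
          sgn (v1 (t, x) - v2 (t, x)) * (f1 t x (v1 (t, x)) - f2 t x (v2 (t, x))) * \<psi> (t, x))
    \<ge> - (LINT (t, x) : {(t, x). 0 < t \<and> v1 (t, x) = v2 (t, x)} | lebesgue.
          \<bar>f1 t x (v1 (t, x)) - f2 t x (v2 (t, x))\<bar> * \<psi> (t, x)))
  \<and> (\<forall>\<psi> \<in> test_functions time_space. (\<forall>z. 0 \<le> \<psi> z) \<longrightarrow>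
      (LINT (t, x) : time_space | lebesgue.
          max (\<eta> x (v1 (t, x)) - \<eta> x (v2 (t, x))) 0 * d_t \<psi> (t, x))
    + (LINT (t, x) : time_space | lebesgue.
          of_bool (v1 (t, x) > v2 (t, x)) * ((A (v1 (t, x)) - A (v2 (t, x))) \<bullet> grad_x \<psi> (t, x)))
    + (LINT (t, x) : time_space | lebesgue.
          of_bool (v1 (t, x) > v2 (t, x)) * (f1 t x (v1 (t, x)) - f2 t x (v2 (t, x))) * \<psi> (t, x))
    \<ge> - (LINT (t, x) : {(t, x). 0 < t \<and> v1 (t, x) = v2 (t, x)} | lebesgue.
          max (f1 t x (v1 (t, x)) - f2 t x (v2 (t, x))) 0 * \<psi> (t, x)))"
proof -
  note st = assms(1) and gr = assms(2) and src = assms(4,5) and sol = assms(6,7)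
  have A: "continuous_on UNIV A"
    using st by (simp add: structure_condition_def)
  have v_inf: "L_inf v1" "L_inf v2"
    using sol by (simp_all add: entropy_weak_solution_def)
  obtain w1 C1 where w1: "w1 \<in> borel_measurable borel" "\<And>z. \<bar>w1 z\<bar> \<le> C1"
      "AE z in lebesgue. z \<in> time_space \<longrightarrow> v1 z = w1 z"
    by (rule L_inf_borel_representative[OF v_inf(1)]) (rule that; assumption)
  obtain w2 C2 where w2: "w2 \<in> borel_measurable borel" "\<And>z. \<bar>w2 z\<bar> \<le> C2"
      "AE z in lebesgue. z \<in> time_space \<longrightarrow> v2 z = w2 z"
    by (rule L_inf_borel_representative[OF v_inf(2)]) (rule that; assumption)
  define M where "M = max C1 C2"
  have M: "\<bar>w1 z\<bar> \<le> M" "\<bar>w2 z\<bar> \<le> M" for z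
    using w1(2)[of z] w2(2)[of z] by (auto simp: M_def)
  obtain e B where e: "(\<lambda>(x, k). e x k) \<in> borel_measurable (borel \<Otimes>\<^sub>M borel)"
      "\<And>x. mono (e x)" "\<And>x. continuous_on UNIV (e x)" "\<And>x k. \<bar>k\<bar> \<le> M \<Longrightarrow> \<bar>e x k\<bar> \<le> B"
    and e_eq: "AE x in lborel. e x = \<eta> x"
    by (rule eta_borel_representative[OF st gr, of M]) (rule that; assumption)
  obtain g1 where g1: "g1 \<in> borel_measurable borel" "\<And>S. compact S \<Longrightarrow> set_integrable lborel S g1"
      "AE z in lebesgue. z \<in> time_space \<longrightarrow> f1 (fst z) (snd z) (w1 z) = g1 z"
    by (rule source_borel_representative[OF src(1) w1(1) M(1)]) (rule that; assumption)
  obtain g2 where g2: "g2 \<in> borel_measurable borel" "\<And>S. compact S \<Longrightarrow> set_integrable lborel S g2"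
      "AE z in lebesgue. z \<in> time_space \<longrightarrow> f2 (fst z) (snd z) (w2 z) = g2 z"
    by (rule source_borel_representative[OF src(2) w2(1) M(2)]) (rule that; assumption)
  note ent1 = entropy_inequalities_lborel[OF sol(1) A e(1) w1(1) g1(1) e_eq w1(3) g1(3)]
  note ent2 = entropy_inequalities_lborel[OF sol(2) A e(1) w2(1) g2(1) e_eq w2(3) g2(3)]
  interpret P: entropy_pair e A M B w1 w2 g1 g2
    by (unfold_locales; (fact e A w1(1) w2(1) g1(1) g2(1) M g1(2) g2(2) ent1(1) ent2(2))?)
  interpret Q: entropy_pair e A M B w2 w1 g2 g1
    by (unfold_locales; (fact e A w1(1) w2(1) g1(1) g2(1) M g1(2) g2(2) ent2(1) ent1(2))?)
  have rep: "AE z in lebesgue. e (snd z) = \<eta> (snd z)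
      \<and> (z \<in> time_space \<longrightarrow> v1 z = w1 z \<and> v2 z = w2 z
        \<and> f1 (fst z) (snd z) (w1 z) = g1 z \<and> f2 (fst z) (snd z) (w2 z) = g2 z)"
    using AE_completion[OF AE_lborel_snd[OF e_eq]] w1(3) w2(3) g1(3) g2(3)
  proof eventually_elim
    case (elim z)
    then show ?case
      by (cases "z \<in> time_space") simp_all
  qed
  have transfer: "(LINT z : \<Omega> | lebesgue. F z) = (\<integral>z. h z \<partial>lborel)"
    if "integrable lborel h"
      and "\<And>z. z \<notin> time_space \<Longrightarrow> indicator \<Omega> z * F z = h z"
      and "\<And>t x. 0 < t \<Longrightarrow> e x = \<eta> x \<Longrightarrow> v1 (t, x) = w1 (t, x) \<Longrightarrow> v2 (t, x) = w2 (t, x) \<Longrightarrow>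
        f1 t x (w1 (t, x)) = g1 (t, x) \<Longrightarrow> f2 t x (w2 (t, x)) = g2 (t, x) \<Longrightarrow>
        indicator \<Omega> (t, x) * F (t, x) = h (t, x)"
    for \<Omega> and F h :: "real \<times> (real ^ 'n) \<Rightarrow> real"
  proof (rule set_integral_eq_lborel)
    show "h \<in> borel_measurable borel"
      using borel_measurable_integrable[OF that(1)] by simp
    show "AE z in lebesgue. indicator \<Omega> z * F z = h z"
      using rep
    proof eventually_elim
      case (elim z)
      show ?case
      proof (cases "z \<in> time_space")
        case True
        then show ?thesis
          using elim that(3)[of "fst z" "snd z"] by (cases z) auto
      qed (rule that(2))
    qed
  qed
  show ?thesis
  proof (intro conjI ballI impI)
    fix \<psi> :: "real \<times> (real ^ 'n) \<Rightarrow> real"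
    assume \<psi>: "\<psi> \<in> test_functions time_space" and "\<forall>z. 0 \<le> \<psi> z"
    then have nonneg: "\<And>z. 0 \<le> \<psi> z"
      by blast
    have out: "\<psi> z = 0" "d_t \<psi> z = 0" "grad_x \<psi> z = 0" if "z \<notin> time_space" for z
      using that test_functionsD(3)[OF \<psi>] zero_outside_support[of z \<psi>] d_t_outside_support[of z \<psi>]
        grad_x_outside_support[of z \<psi>]
      by blast+
    note kato = P.kato_inequality_terms[OF \<psi> nonneg] Q.kato_inequality_terms[OF \<psi> nonneg]
    note iP = P.integrable_kato_terms[OF \<psi> nonneg] and iQ = Q.integrable_kato_terms[OF \<psi> nonneg]
    note defs = P.ent_def P.flux_def
    have P1: "(LINT (t, x) : time_space | lebesgue.
          max (\<eta> x (v1 (t, x)) - \<eta> x (v2 (t, x))) 0 * d_t \<psi> (t, x))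
        = (\<integral>z. P.ent (snd z) (w1 z) (w2 z) * d_t \<psi> z \<partial>lborel)"
      by (rule transfer[OF iP(1)]) (auto simp: defs out)
    have P2: "(LINT (t, x) : time_space | lebesgue.
          of_bool (v1 (t, x) > v2 (t, x)) * ((A (v1 (t, x)) - A (v2 (t, x))) \<bullet> grad_x \<psi> (t, x)))
        = (\<integral>z. P.flux (w1 z) (w2 z) \<bullet> grad_x \<psi> z \<partial>lborel)"
      by (rule transfer[OF iP(2)]) (auto simp: defs out)
    have P3: "(LINT (t, x) : time_space | lebesgue.
          of_bool (v1 (t, x) > v2 (t, x)) * (f1 t x (v1 (t, x)) - f2 t x (v2 (t, x))) * \<psi> (t, x))
        = (\<integral>z. of_bool (w1 z > w2 z) * (g1 z - g2 z) * \<psi> z \<partial>lborel)"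
      by (rule transfer[OF iP(3)]) (auto simp: out)
    have P4: "(LINT (t, x) : {(t, x). 0 < t \<and> v1 (t, x) = v2 (t, x)} | lebesgue.
          max (f1 t x (v1 (t, x)) - f2 t x (v2 (t, x))) 0 * \<psi> (t, x))
        = (\<integral>z. of_bool (w1 z = w2 z) * max (g1 z - g2 z) 0 * \<psi> z \<partial>lborel)"
      by (rule transfer[OF iP(4)]) (auto simp: out indicator_def)
    show "(LINT (t, x) : time_space | lebesgue.
          max (\<eta> x (v1 (t, x)) - \<eta> x (v2 (t, x))) 0 * d_t \<psi> (t, x))
    + (LINT (t, x) : time_space | lebesgue.
          of_bool (v1 (t, x) > v2 (t, x)) * ((A (v1 (t, x)) - A (v2 (t, x))) \<bullet> grad_x \<psi> (t, x)))
    + (LINT (t, x) : time_space | lebesgue.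
          of_bool (v1 (t, x) > v2 (t, x)) * (f1 t x (v1 (t, x)) - f2 t x (v2 (t, x))) * \<psi> (t, x))
    \<ge> - (LINT (t, x) : {(t, x). 0 < t \<and> v1 (t, x) = v2 (t, x)} | lebesgue.
          max (f1 t x (v1 (t, x)) - f2 t x (v2 (t, x))) 0 * \<psi> (t, x))"
      using kato(1) unfolding P1 P2 P3 P4 by linarith
    have Q1: "(LINT (t, x) : time_space | lebesgue.
          \<bar>\<eta> x (v1 (t, x)) - \<eta> x (v2 (t, x))\<bar> * d_t \<psi> (t, x))
        = (\<integral>z. P.ent (snd z) (w1 z) (w2 z) * d_t \<psi> z \<partial>lborel)
        + (\<integral>z. P.ent (snd z) (w2 z) (w1 z) * d_t \<psi> z \<partial>lborel)"
      unfolding Bochner_Integration.integral_add[OF iP(1) iQ(1), symmetric]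
      by (rule transfer[OF Bochner_Integration.integrable_add[OF iP(1) iQ(1)]])
        (auto simp: defs out max_def abs_if algebra_simps)
    have Q2: "(LINT (t, x) : time_space | lebesgue.
          sgn (v1 (t, x) - v2 (t, x)) * ((A (v1 (t, x)) - A (v2 (t, x))) \<bullet> grad_x \<psi> (t, x)))
        = (\<integral>z. P.flux (w1 z) (w2 z) \<bullet> grad_x \<psi> z \<partial>lborel)
        + (\<integral>z. P.flux (w2 z) (w1 z) \<bullet> grad_x \<psi> z \<partial>lborel)"
      unfolding Bochner_Integration.integral_add[OF iP(2) iQ(2), symmetric]
      by (rule transfer[OF Bochner_Integration.integrable_add[OF iP(2) iQ(2)]])
        (auto simp: defs out sgn_if inner_diff_left)
    have Q3: "(LINT (t, x) : time_space | lebesgue.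
          sgn (v1 (t, x) - v2 (t, x)) * (f1 t x (v1 (t, x)) - f2 t x (v2 (t, x))) * \<psi> (t, x))
        = (\<integral>z. of_bool (w1 z > w2 z) * (g1 z - g2 z) * \<psi> z \<partial>lborel)
        + (\<integral>z. of_bool (w2 z > w1 z) * (g2 z - g1 z) * \<psi> z \<partial>lborel)"
      unfolding Bochner_Integration.integral_add[OF iP(3) iQ(3), symmetric]
      by (rule transfer[OF Bochner_Integration.integrable_add[OF iP(3) iQ(3)]])
        (auto simp: out sgn_if algebra_simps)
    have Q4: "(LINT (t, x) : {(t, x). 0 < t \<and> v1 (t, x) = v2 (t, x)} | lebesgue.
          \<bar>f1 t x (v1 (t, x)) - f2 t x (v2 (t, x))\<bar> * \<psi> (t, x))
        = (\<integral>z. of_bool (w1 z = w2 z) * max (g1 z - g2 z) 0 * \<psi> z \<partial>lborel)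
        + (\<integral>z. of_bool (w2 z = w1 z) * max (g2 z - g1 z) 0 * \<psi> z \<partial>lborel)"
      unfolding Bochner_Integration.integral_add[OF iP(4) iQ(4), symmetric]
      by (rule transfer[OF Bochner_Integration.integrable_add[OF iP(4) iQ(4)]])
        (auto simp: out indicator_def max_def abs_if algebra_simps)
    show "(LINT (t, x) : time_space | lebesgue.
          \<bar>\<eta> x (v1 (t, x)) - \<eta> x (v2 (t, x))\<bar> * d_t \<psi> (t, x))
    + (LINT (t, x) : time_space | lebesgue.
          sgn (v1 (t, x) - v2 (t, x)) * ((A (v1 (t, x)) - A (v2 (t, x))) \<bullet> grad_x \<psi> (t, x)))
    + (LINT (t, x) : time_space | lebesgue.
          sgn (v1 (t, x) - v2 (t, x)) * (f1 t x (v1 (t, x)) - f2 t x (v2 (t, x))) * \<psi> (t, x))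
    \<ge> - (LINT (t, x) : {(t, x). 0 < t \<and> v1 (t, x) = v2 (t, x)} | lebesgue.
          \<bar>f1 t x (v1 (t, x)) - f2 t x (v2 (t, x))\<bar> * \<psi> (t, x))"
      using kato unfolding Q1 Q2 Q3 Q4 by linarith
  qed
qed

end
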